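(* Let $0<\beta_0<1/2$ and $k\in\mathbb{N}$. Suppose that $U:\mathbb{R}\to\mathbb{R}$ is infinitely differentiable and that $U$ and its derivatives of all orders are of moderate growth. Then there is a constant $K$ depending only on $k$, $U$ and $\beta_0$ such that for every $N\ge 1$, every $0<\beta\le\beta_0$ and every $h\in\mathbb{R}$, $$E\left[\left\langle U(l)\right\rangle-\int_{\mathbb{R}}U(x)\,\phi_{r,1-q}(x)\,dx\right]^{2k}\le\frac{K}{N^k},$$ where $l$ is the cavity field of the $N$-spin Sherrington-Kirkpatrick model at inverse temperature $\beta$ and external field $h$, $r=\langle l\rangle$, and $q$ is the constant defined in the context.
   Context: Sherrington-Kirkpatrick (SK) model: $\Sigma_N=\{-1,+1\}^N$; $\{g_{ij}\}_{1\le i<j\le N}$ are i.i.d. standard Gaussian random variables (the disorder), $g_{ij}=g_{ji}$. For $\beta>0$, $h\in\mathbb{R}$ the Hamiltonian is given by $-H_N(\sigma)=\frac{\beta}{\sqrt N}\sum_{i<j\le N}g_{ij}\sigma_i\sigma_j+h\sum_{i\le N}\sigma_i$ for $\sigma=(\sigma_1,\dots,\sigma_N)\in\Sigma_N$, and the Gibbs measure is $G_N(\{\sigma\})=\exp(-H_N(\sigma))/Z_N$ with $Z_N=\sum_{\sigma}\exp(-H_N(\sigma))$. For a function $f$ on $\Sigma_N$ (possibly also depending on other random variables, which are kept fixed), $\langle f\rangle=\sum_\sigma f(\sigma)G_N(\{\sigma\})$. $q$ is the unique solution of $q=E\tanh^2(\beta z\sqrt q+h)$, where $z$ is a standard Gaussian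 random variable. Let $g_1,\dots,g_N$ be i.i.d. standard Gaussian random variables independent of $\{g_{ij}\}_{i<j\le N}$. The cavity field is $l=\frac1{\sqrt N}\sum_{j=1}^N g_j\sigma_j$, and its quenched average is $r=\langle l\rangle=\frac1{\sqrt N}\sum_{j=1}^N g_j\langle\sigma_j\rangle$. $E$ denotes expectation over all the Gaussian variables $g_{ij}$, $g_j$. $\phi_{\mu,\sigma^2}$ denotes the Gaussian density with mean $\mu$ and variance $\sigma^2$. A continuous function $U:\mathbb{R}^d\to\mathbb{R}$ is of moderate growth if $\lim_{\|x\|\to\infty}U(x)\exp(-a\|x\|^2)=0$ for every $a>0$. *)

theory Defs
  imports "HOL-Probability.Probability"
begin

section \<open>The Sherrington--Kirkpatrick model\<close>

definition spins :: "nat \<Rightarrow> (nat \<Rightarrow> real) set" where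
  "spins N = {1..N} \<rightarrow>\<^sub>E {-1, 1}"

definition pairs :: "nat \<Rightarrow> (nat \<times> nat) set" where
  "pairs N = {(i, j). 1 \<le> i \<and> i < j \<and> j \<le> N}"

text \<open>Only the couplings \<open>G (i, j)\<close> with \<open>i < j\<close> enter, so the convention
  \<open>G (i, j) = G (j, i)\<close> is not needed.\<close>

definition hamiltonian ::
  "real \<Rightarrow> real \<Rightarrow> nat \<Rightarrow> (nat \<times> nat \<Rightarrow> real) \<Rightarrow> (nat \<Rightarrow> real) \<Rightarrow> real" where
  "hamiltonian \<beta> h N G \<sigma> =
     - (\<beta> / sqrt (real N) * (\<Sum>(i, j)\<in>pairs N. G (i, j) * \<sigma> i * \<sigma> j) + h * (\<Sum>i\<in>{1..N}. \<sigma> i))"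

definition partition_function ::
  "real \<Rightarrow> real \<Rightarrow> nat \<Rightarrow> (nat \<times> nat \<Rightarrow> real) \<Rightarrow> real" where
  "partition_function \<beta> h N G = (\<Sum>\<sigma>\<in>spins N. exp (- hamiltonian \<beta> h N G \<sigma>))"

definition gibbs_weight ::
  "real \<Rightarrow> real \<Rightarrow> nat \<Rightarrow> (nat \<times> nat \<Rightarrow> real) \<Rightarrow> (nat \<Rightarrow> real) \<Rightarrow> real" where
  "gibbs_weight \<beta> h N G \<sigma> = exp (- hamiltonian \<beta> h N G \<sigma>) / partition_function \<beta> h N G"

definition gibbs_average ::
  "real \<Rightarrow> real \<Rightarrow> nat \<Rightarrow> (nat \<times> nat \<Rightarrow> real) \<Rightarrow> ((nat \<Rightarrow> real) \<Rightarrow> real) \<Rightarrow> real" where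
  "gibbs_average \<beta> h N G f = (\<Sum>\<sigma>\<in>spins N. f \<sigma> * gibbs_weight \<beta> h N G \<sigma>)"

definition cavity_field :: "nat \<Rightarrow> (nat \<Rightarrow> real) \<Rightarrow> (nat \<Rightarrow> real) \<Rightarrow> real" where
  "cavity_field N g \<sigma> = 1 / sqrt (real N) * (\<Sum>j\<in>{1..N}. g j * \<sigma> j)"

definition quenched_cavity_field ::
  "real \<Rightarrow> real \<Rightarrow> nat \<Rightarrow> (nat \<times> nat \<Rightarrow> real) \<Rightarrow> (nat \<Rightarrow> real) \<Rightarrow> real" where
  "quenched_cavity_field \<beta> h N G g = gibbs_average \<beta> h N G (cavity_field N g)"

section \<open>Gaussian randomness\<close>

definition std_gaussian :: "real measure" where
  "std_gaussian = density lborel (\<lambda>x. ennreal (std_normal_density x))"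

text \<open>The joint law of the couplings \<open>(g\<^sub>i\<^sub>j)\<close>, \<open>i < j \<le> N\<close>, and of the independent
  fields \<open>(g\<^sub>j)\<close>, \<open>j \<le> N\<close>: all of them are i.i.d. standard Gaussian coordinates.\<close>

definition disorder :: "nat \<Rightarrow> ((nat \<times> nat \<Rightarrow> real) \<times> (nat \<Rightarrow> real)) measure" where
  "disorder N =
     (\<Pi>\<^sub>M p\<in>pairs N. std_gaussian) \<Otimes>\<^sub>M (\<Pi>\<^sub>M j\<in>{1..N}. std_gaussian)"

text \<open>The constraint \<open>0 \<le> q\<close> only makes the domain of the real square root explicit;
  every solution is nonnegative.\<close>

definition sk_q :: "real \<Rightarrow> real \<Rightarrow> real" where
  "sk_q \<beta> h =
     (THE q. 0 \<le> q \<and> q = (LINT z|std_gaussian. (tanh (\<beta> * z * sqrt q + h))\<^sup>2))"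

text \<open>The second parameter of \<^const>\<open>normal_density\<close> is the standard deviation, whereas
  \<open>v\<close> below is the variance.\<close>

definition gaussian_average :: "real \<Rightarrow> real \<Rightarrow> (real \<Rightarrow> real) \<Rightarrow> real" where
  "gaussian_average m v U = (LINT x|lborel. U x * normal_density m (sqrt v) x)"

section \<open>Test functions\<close>

definition moderate_growth :: "('a::euclidean_space \<Rightarrow> real) \<Rightarrow> bool" where
  "moderate_growth U \<longleftrightarrow>
     continuous_on UNIV U \<and>
     (\<forall>a>0. ((\<lambda>x. U x * exp (- a * (norm x)\<^sup>2)) \<longlongrightarrow> 0) at_infinity)"

definition smooth :: "(real \<Rightarrow> real) \<Rightarrow> bool" where
  "smooth U \<longleftrightarrow> (\<forall>n x. (deriv ^^ n) U differentiable (at x))"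

end

theory Submission
  imports Defs
begin

text \<open>
  Write \<open>W x\<close> for the mean of \<open>U (x + \<surd>(1 - q) z)\<close> over a standard Gaussian \<open>z\<close>, so that the random
  variable to be estimated is the Gibbs average of \<open>U l - W r\<close>. Its power \<open>n = 2k\<close> is the average
  of a product of \<open>n\<close> such factors over independent replicas \<open>\<sigma>\<^sup>1, \<dots>, \<sigma>\<^sup>n\<close>. The argument has two
  halves: with the couplings fixed, the power is controlled by the moment of order \<open>n\<close> of
  \<open>R - q\<close>, where \<open>R\<close> is the overlap \<open>(1/N) \<Sum>\<^sub>i \<sigma>\<^sub>i \<tau>\<^sub>i\<close> of two replicas; and at high
  temperature this moment is of order \<open>N\<close> to the power \<open>-k\<close>.

  For the first half, fix the couplings. The centred fields \<open>l\<^sup>a - r\<close> of the replicas and \<open>r\<close> itself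
  are jointly Gaussian in \<open>g\<close>. If the centred fields were independent of each other and of \<open>r\<close>, with
  variance \<open>1 - q\<close>, every factor would have conditional mean zero. Interpolate between this situation
  and the true one. Each derivative along the interpolation produces one discrepancy of covariances
  and differentiates the test functions twice, in the coordinates that the discrepancy couples.
  A term with fewer than \<open>n\<close> discrepancies vanishes at the start of the interpolation: the total
  number of derivatives is less than \<open>2n\<close>, so some replica has been hit at most once. A replica that
  has not been hit contributes a factor of mean zero; one that has been hit once enters a single
  discrepancy, linearly through its centred spin vector, whose Gibbs average is zero. So only
  terms with \<open>n\<close> discrepancies survive (\<open>Phi_start\<close>, \<open>Phi_bound\<close>), and each discrepancy is a
  combination of averages of \<open>R - q\<close>. This gives \<open>cavity_moment\<close>.

  For the second half (\<open>overlap_concentration\<close>, an argument of Guerra and Latala), interpolate from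
  independent spins in Gaussian site fields to the model. The derivative of the two-replica
  average of \<open>exp (\<lambda> N (R - q)\<^sup>2)\<close> is bounded by a multiple of the average of
  \<open>N (R - q)\<^sup>2 exp (\<lambda> N (R - q)\<^sup>2)\<close>, so letting \<open>\<lambda>\<close> decrease by \<open>2 \<beta>\<^sup>2\<close> in total makes the average
  nonincreasing. For independent spins, \<open>N (R - q)\<close> is a centred sum of bounded independent variables,
  because \<open>q\<close> solves the self-consistency equation, and the average is finite for \<open>\<lambda> < 1/2\<close>.
  The assumption \<open>\<beta> < 1/2\<close> leaves a positive exponent at the end.

  Both interpolations, and the one that shows that the map defining \<open>q\<close> is a contraction, are instances
  of \<open>gaussian_interpolation\<close>. The paths are trigonometric, since \<open>sin t\<close> and \<open>cos t\<close> are
  smooth at both ends where \<open>\<surd>t\<close> and \<open>\<surd>(1 - t)\<close> are not.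
\<close>

section \<open>Standard Gaussian coordinates\<close>

definition gaussian_coords :: "'i set \<Rightarrow> ('i \<Rightarrow> real) measure" where
  "gaussian_coords I = (\<Pi>\<^sub>M i\<in>I. std_gaussian)"

lemma sets_std_gaussian [measurable_cong, simp]: "sets std_gaussian = sets borel"
  by (simp add: std_gaussian_def)

lemma space_std_gaussian [simp]: "space std_gaussian = UNIV"
  by (simp add: std_gaussian_def)

lemma prob_space_std_gaussian: "prob_space std_gaussian"
  unfolding std_gaussian_def by (rule prob_space_normal_density) simp

interpretation gauss1: prob_space std_gaussian
  by (rule prob_space_std_gaussian)

interpretation gauss: product_prob_space "\<lambda>_::'i. std_gaussian" UNIV
  by unfold_locales

lemma prob_space_gaussian_coords: "prob_space (gaussian_coords I)"
  unfolding gaussian_coords_def by (intro prob_space_PiM prob_space_std_gaussian)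

lemma sets_gaussian_coords [measurable_cong]: "sets (gaussian_coords I) = sets (\<Pi>\<^sub>M i\<in>I. borel)"
  unfolding gaussian_coords_def by (intro sets_PiM_cong) auto

lemma measurable_gaussian_coord:
  "i \<in> I \<Longrightarrow> (\<lambda>g. g i) \<in> borel_measurable (gaussian_coords I)"
  by measurable

lemma integrable_std_gaussian_iff:
  "f \<in> borel_measurable borel \<Longrightarrow>
    integrable std_gaussian f \<longleftrightarrow> integrable lborel (\<lambda>x. std_normal_density x * f x)"
  unfolding std_gaussian_def by (simp add: integrable_density)

lemma integral_std_gaussian:
  "f \<in> borel_measurable borel \<Longrightarrow>
    (LINT x|std_gaussian. f x) = (LINT x|lborel. std_normal_density x * f x)"
  unfolding std_gaussian_def by (simp add: integral_density)

text \<open>The product with the Gaussian density is a multiple of the centred normal density of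
  variance \<open>1 / (1 - 2a)\<close>.\<close>

lemma exp_square_std_gaussian:
  fixes a :: real
  assumes "2 * a < 1"
  shows "has_bochner_integral std_gaussian (\<lambda>x. exp (a * x\<^sup>2)) (1 / sqrt (1 - 2 * a))"
proof -
  define s where "s = 1 / sqrt (1 - 2 * a)"
  have s: "s > 0" "s\<^sup>2 = 1 / (1 - 2 * a)"
    using assms by (auto simp: s_def power_divide)
  have eq: "std_normal_density x * exp (a * x\<^sup>2) = s * normal_density 0 s x" for x
  proof -
    have "- (x - 0)\<^sup>2 / (2 * s\<^sup>2) = (- (x - 0)\<^sup>2 / 2) * (1 / s\<^sup>2)"
      by simp
    also have "\<dots> = - (x - 0)\<^sup>2 / (2 * 1\<^sup>2) + a * x\<^sup>2"
      unfolding s(2) by (simp add: field_simps)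
    finally have e: "- (x - 0)\<^sup>2 / (2 * s\<^sup>2) = - (x - 0)\<^sup>2 / (2 * 1\<^sup>2) + a * x\<^sup>2" .
    have "sqrt (2 * pi * s\<^sup>2) = sqrt (2 * pi * 1\<^sup>2) * s"
      using s(1) by (simp add: real_sqrt_mult)
    then show ?thesis
      unfolding normal_density_def e exp_add using s(1) by simp
  qed
  have "has_bochner_integral lborel (\<lambda>x. s * normal_density 0 s x) (s * 1)"
    using s(1) by (intro has_bochner_integral_mult_right)
      (auto simp: has_bochner_integral_iff)
  then show ?thesis
    by (simp add: has_bochner_integral_iff integrable_std_gaussian_iff integral_std_gaussian eq
        flip: s_def)
qed

text \<open>Completing the square turns the product with the density into a normal density of mean \<open>c\<close>.\<close>

lemma exp_linear_std_gaussian: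
  fixes c :: real
  shows "has_bochner_integral std_gaussian (\<lambda>x. exp (c * x)) (exp (c\<^sup>2 / 2))"
proof -
  have eq: "std_normal_density x * exp (c * x) = exp (c\<^sup>2 / 2) * normal_density c 1 x" for x
  proof -
    have e: "- (x - 0)\<^sup>2 / (2 * 1\<^sup>2) = c\<^sup>2 / 2 + - (x - c)\<^sup>2 / (2 * 1\<^sup>2) - c * x"
      by (simp add: power2_eq_square field_simps)
    show ?thesis
      unfolding normal_density_def e exp_add exp_diff by simp
  qed
  have "has_bochner_integral lborel (\<lambda>x. exp (c\<^sup>2 / 2) * normal_density c 1 x) (exp (c\<^sup>2 / 2) * 1)"
    by (intro has_bochner_integral_mult_right) (auto simp: has_bochner_integral_iff)
  then show ?thesis
    by (simp add: has_bochner_integral_iff integrable_std_gaussian_iff integral_std_gaussian eq)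
qed

lemma integrable_prod_gaussian_coords:
  fixes f :: "'i \<Rightarrow> real \<Rightarrow> real"
  assumes "finite I" "\<And>i. i \<in> I \<Longrightarrow> integrable std_gaussian (f i)"
  shows "integrable (gaussian_coords I) (\<lambda>g. \<Prod>i\<in>I. f i (g i))"
  unfolding gaussian_coords_def by (rule gauss.product_integrable_prod) (use assms in auto)

lemma integral_prod_gaussian_coords:
  fixes f :: "'i \<Rightarrow> real \<Rightarrow> real"
  assumes "finite I" "\<And>i. i \<in> I \<Longrightarrow> integrable std_gaussian (f i)"
  shows "(LINT g|gaussian_coords I. (\<Prod>i\<in>I. f i (g i))) = (\<Prod>i\<in>I. LINT x|std_gaussian. f i x)"
  unfolding gaussian_coords_def by (rule gauss.product_integral_prod) (use assms in auto)

lemma integrable_exp_sum_squares: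
  fixes a :: real
  assumes "finite I" "2 * a < 1"
  shows "integrable (gaussian_coords I) (\<lambda>g. exp (a * (\<Sum>i\<in>I. (g i)\<^sup>2)))"
proof -
  have "integrable (gaussian_coords I) (\<lambda>g. \<Prod>i\<in>I. exp (a * (g i)\<^sup>2))"
    using exp_square_std_gaussian[OF assms(2)] assms(1)
    by (intro integrable_prod_gaussian_coords[where f="\<lambda>_ x. exp (a * x\<^sup>2)"])
      (auto simp: has_bochner_integral_iff)
  then show ?thesis
    by (simp add: sum_distrib_left exp_sum assms(1))
qed

lemma integral_gaussian_coords_insert:
  fixes f :: "('i \<Rightarrow> real) \<Rightarrow> real"
  assumes "finite I" "i \<notin> I" "integrable (gaussian_coords (insert i I)) f"
  shows "(LINT g|gaussian_coords (insert i I). f g) =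
    (LINT g|gaussian_coords I. LINT y|std_gaussian. f (g(i := y)))"
  using gauss.product_integral_insert[of I i f] assms by (simp add: gaussian_coords_def)

lemma distr_gaussian_coords_restrict:
  assumes "finite I" "J \<subseteq> I"
  shows "distr (gaussian_coords I) (gaussian_coords J) (\<lambda>g. restrict g J) = gaussian_coords J"
  using gauss.distr_restrict[of J I] assms by (simp add: gaussian_coords_def)

lemma measurable_restrict_gaussian_coords:
  "J \<subseteq> I \<Longrightarrow> (\<lambda>g. restrict g J) \<in> measurable (gaussian_coords I) (gaussian_coords J)"
  unfolding gaussian_coords_def by (rule measurable_restrict_subset)

text \<open>Auxiliary Gaussian coordinates introduced for an interpolation are discarded at its end, where
  the integrand no longer depends on them.\<close>

lemma gaussian_coords_marginal:
  fixes f :: "('i \<Rightarrow> real) \<Rightarrow> real"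
  assumes "finite I" "J \<subseteq> I" and f: "f \<in> borel_measurable (gaussian_coords J)"
    and dep: "\<And>g. f (restrict g J) = f g"
  shows "integrable (gaussian_coords I) f \<longleftrightarrow> integrable (gaussian_coords J) f"
    and "(LINT g|gaussian_coords I. f g) = (LINT g|gaussian_coords J. f g)"
proof -
  note m = measurable_restrict_gaussian_coords[OF assms(2)]
  show "integrable (gaussian_coords I) f \<longleftrightarrow> integrable (gaussian_coords J) f"
    using integrable_distr_eq[OF m f]
    by (simp add: distr_gaussian_coords_restrict[OF assms(1,2)] dep)
  show "(LINT g|gaussian_coords I. f g) = (LINT g|gaussian_coords J. f g)"
    using integral_distr[OF m f]
    by (simp add: distr_gaussian_coords_restrict[OF assms(1,2)] dep)
qed

section \<open>Gaussian integration by parts\<close>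

text \<open>A linear factor costs no more than a small Gaussian exponential. This keeps all growth bounds
  below in the single form \<open>C exp (a |g|\<^sup>2)\<close>.\<close>

lemma abs_le_exp_square: "\<bar>x::real\<bar> \<le> 2 * exp (x\<^sup>2 / 8)"
proof -
  have "2 * \<bar>x\<bar> \<le> x\<^sup>2 / 4 + 4"
    using zero_le_power2[of "\<bar>x\<bar> / 2 - 2"]
    by (simp add: power2_diff power_divide)
  also have "\<dots> \<le> 4 * exp (x\<^sup>2 / 8)"
    using exp_ge_add_one_self[of "x\<^sup>2 / 8"] zero_le_power2[of x] by linarith
  finally show ?thesis by simp
qed

text \<open>The derivative of \<open>\<psi>\<close> times the Gaussian density integrates to zero over the line: growth up to
  \<open>exp (x\<^sup>2 / 8)\<close> is beaten by the density, so there are no boundary terms.\<close>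

lemma gaussian_ibp_real:
  fixes \<psi> \<psi>' :: "real \<Rightarrow> real"
  assumes der: "\<And>x. (\<psi> has_real_derivative \<psi>' x) (at x)"
    and cont: "continuous_on UNIV \<psi>'"
    and b: "\<And>x. \<bar>\<psi> x\<bar> \<le> C * exp (x\<^sup>2 / 8)" and b': "\<And>x. \<bar>\<psi>' x\<bar> \<le> C * exp (x\<^sup>2 / 8)"
  shows "(LINT x|std_gaussian. x * \<psi> x) = (LINT x|std_gaussian. \<psi>' x)"
proof -
  have c\<psi>: "continuous_on UNIV \<psi>"
    using der by (meson DERIV_isCont continuous_at_imp_continuous_on)
  have [measurable]: "\<psi> \<in> borel_measurable borel" "\<psi>' \<in> borel_measurable borel"
    using c\<psi> cont by (auto intro: borel_measurable_continuous_onI)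
  have C: "C \<ge> 0" using b[of 0] by simp
  have dom: "integrable std_gaussian (\<lambda>x. 2 * C * exp (1/4 * x\<^sup>2))"
    using exp_square_std_gaussian[of "1/4"] by (auto simp: has_bochner_integral_iff)
  have i1: "integrable std_gaussian (\<lambda>x. x * \<psi> x)"
  proof (rule Bochner_Integration.integrable_bound[OF dom])
    have "\<bar>x * \<psi> x\<bar> \<le> 2 * exp (x\<^sup>2 / 8) * (C * exp (x\<^sup>2 / 8))" for x
      unfolding abs_mult by (intro mult_mono abs_le_exp_square b) auto
    then have "\<bar>x * \<psi> x\<bar> \<le> 2 * C * exp (1/4 * x\<^sup>2)" for x
      by (simp add: exp_add [symmetric] mult.assoc mult.left_commute)
    then show "AE x in std_gaussian. norm (x * \<psi> x) \<le> norm (2 * C * exp (1/4 * x\<^sup>2))"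
      using C by (intro always_eventually) (auto simp: abs_mult)
  qed simp
  have i2: "integrable std_gaussian \<psi>'"
  proof (rule Bochner_Integration.integrable_bound[OF dom])
    have "\<bar>\<psi>' x\<bar> \<le> 2 * C * exp (1/4 * x\<^sup>2)" for x
    proof -
      have "\<bar>\<psi>' x\<bar> \<le> C * exp (x\<^sup>2 / 8)" by (rule b')
      also have "\<dots> \<le> (2 * C) * exp (1/4 * x\<^sup>2)" using C by (intro mult_mono) auto
      finally show ?thesis .
    qed
    then show "AE x in std_gaussian. norm (\<psi>' x) \<le> norm (2 * C * exp (1/4 * x\<^sup>2))"
      using C by (intro always_eventually) auto
  qed simp
  let ?F = "\<lambda>x. std_normal_density x * \<psi> x"
  let ?f = "\<lambda>x. std_normal_density x * \<psi>' x - std_normal_density x * (x * \<psi> x)"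
  have dd: "(std_normal_density has_real_derivative - x * std_normal_density x) (at x)" for x
    unfolding std_normal_density_def [abs_def]
    by (auto intro!: derivative_eq_intros simp: field_simps)
  have dF: "(?F has_real_derivative ?f x) (at x)" for x
    by (rule derivative_eq_intros dd der refl)+ (simp add: algebra_simps)
  have int: "integrable lborel ?f"
    using i1 i2 by (intro Bochner_Integration.integrable_diff) (simp_all add: integrable_std_gaussian_iff)
  have Fb: "\<bar>?F x\<bar> \<le> C * exp (- (x\<^sup>2) / 4)" for x
  proof -
    have "std_normal_density x \<le> exp (- x\<^sup>2 / 2)"
      unfolding std_normal_density_def
      using pi_gt3 by (intro mult_left_le_one_le) (auto simp: field_simps)
    then have "\<bar>?F x\<bar> \<le> exp (- x\<^sup>2 / 2) * (C * exp (x\<^sup>2 / 8))"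
      unfolding abs_mult by (intro mult_mono b) auto
    also have "\<dots> = C * exp (- x\<^sup>2 / 2 + x\<^sup>2 / 8)"
      unfolding exp_add by simp
    also have "\<dots> \<le> C * exp (- (x\<^sup>2) / 4)"
      using C by (intro mult_left_mono) auto
    finally show ?thesis .
  qed
  have lim: "(?F \<longlongrightarrow> 0) at_top" "(?F \<longlongrightarrow> 0) at_bot"
  proof -
    have "((\<lambda>x. C * exp (- (x\<^sup>2) / 4)) \<longlongrightarrow> C * 0) F"
      if F: "filterlim (\<lambda>x::real. x\<^sup>2) at_top F" for F
      by (intro tendsto_mult tendsto_const filterlim_compose[OF exp_at_bot])
        (use filterlim_tendsto_pos_mult_at_top[OF tendsto_const[of "1/4"] _ F] in
          \<open>simp add: filterlim_uminus_at_bot\<close>)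
    then have *: "((\<lambda>x. C * exp (- (x\<^sup>2) / 4)) \<longlongrightarrow> 0) F"
      if "filterlim (\<lambda>x::real. x\<^sup>2) at_top F" for F using that by auto
    have "filterlim (\<lambda>x::real. x\<^sup>2) at_top at_top"
      by (intro filterlim_pow_at_top filterlim_ident) auto
    note 1 = *[OF this]
    have "filterlim (\<lambda>x::real. x\<^sup>2) at_top at_bot"
      by (intro filterlim_pow_at_bot_even filterlim_ident) auto
    note 2 = *[OF this]
    show "(?F \<longlongrightarrow> 0) at_top"
      by (rule Lim_null_comparison[OF _ 1]) (use Fb in auto)
    show "(?F \<longlongrightarrow> 0) at_bot"
      by (rule Lim_null_comparison[OF _ 2]) (use Fb in auto)
  qed
  have "(LBINT x=-\<infinity>..\<infinity>. ?f x) = 0 - 0"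
  proof (rule interval_integral_FTC_integrable)
    show "(?F has_vector_derivative ?f x) (at x)" for x
      using dF[of x] by (simp add: has_real_derivative_iff_has_vector_derivative)
    have "continuous_on UNIV ?f"
      unfolding std_normal_density_def by (intro continuous_intros c\<psi> cont) auto
    then show "isCont ?f x" for x
      by (simp add: continuous_on_eq_continuous_at)
    show "set_integrable lborel (einterval (- \<infinity>) \<infinity>) ?f"
      using int by (simp add: set_integrable_def)
    show "(((\<lambda>x. std_normal_density x * \<psi> x) \<circ> real_of_ereal) \<longlongrightarrow> 0) (at_right (- \<infinity>))"
      "(((\<lambda>x. std_normal_density x * \<psi> x) \<circ> real_of_ereal) \<longlongrightarrow> 0) (at_left \<infinity>)"
      unfolding ereal_tendsto_simps by (rule lim)+
  qed auto
  then have "(LINT x|lborel. ?f x) = 0"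
    by (simp add: interval_integral_to_infinity_eq interval_lebesgue_integral_def set_lebesgue_integral_def)
  then show ?thesis
    using i1 i2 by (subst (asm) Bochner_Integration.integral_diff)
      (simp_all add: integral_std_gaussian integrable_std_gaussian_iff)
qed

text \<open>Fubini's theorem isolates the coordinate \<open>i\<close>. The exponent \<open>1/8\<close> in the growth condition leaves
  room for the extra factor \<open>g i\<close>, which together with it stays below \<open>exp (|g|\<^sup>2 / 4)\<close>.\<close>

lemma gaussian_ibp:
  fixes \<psi> \<psi>' :: "('i \<Rightarrow> real) \<Rightarrow> real"
  assumes I: "finite I" "i \<in> I"
    and [measurable]: "\<psi> \<in> borel_measurable (gaussian_coords I)"
      "\<psi>' \<in> borel_measurable (gaussian_coords I)"
    and der: "\<And>g y. ((\<lambda>y. \<psi> (g(i := y))) has_real_derivative \<psi>' (g(i := y))) (at y)"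
    and cont: "\<And>g. continuous_on UNIV (\<lambda>y. \<psi>' (g(i := y)))"
    and b: "\<And>g. \<bar>\<psi> g\<bar> \<le> C * exp (1/8 * (\<Sum>i\<in>I. (g i)\<^sup>2))"
    and b': "\<And>g. \<bar>\<psi>' g\<bar> \<le> C * exp (1/8 * (\<Sum>i\<in>I. (g i)\<^sup>2))"
  shows "integrable (gaussian_coords I) (\<lambda>g. g i * \<psi> g)"
    and "integrable (gaussian_coords I) \<psi>'"
    and "(LINT g|gaussian_coords I. g i * \<psi> g) = (LINT g|gaussian_coords I. \<psi>' g)"
proof -
  have C: "C \<ge> 0"
    using b[of "\<lambda>_. 0"] by simp
  have dom: "integrable (gaussian_coords I) (\<lambda>g. 2 * C * exp (1/4 * (\<Sum>i\<in>I. (g i)\<^sup>2)))"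
    using I by (intro integrable_mult_right integrable_exp_sum_squares) auto
  have sq: "(g i)\<^sup>2 \<le> (\<Sum>i\<in>I. (g i)\<^sup>2)" for g :: "'i \<Rightarrow> real"
    using I by (intro member_le_sum) auto
  show int1: "integrable (gaussian_coords I) (\<lambda>g. g i * \<psi> g)"
  proof (rule Bochner_Integration.integrable_bound[OF dom])
    have "\<bar>g i * \<psi> g\<bar> \<le> 2 * C * exp (1/4 * (\<Sum>i\<in>I. (g i)\<^sup>2))" for g
    proof -
      have "\<bar>g i * \<psi> g\<bar> \<le> (2 * exp ((g i)\<^sup>2 / 8)) * (C * exp (1/8 * (\<Sum>i\<in>I. (g i)\<^sup>2)))"
        unfolding abs_mult by (intro mult_mono abs_le_exp_square b) auto
      also have "\<dots> \<le> (2 * exp (1/8 * (\<Sum>i\<in>I. (g i)\<^sup>2))) * (C * exp (1/8 * (\<Sum>i\<in>I. (g i)\<^sup>2)))"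
        using sq[of g] C by (intro mult_right_mono) auto
      finally show ?thesis
        by (simp add: exp_add [symmetric] mult.assoc mult.left_commute)
    qed
    then show "AE g in gaussian_coords I. norm (g i * \<psi> g) \<le> norm (2 * C * exp (1/4 * (\<Sum>i\<in>I. (g i)\<^sup>2)))"
      using C by (intro always_eventually) (auto simp: abs_mult)
  qed (use I in measurable)
  show int2: "integrable (gaussian_coords I) \<psi>'"
  proof (rule Bochner_Integration.integrable_bound[OF dom])
    have "\<bar>\<psi>' g\<bar> \<le> 2 * C * exp (1/4 * (\<Sum>i\<in>I. (g i)\<^sup>2))" for g
    proof -
      have "\<bar>\<psi>' g\<bar> \<le> C * exp (1/8 * (\<Sum>i\<in>I. (g i)\<^sup>2))" by (rule b')
      also have "\<dots> \<le> (2 * C) * exp (1/4 * (\<Sum>i\<in>I. (g i)\<^sup>2))"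
        using C by (intro mult_mono) (auto simp: sum_nonneg)
      finally show ?thesis .
    qed
    then show "AE g in gaussian_coords I. norm (\<psi>' g) \<le> norm (2 * C * exp (1/4 * (\<Sum>i\<in>I. (g i)\<^sup>2)))"
      using C by (intro always_eventually) auto
  qed simp
  define J where "J = I - {i}"
  have IJ: "I = insert i J" "i \<notin> J" "finite J"
    using I by (auto simp: J_def)
  have "(LINT y|std_gaussian. y * \<psi> (g(i := y))) = (LINT y|std_gaussian. \<psi>' (g(i := y)))" for g
  proof (rule gaussian_ibp_real[OF der cont])
    fix x :: real
    have eq: "exp (1/8 * (\<Sum>j\<in>I. ((g(i := x)) j)\<^sup>2)) = exp (1/8 * (\<Sum>j\<in>J. (g j)\<^sup>2)) * exp (x\<^sup>2 / 8)"
    proof -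
      have "(\<Sum>j\<in>J. ((g(i := x)) j)\<^sup>2) = (\<Sum>j\<in>J. (g j)\<^sup>2)"
        using IJ by (intro sum.cong) auto
      then show ?thesis
        using IJ(2,3) by (simp add: IJ(1) exp_add [symmetric] algebra_simps)
    qed
    show "\<bar>\<psi> (g(i := x))\<bar> \<le> C * exp (1/8 * (\<Sum>j\<in>J. (g j)\<^sup>2)) * exp (x\<^sup>2 / 8)"
      "\<bar>\<psi>' (g(i := x))\<bar> \<le> C * exp (1/8 * (\<Sum>j\<in>J. (g j)\<^sup>2)) * exp (x\<^sup>2 / 8)"
      using b[of "g(i := x)"] b'[of "g(i := x)"] unfolding eq by (simp_all add: mult.assoc)
  qed
  then show "(LINT g|gaussian_coords I. g i * \<psi> g) = (LINT g|gaussian_coords I. \<psi>' g)"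
    using int1 int2 IJ by (simp add: integral_gaussian_coords_insert)
qed

section \<open>Subgaussian variables\<close>

text \<open>The exponential of \<open>b y\<^sup>2\<close> is the mean of \<open>exp (\<surd>(2b) z y)\<close> over a standard Gaussian \<open>z\<close>, so
  exchanging the integrals reduces the claim to the assumed bound on exponential moments. The
  weight \<open>W\<close> makes the statement cover averages over Gaussian variables and finite weighted
  sums alike.\<close>

lemma subgaussian_exp_square:
  fixes Y W :: "'a \<Rightarrow> real"
  assumes "sigma_finite_measure M"
    and [measurable]: "Y \<in> borel_measurable M" "W \<in> borel_measurable M"
    and W: "\<And>x. W x \<ge> 0"
    and sub: "\<And>l. (\<integral>\<^sup>+x. ennreal (W x * exp (l * Y x)) \<partial>M) \<le> ennreal (exp (l\<^sup>2 * \<tau> / 2))"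
    and b: "b \<ge> 0" "2 * b * \<tau> < 1"
  shows "(\<integral>\<^sup>+x. ennreal (W x * exp (b * (Y x)\<^sup>2)) \<partial>M) \<le> ennreal (1 / sqrt (1 - 2 * b * \<tau>))"
proof -
  interpret M: sigma_finite_measure M by fact
  interpret pair_sigma_finite M std_gaussian ..
  have lin: "(\<integral>\<^sup>+z. ennreal (exp (c * z)) \<partial>std_gaussian) = ennreal (exp (c\<^sup>2 / 2))" for c
    using exp_linear_std_gaussian[of c]
    by (subst nn_integral_eq_integral) (auto simp: has_bochner_integral_iff)
  have "(\<integral>\<^sup>+x. ennreal (W x * exp (b * (Y x)\<^sup>2)) \<partial>M)
      = (\<integral>\<^sup>+x. (\<integral>\<^sup>+z. ennreal (W x * exp ((sqrt (2 * b) * z) * Y x)) \<partial>std_gaussian) \<partial>M)"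
  proof (rule nn_integral_cong)
    fix x
    have "(\<integral>\<^sup>+z. ennreal (W x * exp ((sqrt (2 * b) * z) * Y x)) \<partial>std_gaussian)
      = (\<integral>\<^sup>+z. ennreal (W x) * ennreal (exp ((sqrt (2 * b) * Y x) * z)) \<partial>std_gaussian)"
      using W by (intro nn_integral_cong) (simp add: ennreal_mult' mult_ac)
    also have "\<dots> = ennreal (W x) * ennreal (exp ((sqrt (2 * b) * Y x)\<^sup>2 / 2))"
      by (subst nn_integral_cmult) (auto simp: lin)
    also have "\<dots> = ennreal (W x * exp (b * (Y x)\<^sup>2))"
      using W b by (simp add: ennreal_mult' power_mult_distrib)
    finally show "ennreal (W x * exp (b * (Y x)\<^sup>2)) =
      (\<integral>\<^sup>+z. ennreal (W x * exp ((sqrt (2 * b) * z) * Y x)) \<partial>std_gaussian)" ..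
  qed
  also have "\<dots> = (\<integral>\<^sup>+z. (\<integral>\<^sup>+x. ennreal (W x * exp ((sqrt (2 * b) * z) * Y x)) \<partial>M) \<partial>std_gaussian)"
    by (rule Fubini'[symmetric]) measurable
  also have "\<dots> \<le> (\<integral>\<^sup>+z. ennreal (exp ((b * \<tau>) * z\<^sup>2)) \<partial>std_gaussian)"
    using sub[of "sqrt (2 * b) * _"] b(1)
    by (intro nn_integral_mono) (simp add: power_mult_distrib mult_ac)
  also have "\<dots> = ennreal (1 / sqrt (1 - 2 * b * \<tau>))"
    using exp_square_std_gaussian[of "b * \<tau>"] b(2)
    by (subst nn_integral_eq_integral) (auto simp: has_bochner_integral_iff mult.assoc)
  finally show ?thesis .
qed

text \<open>A linear form in Gaussian coordinates is subgaussian with the sum of its squared coefficients as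
  variance; the numerical condition makes the resulting constant at most \<open>1 / \<surd>(1/4)\<close>.\<close>

lemma exp_square_linear_form:
  fixes c :: "'i \<Rightarrow> real"
  assumes I: "finite I" and b: "b \<ge> 0" "8 * b * (\<Sum>i\<in>I. (c i)\<^sup>2) \<le> 3"
  shows "integrable (gaussian_coords I) (\<lambda>g. exp (b * (\<Sum>i\<in>I. c i * g i)\<^sup>2))"
    and "(LINT g|gaussian_coords I. exp (b * (\<Sum>i\<in>I. c i * g i)\<^sup>2)) \<le> 2"
proof -
  interpret G: prob_space "gaussian_coords I" by (rule prob_space_gaussian_coords)
  define \<tau> where "\<tau> = (\<Sum>i\<in>I. (c i)\<^sup>2)"
  have "(\<integral>\<^sup>+g. ennreal (1 * exp (b * (\<Sum>i\<in>I. c i * g i)\<^sup>2)) \<partial>gaussian_coords I)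
      \<le> ennreal (1 / sqrt (1 - 2 * b * \<tau>))"
  proof (rule subgaussian_exp_square)
    fix l :: real
    have *: "has_bochner_integral std_gaussian (\<lambda>x. exp (l * (c i * x))) (exp ((l * c i)\<^sup>2 / 2))" for i
      using exp_linear_std_gaussian[of "l * c i"] by (simp add: mult.assoc)
    have e: "exp (l * (\<Sum>i\<in>I. c i * g i)) = (\<Prod>i\<in>I. exp (l * (c i * g i)))" for g
      using I by (simp add: sum_distrib_left exp_sum)
    have "(LINT g|gaussian_coords I. exp (l * (\<Sum>i\<in>I. c i * g i))) = (\<Prod>i\<in>I. exp ((l * c i)\<^sup>2 / 2))"
      unfolding e using I *
      by (subst integral_prod_gaussian_coords) (auto simp: has_bochner_integral_iff)
    also have "\<dots> = exp (l\<^sup>2 * \<tau> / 2)"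
      using I by (simp add: exp_sum [symmetric] \<tau>_def power_mult_distrib sum_distrib_left sum_divide_distrib)
    moreover have "integrable (gaussian_coords I) (\<lambda>g. exp (l * (\<Sum>i\<in>I. c i * g i)))"
      unfolding e using I * by (intro integrable_prod_gaussian_coords) (auto simp: has_bochner_integral_iff)
    ultimately show "(\<integral>\<^sup>+g. ennreal (1 * exp (l * (\<Sum>i\<in>I. c i * g i))) \<partial>gaussian_coords I)
        \<le> ennreal (exp (l\<^sup>2 * \<tau> / 2))"
      by (simp add: nn_integral_eq_integral)
  qed (use b in \<open>auto simp: \<tau>_def intro: G.sigma_finite_measure_axioms\<close>)
  also have "1 / sqrt (1 - 2 * b * \<tau>) \<le> 2"
  proof -
    have "sqrt (1/4) \<le> sqrt (1 - 2 * b * \<tau>)"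
      using b(2) by (intro real_sqrt_le_mono) (simp add: \<tau>_def)
    moreover have "sqrt (1/4) = (1/2::real)"
      by (rule real_sqrt_unique) (auto simp: power2_eq_square)
    ultimately have "1/2 \<le> sqrt (1 - 2 * b * \<tau>)" by simp
    then show ?thesis
      using frac_le[of 1 1 "1/2" "sqrt (1 - 2 * b * \<tau>)"] by simp
  qed
  finally have le: "(\<integral>\<^sup>+g. ennreal (exp (b * (\<Sum>i\<in>I. c i * g i)\<^sup>2)) \<partial>gaussian_coords I) \<le> ennreal 2"
    by (simp add: ennreal_leI)
  show int: "integrable (gaussian_coords I) (\<lambda>g. exp (b * (\<Sum>i\<in>I. c i * g i)\<^sup>2))"
    using le by (intro integrableI_bounded) (auto simp: order.strict_trans1)
  have "ennreal (LINT g|gaussian_coords I. exp (b * (\<Sum>i\<in>I. c i * g i)\<^sup>2)) \<le> ennreal 2"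
    using le int by (subst nn_integral_eq_integral[symmetric]) auto
  then show "(LINT g|gaussian_coords I. exp (b * (\<Sum>i\<in>I. c i * g i)\<^sup>2)) \<le> 2"
    by (subst (asm) ennreal_le_iff) auto
qed

section \<open>Gaussian interpolation\<close>

text \<open>The mean value theorem bounds the difference quotients by \<open>w\<close>, so dominated convergence applies.
  Domination near \<open>t\<close> suffices, which matters for integrands that grow in the parameter.\<close>

lemma has_real_derivative_integral:
  fixes f f' :: "real \<Rightarrow> 'a \<Rightarrow> real"
  assumes S: "open S" "convex S" "t \<in> S"
    and int: "\<And>s. s \<in> S \<Longrightarrow> integrable M (f s)"
    and der: "\<And>s x. s \<in> S \<Longrightarrow> x \<in> space M \<Longrightarrow> ((\<lambda>s. f s x) has_real_derivative f' s x) (at s)"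
    and bound: "\<And>s x. s \<in> S \<Longrightarrow> x \<in> space M \<Longrightarrow> \<bar>f' s x\<bar> \<le> w x"
    and w: "integrable M w"
    and meas: "f' t \<in> borel_measurable M"
  shows "((\<lambda>s. LINT x|M. f s x) has_real_derivative (LINT x|M. f' t x)) (at t)"
proof -
  have "(\<lambda>i. ((LINT x|M. f (X i) x) - (LINT x|M. f t x)) / (X i - t)) \<longlonglongrightarrow> (LINT x|M. f' t x)"
    if X: "\<And>i. X i \<in> S - {t}" "X \<longlonglongrightarrow> t" for X
  proof -
    have "(\<lambda>i. LINT x|M. (f (X i) x - f t x) / (X i - t)) \<longlonglongrightarrow> (LINT x|M. f' t x)"
    proof (rule integral_dominated_convergence)
      show "AE x in M. (\<lambda>i. (f (X i) x - f t x) / (X i - t)) \<longlonglongrightarrow> f' t x"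
      proof (rule AE_I2)
        fix x assume "x \<in> space M"
        from der[OF S(3) this] have "((\<lambda>s. (f s x - f t x) / (s - t)) \<longlongrightarrow> f' t x) (at t)"
          by (simp add: has_field_derivative_iff)
        then show "(\<lambda>i. (f (X i) x - f t x) / (X i - t)) \<longlonglongrightarrow> f' t x"
          using X unfolding tendsto_at_iff_sequentially comp_def by auto
      qed
      show "AE x in M. norm ((f (X i) x - f t x) / (X i - t)) \<le> w x" for i
      proof (rule AE_I2)
        fix x assume x: "x \<in> space M"
        have Xt: "X i \<noteq> t" "X i \<in> S" using X(1)[of i] by auto
        have "norm (f (X i) x - f t x) \<le> w x * norm (X i - t)"
        proof (rule field_differentiable_bound[OF S(2)])
          show "((\<lambda>s. f s x) has_real_derivative f' s x) (at s within S)" if "s \<in> S" for s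
            using der[OF that x] by (rule has_field_derivative_at_within)
          show "norm (f' s x) \<le> w x" if "s \<in> S" for s
            using bound[OF that x] by simp
        qed (rule Xt S)+
        then show "norm ((f (X i) x - f t x) / (X i - t)) \<le> w x"
          using Xt by (simp add: norm_divide field_simps)
      qed
      show "(\<lambda>x. (f (X i) x - f t x) / (X i - t)) \<in> borel_measurable M" for i
        using int[of "X i"] int[OF S(3)] X(1)[of i] by auto
    qed (use w meas in auto)
    moreover have "integrable M (f (X i))" for i
      using X(1)[of i] by (intro int) auto
    ultimately show ?thesis
      using int[OF S(3)] by (simp add: integral_diff)
  qed
  then have "((\<lambda>s. LINT x|M. f s x) has_real_derivative (LINT x|M. f' t x)) (at t within S)"
    unfolding has_field_derivative_iff tendsto_at_iff_sequentially comp_def by blast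
  then show ?thesis
    unfolding at_within_open[OF S(3) S(1)] .
qed

lemma uniform_constant:
  fixes f :: "'v \<Rightarrow> 'x \<Rightarrow> real"
  assumes "finite V" "\<And>v. v \<in> V \<Longrightarrow> \<exists>C. \<forall>x. \<bar>f v x\<bar> \<le> C * E x" and E: "\<And>x. E x \<ge> 0"
  shows "\<exists>C\<ge>0. \<forall>v\<in>V. \<forall>x. \<bar>f v x\<bar> \<le> C * E x"
proof -
  obtain C where C: "\<And>v x. v \<in> V \<Longrightarrow> \<bar>f v x\<bar> \<le> C v * E x"
    using assms(2) by metis
  have "\<bar>f v x\<bar> \<le> (\<Sum>v\<in>V. \<bar>C v\<bar>) * E x" if "v \<in> V" for v x
  proof -
    have "C v \<le> (\<Sum>v\<in>V. \<bar>C v\<bar>)"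
      using member_le_sum[of v V "\<lambda>v. \<bar>C v\<bar>"] that assms(1) by auto
    then show ?thesis
      using C[OF that, of x] E[of x] by (meson mult_right_mono order_trans)
  qed
  then show ?thesis
    by (intro exI[of _ "\<Sum>v\<in>V. \<bar>C v\<bar>"]) auto
qed

lemma linear_form_square_le:
  fixes c g :: "'i \<Rightarrow> real"
  assumes "finite I" "\<And>i. i \<in> I \<Longrightarrow> \<bar>c i\<bar> \<le> B"
  shows "(\<Sum>i\<in>I. c i * g i)\<^sup>2 \<le> real (card I) * B\<^sup>2 * (\<Sum>i\<in>I. (g i)\<^sup>2)"
proof -
  have "(\<Sum>i\<in>I. c i * g i)\<^sup>2 \<le> (\<Sum>i\<in>I. (c i * g i)\<^sup>2) * card I"
    by (rule sum_squared_le_sum_of_squares)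
  also have "(\<Sum>i\<in>I. (c i * g i)\<^sup>2) \<le> (\<Sum>i\<in>I. B\<^sup>2 * (g i)\<^sup>2)"
  proof (intro sum_mono)
    fix i assume "i \<in> I"
    then have "(c i)\<^sup>2 \<le> B\<^sup>2"
      using assms(2) by (metis abs_ge_zero abs_le_square_iff abs_of_nonneg order_trans)
    then show "(c i * g i)\<^sup>2 \<le> B\<^sup>2 * (g i)\<^sup>2"
      by (simp add: power_mult_distrib mult_right_mono)
  qed
  finally have "(\<Sum>i\<in>I. c i * g i)\<^sup>2 \<le> (\<Sum>i\<in>I. B\<^sup>2 * (g i)\<^sup>2) * real (card I)"
    by (simp add: mult_right_mono)
  then show ?thesis
    by (simp add: sum_distrib_left [symmetric] mult_ac)
qed

text \<open>The chain rule gives \<open>\<Sum>\<^sub>v \<Sum>\<^sub>i c' v i t g\<^sub>i F1 t v\<close>, and integration by parts replaces each \<open>g\<^sub>i\<close> by a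
  derivative of \<open>F1\<close>. The matrix \<open>\<Sum>\<^sub>i c' v i t c w i t\<close> is, after symmetrization, one half of the
  derivative of the covariance of the fields \<open>\<Sum>\<^sub>i c v i t g\<^sub>i\<close>, so only covariances matter.

  Partial derivatives are expressed along curves and measurability along families of random
  variables, because the finite set \<open>V\<close> of coordinates may sit in an infinite type, such as that
  of spin configurations. Growth below \<open>exp (a |x|\<^sup>2)\<close> for every \<open>a > 0\<close> is what allows arbitrary
  coefficients \<open>c\<close>. The function may also depend on \<open>t\<close> directly, with derivative \<open>F0\<close>.\<close>

theorem gaussian_interpolation:
  fixes F F0 :: "real \<Rightarrow> ('v \<Rightarrow> real) \<Rightarrow> real"
    and F1 :: "real \<Rightarrow> 'v \<Rightarrow> ('v \<Rightarrow> real) \<Rightarrow> real"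
    and F2 :: "real \<Rightarrow> 'v \<Rightarrow> 'v \<Rightarrow> ('v \<Rightarrow> real) \<Rightarrow> real"
    and c c' :: "'v \<Rightarrow> 'i \<Rightarrow> real \<Rightarrow> real"
  assumes I: "finite I" and V: "finite V"
    and dc: "\<And>v i t. v \<in> V \<Longrightarrow> i \<in> I \<Longrightarrow> (c v i has_real_derivative c' v i t) (at t)"
    and bc: "\<And>v i t. v \<in> V \<Longrightarrow> i \<in> I \<Longrightarrow> \<bar>c v i t\<bar> \<le> B"
    and bc': "\<And>v i t. v \<in> V \<Longrightarrow> i \<in> I \<Longrightarrow> \<bar>c' v i t\<bar> \<le> B"
    and dF: "\<And>x x' t. (\<And>v. v \<in> V \<Longrightarrow> ((\<lambda>s. x s v) has_real_derivative x' v) (at t)) \<Longrightarrow>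
      ((\<lambda>s. F s (x s)) has_real_derivative F0 t (x t) + (\<Sum>v\<in>V. F1 t v (x t) * x' v)) (at t)"
    and dF1: "\<And>s v x x' t. v \<in> V \<Longrightarrow>
      (\<And>w. w \<in> V \<Longrightarrow> ((\<lambda>y. x y w) has_real_derivative x' w) (at t)) \<Longrightarrow>
      ((\<lambda>y. F1 s v (x y)) has_real_derivative (\<Sum>w\<in>V. F2 s v w (x t) * x' w)) (at t)"
    and cF2: "\<And>s v w x. v \<in> V \<Longrightarrow> w \<in> V \<Longrightarrow> (\<And>u. u \<in> V \<Longrightarrow> continuous_on UNIV (\<lambda>y::real. x y u)) \<Longrightarrow>
      continuous_on UNIV (\<lambda>y. F2 s v w (x y))"
    and bF: "\<And>a. a > 0 \<Longrightarrow> \<exists>C. \<forall>t x. \<bar>F t x\<bar> \<le> C * exp (a * (\<Sum>v\<in>V. (x v)\<^sup>2))"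
    and bF0: "\<And>a. a > 0 \<Longrightarrow> \<exists>C. \<forall>t x. \<bar>F0 t x\<bar> \<le> C * exp (a * (\<Sum>v\<in>V. (x v)\<^sup>2))"
    and bF1: "\<And>a v. a > 0 \<Longrightarrow> v \<in> V \<Longrightarrow> \<exists>C. \<forall>t x. \<bar>F1 t v x\<bar> \<le> C * exp (a * (\<Sum>v\<in>V. (x v)\<^sup>2))"
    and bF2: "\<And>a t v w. a > 0 \<Longrightarrow> v \<in> V \<Longrightarrow> w \<in> V \<Longrightarrow>
      \<exists>C. \<forall>x. \<bar>F2 t v w x\<bar> \<le> C * exp (a * (\<Sum>v\<in>V. (x v)\<^sup>2))"
    and mF: "\<And>t X. (\<And>v. v \<in> V \<Longrightarrow> X v \<in> borel_measurable (gaussian_coords I)) \<Longrightarrow>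
      (\<lambda>g. F t (\<lambda>v. X v g)) \<in> borel_measurable (gaussian_coords I)"
    and mF0: "\<And>t X. (\<And>v. v \<in> V \<Longrightarrow> X v \<in> borel_measurable (gaussian_coords I)) \<Longrightarrow>
      (\<lambda>g. F0 t (\<lambda>v. X v g)) \<in> borel_measurable (gaussian_coords I)"
    and mF1: "\<And>t v X. v \<in> V \<Longrightarrow> (\<And>v. v \<in> V \<Longrightarrow> X v \<in> borel_measurable (gaussian_coords I)) \<Longrightarrow>
      (\<lambda>g. F1 t v (\<lambda>v. X v g)) \<in> borel_measurable (gaussian_coords I)"
    and mF2: "\<And>t v w X. v \<in> V \<Longrightarrow> w \<in> V \<Longrightarrow>
      (\<And>v. v \<in> V \<Longrightarrow> X v \<in> borel_measurable (gaussian_coords I)) \<Longrightarrow>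
      (\<lambda>g. F2 t v w (\<lambda>v. X v g)) \<in> borel_measurable (gaussian_coords I)"
  shows "((\<lambda>t. LINT g|gaussian_coords I. F t (\<lambda>v. \<Sum>i\<in>I. c v i t * g i)) has_real_derivative
      (LINT g|gaussian_coords I. F0 t (\<lambda>v. \<Sum>i\<in>I. c v i t * g i)) +
      (\<Sum>v\<in>V. \<Sum>w\<in>V. (\<Sum>i\<in>I. c' v i t * c w i t) *
        (LINT g|gaussian_coords I. F2 t v w (\<lambda>v. \<Sum>i\<in>I. c v i t * g i)))) (at t)"
    and "integrable (gaussian_coords I) (\<lambda>g. F t (\<lambda>v. \<Sum>i\<in>I. c v i t * g i))"
    and "integrable (gaussian_coords I) (\<lambda>g. F0 t (\<lambda>v. \<Sum>i\<in>I. c v i t * g i))"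
    and "\<And>v w. v \<in> V \<Longrightarrow> w \<in> V \<Longrightarrow>
      integrable (gaussian_coords I) (\<lambda>g. F2 t v w (\<lambda>v. \<Sum>i\<in>I. c v i t * g i))"
proof -
  let ?P = "gaussian_coords I"
  define X where "X t g v = (\<Sum>i\<in>I. c v i t * g i)" for t g v
  define S where "S g = (\<Sum>i\<in>I. (g i)\<^sup>2)" for g :: "'i \<Rightarrow> real"
  (* so small that the growth bounds in x = X t g stay below exp (S g / 8) *)
  define a where "a = 1 / (8 * (1 + real (card V) * (real (card I) * B\<^sup>2)))"
  have pos: "1 + real (card V) * (real (card I) * B\<^sup>2) > 0"
    by (simp add: add_pos_nonneg)
  have a: "a > 0"
    unfolding a_def using pos by simp
  have S0: "S g \<ge> 0" for g by (simp add: S_def sum_nonneg)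
  have Xe: "X t g = (\<lambda>v. \<Sum>i\<in>I. c v i t * g i)" for t g
    by (simp add: X_def fun_eq_iff)
  have X2: "exp (a * (\<Sum>v\<in>V. (X t g v)\<^sup>2)) \<le> exp (1/8 * S g)" for t g
  proof -
    have "(\<Sum>v\<in>V. (X t g v)\<^sup>2) \<le> (\<Sum>v\<in>V. real (card I) * B\<^sup>2 * S g)"
      unfolding X_def S_def by (rule sum_mono, rule linear_form_square_le) (use I bc in auto)
    also have "\<dots> = real (card V) * (real (card I) * B\<^sup>2) * S g"
      by simp
    also have "\<dots> \<le> (1 + real (card V) * (real (card I) * B\<^sup>2)) * S g"
      using S0 by (intro mult_right_mono) auto
    finally have "a * (\<Sum>v\<in>V. (X t g v)\<^sup>2) \<le> a * ((1 + real (card V) * (real (card I) * B\<^sup>2)) * S g)"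
      using a by (intro mult_left_mono) auto
    also have "\<dots> = 1/8 * S g"
    proof -
      have "1 / (8 * M) * (M * y) = 1/8 * y" if "M > 0" for M y :: real
        using that by simp
      from this[OF pos] show ?thesis unfolding a_def .
    qed
    finally show ?thesis by simp
  qed
  have mX: "(\<lambda>g. X t g v) \<in> borel_measurable ?P" for t v
    unfolding X_def
    by (intro borel_measurable_sum borel_measurable_times borel_measurable_const measurable_gaussian_coord)
  note [measurable] = mF[OF mX] mF0[OF mX] mF1[OF _ mX] mF2[OF _ _ mX]
  obtain C0 where C0: "\<And>t x. \<bar>F t x\<bar> \<le> C0 * exp (a * (\<Sum>v\<in>V. (x v)\<^sup>2))"
    using bF[OF a] by auto
  obtain C1 where C1: "\<And>t x. \<bar>F0 t x\<bar> \<le> C1 * exp (a * (\<Sum>v\<in>V. (x v)\<^sup>2))"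
    using bF0[OF a] by auto
  have "\<exists>C\<ge>0. \<forall>v\<in>V. \<forall>p. \<bar>(case p of (t, x) \<Rightarrow> F1 t v x)\<bar>
      \<le> C * (case p of (t::real, x) \<Rightarrow> exp (a * (\<Sum>v\<in>V. (x v)\<^sup>2)))"
    using bF1[OF a] V by (intro uniform_constant) (auto simp: split_def)
  then obtain C2 where C2: "C2 \<ge> 0" "\<And>t v x. v \<in> V \<Longrightarrow> \<bar>F1 t v x\<bar> \<le> C2 * exp (a * (\<Sum>v\<in>V. (x v)\<^sup>2))"
    by (auto simp: split_def)
  have "\<exists>C\<ge>0. \<forall>p\<in>V \<times> V. \<forall>x. \<bar>(case p of (v, w) \<Rightarrow> F2 t v w x)\<bar> \<le> C * exp (a * (\<Sum>v\<in>V. (x v)\<^sup>2))" for t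
    using bF2[OF a] V by (intro uniform_constant) (auto simp: split_def)
  then have "\<exists>C\<ge>0. \<forall>v\<in>V. \<forall>w\<in>V. \<forall>x. \<bar>F2 t v w x\<bar> \<le> C * exp (a * (\<Sum>v\<in>V. (x v)\<^sup>2))" for t
    by fastforce
  then obtain C3 where C3': "\<forall>t. C3 t \<ge> 0 \<and>
      (\<forall>v\<in>V. \<forall>w\<in>V. \<forall>x. \<bar>F2 t v w x\<bar> \<le> C3 t * exp (a * (\<Sum>v\<in>V. (x v)\<^sup>2)))"
    by moura
  then have C3: "\<And>t. C3 t \<ge> 0"
    "\<And>t v w x. v \<in> V \<Longrightarrow> w \<in> V \<Longrightarrow> \<bar>F2 t v w x\<bar> \<le> C3 t * exp (a * (\<Sum>v\<in>V. (x v)\<^sup>2))"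
    by auto
  have C01: "C0 \<ge> 0" "C1 \<ge> 0"
    using C0[of 0 "\<lambda>_. 0"] C1[of 0 "\<lambda>_. 0"] by auto
  have up: "y \<le> C * exp (1/8 * S g)" if "y \<le> C * exp (a * (\<Sum>v\<in>V. (X t g v)\<^sup>2))" "C \<ge> 0" for y C t g
    using that X2[of t g] by (meson mult_left_mono order_trans)
  note b0 = up[OF C0 C01(1)] and b1 = up[OF C1 C01(2)]
    and b2 = up[OF C2(2) C2(1)] and b3 = up[OF C3(2) C3(1)]
  have dom4: "integrable ?P (\<lambda>g. K * exp (1/4 * S g))"
    and dom8: "integrable ?P (\<lambda>g. K * exp (1/8 * S g))" for K
    unfolding S_def using I by (intro integrable_mult_right integrable_exp_sum_squares; simp)+
  have iF: "integrable ?P (\<lambda>g. F t (X t g))" for t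
    by (rule Bochner_Integration.integrable_bound[OF dom8[of C0]])
      (use b0 C01 in \<open>auto intro!: always_eventually mF mX simp: abs_mult\<close>)
  have iF0: "integrable ?P (\<lambda>g. F0 t (X t g))" for t
    by (rule Bochner_Integration.integrable_bound[OF dom8[of C1]])
      (use b1 C01 in \<open>auto intro!: always_eventually mF0 mX simp: abs_mult\<close>)
  have iF2: "integrable ?P (\<lambda>g. F2 t v w (X t g))" if "v \<in> V" "w \<in> V" for t v w
    by (rule Bochner_Integration.integrable_bound[OF dom8[of "C3 t"]])
      (use b3 C3(1) that in \<open>auto intro!: always_eventually mF2 mX simp: abs_mult\<close>)
  define D where "D t g = F0 t (X t g) + (\<Sum>v\<in>V. F1 t v (X t g) * (\<Sum>i\<in>I. c' v i t * g i))" for t g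
  have dX: "((\<lambda>s. X s g v) has_real_derivative (\<Sum>i\<in>I. c' v i t * g i)) (at t)" if "v \<in> V" for t g v
    unfolding X_def by (intro DERIV_sum DERIV_cmult_right dc that)
  have der: "((\<lambda>s. F s (X s g)) has_real_derivative D t g) (at t)" for t g
    unfolding D_def by (rule dF) (rule dX)
  have Dm: "D t \<in> borel_measurable ?P" for t
    unfolding D_def
    by (intro borel_measurable_add borel_measurable_sum borel_measurable_times borel_measurable_const
        mF0 mF1 mX measurable_gaussian_coord)
  define K where "K = C1 + (\<Sum>v\<in>V. \<Sum>i\<in>I. 2 * C2 * \<bar>B\<bar>)"
  have tbound: "\<bar>c' v i t * g i\<bar> * \<bar>F1 t v (X t g)\<bar> \<le> 2 * C2 * \<bar>B\<bar> * exp (1/4 * S g)" if "v \<in> V" "i \<in> I" for v i t g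
  proof -
    have "\<bar>g i\<bar> \<le> 2 * exp (1/8 * S g)"
    proof -
      have "(g i)\<^sup>2 \<le> S g"
        unfolding S_def using that I by (intro member_le_sum) auto
      then show ?thesis
        by (intro order_trans[OF abs_le_exp_square]) simp
    qed
    then have "\<bar>c' v i t * g i\<bar> * \<bar>F1 t v (X t g)\<bar> \<le> (\<bar>B\<bar> * (2 * exp (1/8 * S g))) * (C2 * exp (1/8 * S g))"
      unfolding abs_mult using bc'[OF that, of t] that by (intro mult_mono b2) auto
    also have "\<dots> = 2 * C2 * \<bar>B\<bar> * (exp (1/8 * S g) * exp (1/8 * S g))"
      by (simp add: mult_ac)
    also have "exp (1/8 * S g) * exp (1/8 * S g) = exp (1/4 * S g)"
      by (simp add: exp_add [symmetric])
    finally show ?thesis .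
  qed
  have Db: "\<bar>D t g\<bar> \<le> K * exp (1/4 * S g)" for t g
  proof -
    have "\<bar>D t g\<bar> \<le> \<bar>F0 t (X t g)\<bar> + (\<Sum>v\<in>V. \<bar>F1 t v (X t g) * (\<Sum>i\<in>I. c' v i t * g i)\<bar>)"
      unfolding D_def by (intro order_trans[OF abs_triangle_ineq] add_mono sum_abs) auto
    also have "\<dots> \<le> \<bar>F0 t (X t g)\<bar> + (\<Sum>v\<in>V. \<Sum>i\<in>I. \<bar>c' v i t * g i\<bar> * \<bar>F1 t v (X t g)\<bar>)"
      unfolding abs_mult[of "F1 _ _ _"] sum_distrib_right [symmetric]
      by (intro add_mono sum_mono) (auto simp: mult.commute intro!: mult_left_mono sum_abs)
    also have "\<dots> \<le> C1 * exp (1/4 * S g) + (\<Sum>v\<in>V. \<Sum>i\<in>I. 2 * C2 * \<bar>B\<bar> * exp (1/4 * S g))"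
    proof (intro add_mono sum_mono tbound)
      have "\<bar>F0 t (X t g)\<bar> \<le> C1 * exp (1/8 * S g)" by (rule b1)
      also have "\<dots> \<le> C1 * exp (1/4 * S g)"
        using C01 S0[of g] by (intro mult_left_mono) auto
      finally show "\<bar>F0 t (X t g)\<bar> \<le> C1 * exp (1/4 * S g)" .
    qed
    also have "\<dots> = K * exp (1/4 * S g)"
      by (simp add: K_def algebra_simps)
    finally show ?thesis .
  qed
  have main: "((\<lambda>t. LINT g|?P. F t (X t g)) has_real_derivative (LINT g|?P. D t g)) (at t)"
    by (rule has_real_derivative_integral[OF open_UNIV convex_UNIV UNIV_I iF der Db dom4 Dm])
  define \<psi>' where "\<psi>' v i g = (\<Sum>w\<in>V. F2 t v w (X t g) * c w i t)" for v i g
  have ibp: "integrable ?P (\<lambda>g. g i * F1 t v (X t g))" "integrable ?P (\<psi>' v i)"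
    "(LINT g|?P. g i * F1 t v (X t g)) = (LINT g|?P. \<psi>' v i g)" if vi: "v \<in> V" "i \<in> I" for v i
  proof -
    define C where "C = max C2 (\<Sum>w\<in>V. C3 t * \<bar>B\<bar>)"
    have dXi: "((\<lambda>y. X t (g(i := y)) w) has_real_derivative c w i t) (at y)" for g w y
    proof -
      have "X t (g(i := y)) w = X t (g(i := 0)) w + c w i t * y" for y
      proof -
        have "(\<Sum>j\<in>I - {i}. c w j t * (if j = i then y else g j)) = (\<Sum>j\<in>I - {i}. c w j t * g j)" for y
          by (intro sum.cong) auto
        then show ?thesis
          unfolding X_def using vi(2) I by (simp add: sum.remove[of I i])
      qed
      then have "(\<lambda>y. X t (g(i := y)) w) = (\<lambda>y. X t (g(i := 0)) w + c w i t * y)" by (rule ext)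
      then show ?thesis
        by (auto intro!: derivative_eq_intros)
    qed
    have 1: "(\<lambda>g. F1 t v (X t g)) \<in> borel_measurable ?P"
      using vi by (intro mF1 mX)
    have 2: "\<psi>' v i \<in> borel_measurable ?P"
      unfolding \<psi>'_def using vi by (intro borel_measurable_sum borel_measurable_times mF2 mX) auto
    have 3: "((\<lambda>y. F1 t v (X t (g(i := y)))) has_real_derivative \<psi>' v i (g(i := y))) (at y)" for g y
      unfolding \<psi>'_def by (rule dF1[OF vi(1)]) (rule dXi)
    have 4: "continuous_on UNIV (\<lambda>y. \<psi>' v i (g(i := y)))" for g
      unfolding \<psi>'_def
    proof (intro continuous_on_sum continuous_on_mult continuous_on_const cF2 vi)
      show "continuous_on UNIV (\<lambda>y. X t (g(i := y)) u)" for u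
        using dXi by (meson DERIV_isCont continuous_at_imp_continuous_on)
    qed
    have 5: "\<bar>F1 t v (X t g)\<bar> \<le> C * exp (1/8 * (\<Sum>i\<in>I. (g i)\<^sup>2))" for g
    proof -
      have "\<bar>F1 t v (X t g)\<bar> \<le> C2 * exp (1/8 * S g)" by (rule b2[OF vi(1)])
      also have "\<dots> \<le> C * exp (1/8 * S g)" by (intro mult_right_mono) (auto simp: C_def)
      finally show ?thesis unfolding S_def .
    qed
    have 6: "\<bar>\<psi>' v i g\<bar> \<le> C * exp (1/8 * (\<Sum>i\<in>I. (g i)\<^sup>2))" for g
    proof -
      have "\<bar>\<psi>' v i g\<bar> \<le> (\<Sum>w\<in>V. \<bar>F2 t v w (X t g)\<bar> * \<bar>c w i t\<bar>)"
        unfolding \<psi>'_def abs_mult [symmetric] by (rule sum_abs)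
      also have "\<dots> \<le> (\<Sum>w\<in>V. (C3 t * exp (1/8 * S g)) * \<bar>B\<bar>)"
        using bc vi C3(1) by (intro sum_mono mult_mono b3) (auto intro: order_trans[OF bc])
      also have "\<dots> = (\<Sum>w\<in>V. C3 t * \<bar>B\<bar>) * exp (1/8 * S g)"
        by (simp add: mult_ac)
      also have "\<dots> \<le> C * exp (1/8 * S g)" by (intro mult_right_mono) (auto simp: C_def)
      finally show ?thesis unfolding S_def .
    qed
    show "integrable ?P (\<lambda>g. g i * F1 t v (X t g))" "integrable ?P (\<psi>' v i)"
      "(LINT g|?P. g i * F1 t v (X t g)) = (LINT g|?P. \<psi>' v i g)"
      by (rule gaussian_ibp[OF I vi(2) 1 2 3 4 5 6])+
  qed
  have "(LINT g|?P. D t g) = (LINT g|?P. F0 t (X t g)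
      + (\<Sum>v\<in>V. \<Sum>i\<in>I. c' v i t * (g i * F1 t v (X t g))))"
    unfolding D_def by (simp add: sum_distrib_left mult_ac)
  also have "\<dots> = (LINT g|?P. F0 t (X t g)) + (\<Sum>v\<in>V. \<Sum>i\<in>I. c' v i t * (LINT g|?P. \<psi>' v i g))"
  proof -
    have "(LINT g|?P. (\<Sum>v\<in>V. \<Sum>i\<in>I. c' v i t * (g i * F1 t v (X t g))))
        = (\<Sum>v\<in>V. \<Sum>i\<in>I. c' v i t * (LINT g|?P. \<psi>' v i g))"
      using ibp(1) by (simp add: Bochner_Integration.integral_sum ibp(3))
    moreover have "integrable ?P (\<lambda>g. \<Sum>v\<in>V. \<Sum>i\<in>I. c' v i t * (g i * F1 t v (X t g)))"
      using ibp(1) by (intro Bochner_Integration.integrable_sum integrable_mult_right) auto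
    ultimately show ?thesis
      using iF0 by (simp add: Bochner_Integration.integral_add)
  qed
  also have "(\<Sum>v\<in>V. \<Sum>i\<in>I. c' v i t * (LINT g|?P. \<psi>' v i g)) =
      (\<Sum>v\<in>V. \<Sum>i\<in>I. c' v i t * (\<Sum>w\<in>V. c w i t * (LINT g|?P. F2 t v w (X t g))))"
    unfolding \<psi>'_def using iF2 
    by (intro sum.cong refl) (simp add: Bochner_Integration.integral_sum mult.commute)
  also have "\<dots> = (\<Sum>v\<in>V. \<Sum>i\<in>I. \<Sum>w\<in>V. c' v i t * c w i t * (LINT g|?P. F2 t v w (X t g)))"
    by (simp add: sum_distrib_left mult_ac)
  also have "\<dots> = (\<Sum>v\<in>V. \<Sum>w\<in>V. \<Sum>i\<in>I. c' v i t * c w i t * (LINT g|?P. F2 t v w (X t g)))"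
    by (intro sum.cong refl sum.swap)
  also have "\<dots> = (\<Sum>v\<in>V. \<Sum>w\<in>V. (\<Sum>i\<in>I. c' v i t * c w i t) * (LINT g|?P. F2 t v w (X t g)))"
    by (simp add: sum_distrib_right)
  finally show "((\<lambda>t. LINT g|gaussian_coords I. F t (\<lambda>v. \<Sum>i\<in>I. c v i t * g i)) has_real_derivative
      (LINT g|gaussian_coords I. F0 t (\<lambda>v. \<Sum>i\<in>I. c v i t * g i)) +
      (\<Sum>v\<in>V. \<Sum>w\<in>V. (\<Sum>i\<in>I. c' v i t * c w i t) *
        (LINT g|gaussian_coords I. F2 t v w (\<lambda>v. \<Sum>i\<in>I. c v i t * g i)))) (at t)"
    using main by (simp add: Xe)
  show "integrable (gaussian_coords I) (\<lambda>g. F t (\<lambda>v. \<Sum>i\<in>I. c v i t * g i))"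
    using iF[of t] by (simp add: Xe)
  show "integrable (gaussian_coords I) (\<lambda>g. F0 t (\<lambda>v. \<Sum>i\<in>I. c v i t * g i))"
    using iF0[of t] by (simp add: Xe)
  show "integrable (gaussian_coords I) (\<lambda>g. F2 t v w (\<lambda>v. \<Sum>i\<in>I. c v i t * g i))"
    if "v \<in> V" "w \<in> V" for v w
    using iF2[OF that, of t] by (simp add: Xe)
qed

section \<open>The self-consistency equation\<close>

lemma integral_gaussian_coord:
  assumes "i \<in> I" "f \<in> borel_measurable borel"
  shows "(LINT g|gaussian_coords I. f (g i)) = (LINT x|std_gaussian. f x :: real)"
proof -
  have m: "(\<lambda>g. g i) \<in> measurable (gaussian_coords I) std_gaussian"
    using assms(1) unfolding gaussian_coords_def by (rule measurable_component_singleton)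
  have "distr (gaussian_coords I) std_gaussian (\<lambda>g. g i) = std_gaussian"
    unfolding gaussian_coords_def using assms(1) prob_space_std_gaussian
    by (intro distr_PiM_component) auto
  then show ?thesis
    using integral_distr[OF m, of f] assms(2) by simp
qed

lemma tanh_square_lt_1: "(tanh (x::real))\<^sup>2 < 1"
  using tanh_real_gt_neg1[of x] tanh_real_lt_1[of x] by (simp add: abs_square_less_1)

lemmas tanh_square_le_1 = tanh_square_lt_1 [THEN less_imp_le]

definition overlap_map :: "real \<Rightarrow> real \<Rightarrow> real \<Rightarrow> real" where
  "overlap_map \<beta> h q = (LINT z|std_gaussian. (tanh (\<beta> * z * sqrt q + h))\<^sup>2)"

text \<open>The field \<open>\<beta> (\<surd>q cos t z\<^sub>1 + \<surd>q' sin t z\<^sub>2)\<close> interpolates between the two arguments of \<open>tanh\<close>. The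
  derivative of the mean of \<open>tanh\<^sup>2\<close> is \<open>\<beta>\<^sup>2 (q' - q) sin t cos t\<close> times the mean of the second
  derivative of \<open>tanh\<^sup>2\<close>, which is at most 4 in absolute value; the path has length \<open>\<pi>/2 \<le> 2\<close>.\<close>

lemma overlap_map_lipschitz:
  assumes q: "0 \<le> q" "q \<le> 1" "0 \<le> q'" "q' \<le> 1"
  shows "\<bar>overlap_map \<beta> h q' - overlap_map \<beta> h q\<bar> \<le> 4 * \<beta>\<^sup>2 * \<bar>q' - q\<bar>"
proof -
  define c :: "unit \<Rightarrow> bool \<Rightarrow> real \<Rightarrow> real" where
    "c = (\<lambda>v i t. if i then \<beta> * sqrt q * cos t else \<beta> * sqrt q' * sin t)"
  define c' :: "unit \<Rightarrow> bool \<Rightarrow> real \<Rightarrow> real" where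
    "c' = (\<lambda>v i t. if i then - \<beta> * sqrt q * sin t else \<beta> * sqrt q' * cos t)"
  define F :: "real \<Rightarrow> (unit \<Rightarrow> real) \<Rightarrow> real" where "F = (\<lambda>t x. (tanh (x () + h))\<^sup>2)"
  define F1 :: "real \<Rightarrow> unit \<Rightarrow> (unit \<Rightarrow> real) \<Rightarrow> real" where
    "F1 = (\<lambda>t v x. 2 * tanh (x () + h) * (1 - (tanh (x () + h))\<^sup>2))"
  define F2 :: "real \<Rightarrow> unit \<Rightarrow> unit \<Rightarrow> (unit \<Rightarrow> real) \<Rightarrow> real" where
    "F2 = (\<lambda>t v w x. 2 * (1 - (tanh (x () + h))\<^sup>2) * (1 - 3 * (tanh (x () + h))\<^sup>2))"
  let ?X = "\<lambda>t g v. \<Sum>i\<in>UNIV. c v i t * g i"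
  define \<phi> where "\<phi> t = (LINT g|gaussian_coords UNIV. F t (?X t g))" for t
  define \<phi>' where "\<phi>' t = (\<Sum>i\<in>UNIV. c' () i t * c () i t) * (LINT g|gaussian_coords UNIV. F2 t () () (?X t g))" for t
  have F2b: "\<bar>F2 t v w x\<bar> \<le> 4" for t v w x
  proof -
    define u where "u = (tanh (x () + h))\<^sup>2"
    have u: "0 \<le> u" "u \<le> 1"
      by (auto simp: u_def tanh_square_le_1)
    have "\<bar>F2 t v w x\<bar> = 2 * \<bar>1 - u\<bar> * \<bar>1 - 3 * u\<bar>"
      by (simp only: F2_def u_def abs_mult abs_numeral)
    also have "\<dots> \<le> (2 * 1) * 2"
      using u by (intro mult_mono) auto
    finally show ?thesis by simp
  qed
  have F1b: "\<bar>F1 t v x\<bar> \<le> 2" for t v x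
  proof -
    have "\<bar>F1 t v x\<bar> = 2 * \<bar>tanh (x () + h)\<bar> * \<bar>1 - (tanh (x () + h))\<^sup>2\<bar>"
      by (simp only: F1_def abs_mult abs_numeral)
    also have "\<dots> \<le> (2 * 1) * 1"
      using tanh_square_le_1[of "x () + h"]
      by (intro mult_mono) (auto simp: abs_square_le_1)
    finally show ?thesis by simp
  qed
  have bound: "\<exists>C. \<forall>t x. \<bar>f t x\<bar> \<le> C * exp (a * (\<Sum>v\<in>UNIV. (x v)\<^sup>2))"
    if "a > 0" "\<And>t x. \<bar>f t x\<bar> \<le> K" for a K and f :: "real \<Rightarrow> (unit \<Rightarrow> real) \<Rightarrow> real"
  proof (intro exI[of _ K] allI)
    fix t and x :: "unit \<Rightarrow> real"
    have "K \<ge> 0" using that(2)[of 0 "\<lambda>_. 0"] by simp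
    moreover have "1 \<le> exp (a * (\<Sum>v\<in>UNIV. (x v)\<^sup>2))"
      using that(1) by (simp add: sum_nonneg)
    ultimately have "K * 1 \<le> K * exp (a * (\<Sum>v\<in>UNIV. (x v)\<^sup>2))"
      by (rule mult_left_mono[rotated])
    then show "\<bar>f t x\<bar> \<le> K * exp (a * (\<Sum>v\<in>UNIV. (x v)\<^sup>2))"
      using that(2)[of t x] by simp
  qed
  have der: "(\<phi> has_real_derivative \<phi>' t) (at t)"
    and int: "integrable (gaussian_coords UNIV) (\<lambda>g. F2 t () () (?X t g))" for t
  proof -
    have d: "((\<lambda>s. tanh (x s + h)) has_real_derivative (1 - (tanh (x t + h))\<^sup>2) * x') (at t)"
      if "(x has_real_derivative x') (at t)" for x x' t
      using that by (auto intro!: derivative_eq_intros)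
    note gi = gaussian_interpolation[where I=UNIV and V=UNIV and c=c and c'=c'
      and B="\<bar>\<beta>\<bar>" and F=F and ?F0.0="\<lambda>_ _. 0" and ?F1.0=F1 and ?F2.0=F2]
    have 1: "(c v i has_real_derivative c' v i t) (at t)" for v i t
      unfolding c_def c'_def by (cases i) (auto intro!: derivative_eq_intros)
    have sq: "sqrt q \<le> 1" "sqrt q' \<le> 1" "0 \<le> sqrt q" "0 \<le> sqrt q'" using q by auto
    have b: "\<bar>\<beta> * r * y\<bar> \<le> \<bar>\<beta>\<bar>" if "0 \<le> r" "r \<le> 1" "\<bar>y\<bar> \<le> 1" for r y :: real
    proof -
      have "\<bar>\<beta>\<bar> * \<bar>r\<bar> * \<bar>y\<bar> \<le> \<bar>\<beta>\<bar> * 1 * 1"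
        using that by (intro mult_mono) auto
      then show ?thesis by (simp add: abs_mult)
    qed
    have 2: "\<bar>c v i t\<bar> \<le> \<bar>\<beta>\<bar>" for v i t
      unfolding c_def using b sq by auto
    have 3: "\<bar>c' v i t\<bar> \<le> \<bar>\<beta>\<bar>" for v i t
      unfolding c'_def using b[of _ "sin t"] b[of _ "cos t"] sq by auto
    have 4: "((\<lambda>s. F s (x s)) has_real_derivative 0 + (\<Sum>v\<in>UNIV. F1 t v (x t) * x' v)) (at t)"
      if "\<And>v. v \<in> UNIV \<Longrightarrow> ((\<lambda>s. x s v) has_real_derivative x' v) (at t)" for x x' t
      unfolding F_def F1_def UNIV_unit
      using DERIV_power[OF d[OF that[of "()"]], of 2] by (simp add: mult_ac)
    have 5: "((\<lambda>y. F1 s v (x y)) has_real_derivative (\<Sum>w\<in>UNIV. F2 s v w (x t) * x' w)) (at t)"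
      if "\<And>v. v \<in> UNIV \<Longrightarrow> ((\<lambda>s. x s v) has_real_derivative x' v) (at t)" for x x' s v t
      unfolding F1_def F2_def UNIV_unit
    proof -
      have "((\<lambda>y. 2 * tanh (x y () + h) * (1 - (tanh (x y () + h))\<^sup>2)) has_real_derivative
        2 * ((1 - (tanh (x t () + h))\<^sup>2) * x' ()) * (1 - (tanh (x t () + h))\<^sup>2)
        + (0 - 2 * tanh (x t () + h) * ((1 - (tanh (x t () + h))\<^sup>2) * x' ())) * (2 * tanh (x t () + h))) (at t)"
        using DERIV_mult[OF DERIV_cmult[OF d[OF that[of "()"]], of 2]
            DERIV_diff[OF DERIV_const[of 1] DERIV_power[OF d[OF that[of "()"]], of 2]]]
        by (simp add: mult_ac)
      then show "((\<lambda>y. 2 * tanh (x y () + h) * (1 - (tanh (x y () + h))\<^sup>2)) has_real_derivative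
        (\<Sum>w\<in>{()}. 2 * (1 - (tanh (x t () + h))\<^sup>2) * (1 - 3 * (tanh (x t () + h))\<^sup>2) * x' w)) (at t)"
        by (rule DERIV_cong) (simp add: power2_eq_square algebra_simps)
    qed
    have tc: "continuous_on UNIV (\<lambda>y. tanh (x y () + h))"
      if "\<And>u. u \<in> UNIV \<Longrightarrow> continuous_on UNIV (\<lambda>y. x y u)" for x :: "real \<Rightarrow> unit \<Rightarrow> real"
      using that[of "()"] by (intro continuous_intros) auto
    have 6: "continuous_on UNIV (\<lambda>y. F2 s v w (x y))"
      if "\<And>u. u \<in> UNIV \<Longrightarrow> continuous_on UNIV (\<lambda>y. x y u)" for s v w and x :: "real \<Rightarrow> unit \<Rightarrow> real"
      unfolding F2_def by (intro continuous_intros tc that)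
    have tm: "(\<lambda>g. tanh (X () g + h)) \<in> borel_measurable M"
      if "\<And>v. v \<in> UNIV \<Longrightarrow> X v \<in> borel_measurable M" for X M
    proof -
      have "continuous_on UNIV (tanh :: real \<Rightarrow> real)"
        by (intro continuous_intros) auto
      then show ?thesis
        by (rule borel_measurable_continuous_on)
          (intro borel_measurable_add borel_measurable_const that UNIV_I)
    qed
    have 7: "\<bar>F t x\<bar> \<le> 1" for t x
      unfolding F_def using tanh_square_le_1 by auto
    have mm: "(\<lambda>g. F t (\<lambda>v. X v g)) \<in> borel_measurable (gaussian_coords UNIV)"
      "(\<lambda>g. F1 t v (\<lambda>v. X v g)) \<in> borel_measurable (gaussian_coords UNIV)"
      "(\<lambda>g. F2 t v w (\<lambda>v. X v g)) \<in> borel_measurable (gaussian_coords UNIV)"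
      if "\<And>v. v \<in> UNIV \<Longrightarrow> X v \<in> borel_measurable (gaussian_coords UNIV)"
      for t v w and X :: "unit \<Rightarrow> (bool \<Rightarrow> real) \<Rightarrow> real"
    proof -
      note [measurable] = tm[of X, OF that]
      show "(\<lambda>g. F t (\<lambda>v. X v g)) \<in> borel_measurable (gaussian_coords UNIV)"
        "(\<lambda>g. F1 t v (\<lambda>v. X v g)) \<in> borel_measurable (gaussian_coords UNIV)"
        "(\<lambda>g. F2 t v w (\<lambda>v. X v g)) \<in> borel_measurable (gaussian_coords UNIV)"
        unfolding F_def F1_def F2_def by measurable
    qed
    have b0: "\<exists>C. \<forall>t x. \<bar>0::real\<bar> \<le> C * exp (a * (\<Sum>v\<in>UNIV. (x v)\<^sup>2))" for a :: real
      by (intro exI[of _ 0]) auto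
    have bF: "\<exists>C. \<forall>t x. \<bar>F t x\<bar> \<le> C * exp (a * (\<Sum>v\<in>UNIV. (x v)\<^sup>2))" if "a > 0" for a
      using bound[OF that, of F 1] 7 by blast
    have bF1: "\<exists>C. \<forall>t x. \<bar>F1 t v x\<bar> \<le> C * exp (a * (\<Sum>v\<in>UNIV. (x v)\<^sup>2))" if "a > 0" for a v
      using bound[OF that, of "\<lambda>t. F1 t v" 2] F1b by blast
    have bF2: "\<exists>C. \<forall>x. \<bar>F2 t v w x\<bar> \<le> C * exp (a * (\<Sum>v\<in>UNIV. (x v)\<^sup>2))" if "a > 0" for a t v w
      using bound[OF that, of "\<lambda>t. F2 t v w" 4] F2b by blast
    have "((\<lambda>t. LINT g|gaussian_coords UNIV. F t (?X t g)) has_real_derivative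
        (LINT g|gaussian_coords (UNIV::bool set). 0) + (\<Sum>v\<in>UNIV. \<Sum>w\<in>UNIV. (\<Sum>i\<in>UNIV. c' v i t * c w i t) *
        (LINT g|gaussian_coords UNIV. F2 t v w (?X t g)))) (at t)"
      by (rule gi(1)) (use 1 2 3 4 5 6 bF bF1 bF2 mm b0 in auto)
    then show "(\<phi> has_real_derivative \<phi>' t) (at t)"
      unfolding \<phi>_def [abs_def] \<phi>'_def by (simp add: UNIV_unit)
    show "integrable (gaussian_coords UNIV) (\<lambda>g. F2 t () () (?X t g))"
      by (rule gi(4)) (use 1 2 3 4 5 6 bF bF1 bF2 mm b0 in auto)
  qed
  have \<phi>b: "\<bar>\<phi>' t\<bar> \<le> 2 * \<beta>\<^sup>2 * \<bar>q' - q\<bar>" for t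
  proof -
    interpret G: prob_space "gaussian_coords (UNIV::bool set)" by (rule prob_space_gaussian_coords)
    have "\<bar>LINT g|gaussian_coords UNIV. F2 t () () (?X t g)\<bar> \<le> (LINT g|gaussian_coords (UNIV::bool set). 4)"
      using int[of t] F2b by (intro order_trans[OF integral_abs_bound] integral_mono) auto
    then have 1: "\<bar>LINT g|gaussian_coords UNIV. F2 t () () (?X t g)\<bar> \<le> 4"
      by (simp add: G.prob_space)
    have "(\<Sum>i\<in>UNIV. c' () i t * c () i t)
        = c' () False t * c () False t + c' () True t * c () True t"
      by (simp add: UNIV_bool)
    also have "\<dots> = (\<beta> * sqrt q' * cos t) * (\<beta> * sqrt q' * sin t)
        + (- \<beta> * sqrt q * sin t) * (\<beta> * sqrt q * cos t)"
      unfolding c_def c'_def if_True if_False by (rule refl)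
    also have "\<dots> = \<beta>\<^sup>2 * ((sqrt q')\<^sup>2 - (sqrt q)\<^sup>2) * (sin t * cos t)"
      by algebra
    also have "\<dots> = \<beta>\<^sup>2 * (q' - q) * (sin (2 * t) / 2)"
      using q by (simp add: sin_double)
    finally have S: "(\<Sum>i\<in>UNIV. c' () i t * c () i t) = \<beta>\<^sup>2 * (q' - q) * (sin (2 * t) / 2)" .
    have "\<bar>\<phi>' t\<bar> = \<beta>\<^sup>2 * \<bar>q' - q\<bar> * (\<bar>sin (2 * t)\<bar> / 2) * \<bar>LINT g|gaussian_coords UNIV. F2 t () () (?X t g)\<bar>"
      unfolding \<phi>'_def S by (simp add: abs_mult)
    also have "\<dots> \<le> \<beta>\<^sup>2 * \<bar>q' - q\<bar> * (1 / 2) * 4"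
      using 1 by (intro mult_mono) auto
    finally show ?thesis by (simp add: mult_ac)
  qed
  have ends: "\<phi> 0 = overlap_map \<beta> h q" "\<phi> (pi / 2) = overlap_map \<beta> h q'"
  proof -
    have m: "(\<lambda>y. (tanh (\<beta> * y * r + h))\<^sup>2) \<in> borel_measurable borel" for r :: real
      by (intro borel_measurable_continuous_onI continuous_intros) auto
    show "\<phi> 0 = overlap_map \<beta> h q"
      using integral_gaussian_coord[OF UNIV_I m, of True "sqrt q"]
      by (simp add: \<phi>_def F_def overlap_map_def UNIV_bool c_def mult_ac)
    show "\<phi> (pi / 2) = overlap_map \<beta> h q'"
      using integral_gaussian_coord[OF UNIV_I m, of False "sqrt q'"]
      by (simp add: \<phi>_def F_def overlap_map_def UNIV_bool c_def mult_ac)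
  qed
  have "norm (\<phi> (pi / 2) - \<phi> 0) \<le> 2 * \<beta>\<^sup>2 * \<bar>q' - q\<bar> * norm (pi / 2 - 0)"
    using der \<phi>b by (intro field_differentiable_bound[of UNIV \<phi> \<phi>']) auto
  also have "\<dots> \<le> 2 * \<beta>\<^sup>2 * \<bar>q' - q\<bar> * 2"
    using pi_less_4 by (intro mult_left_mono) auto
  finally show ?thesis
    by (simp add: ends)
qed

text \<open>For \<open>\<beta> < 1/2\<close> the map is a contraction of the unit interval, and it takes its values there, so
  every nonnegative solution is the fixed point. It is smaller than 1 because \<open>tanh\<^sup>2\<close> is.\<close>

lemma sk_q_fixed_point:
  assumes "0 < \<beta>" "\<beta> < 1 / 2"
  shows "0 \<le> sk_q \<beta> h" "sk_q \<beta> h < 1" "sk_q \<beta> h = overlap_map \<beta> h (sk_q \<beta> h)"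
proof -
  have m: "(\<lambda>y. (tanh (\<beta> * y * r + h))\<^sup>2) \<in> borel_measurable borel" for r :: real
    by (intro borel_measurable_continuous_onI continuous_intros) auto
  have int: "integrable std_gaussian (\<lambda>z. (tanh (\<beta> * z * r + h))\<^sup>2)" for r
    using m tanh_square_le_1 by (intro gauss1.integrable_const_bound[of _ 1]) auto
  have range: "0 \<le> overlap_map \<beta> h q" "overlap_map \<beta> h q \<le> 1" for q
  proof -
    show "0 \<le> overlap_map \<beta> h q" unfolding overlap_map_def by (rule integral_nonneg_AE) auto
    have "overlap_map \<beta> h q \<le> (LINT z|std_gaussian. 1)"
      unfolding overlap_map_def using int tanh_square_le_1 by (intro integral_mono) auto
    then show "overlap_map \<beta> h q \<le> 1" using gauss1.prob_space by simp
  qed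
  have "\<beta>\<^sup>2 < (1/2)\<^sup>2"
    using assms by (intro power_strict_mono) auto
  then have b: "4 * \<beta>\<^sup>2 < 1" by (simp add: power2_eq_square)
  have "\<exists>!q. q \<in> {0..1} \<and> overlap_map \<beta> h q = q"
    by (rule Banach_fix[of _ "4 * \<beta>\<^sup>2"])
      (use b range overlap_map_lipschitz in \<open>auto simp: dist_real_def complete_eq_closed\<close>)
  then have "\<exists>!q. 0 \<le> q \<and> q = overlap_map \<beta> h q"
    using range by (metis atLeastAtMost_iff)
  then have *: "0 \<le> sk_q \<beta> h \<and> sk_q \<beta> h = overlap_map \<beta> h (sk_q \<beta> h)"
    unfolding sk_q_def overlap_map_def by (rule theI')
  then show "0 \<le> sk_q \<beta> h" and fp: "sk_q \<beta> h = overlap_map \<beta> h (sk_q \<beta> h)" by auto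
  have "overlap_map \<beta> h q < 1" for q
  proof -
    show ?thesis
      unfolding overlap_map_def
      by (rule gauss1.expectation_less) (use int tanh_square_lt_1 in auto)
  qed
  then show "sk_q \<beta> h < 1" using fp by metis
qed

section \<open>Gibbs averages as functions of the energies\<close>

text \<open>The energies \<open>x\<close> are the Gaussian fields with respect to which derivatives are taken, and \<open>m\<close> is a
  fixed external energy.\<close>

definition weight :: "'s set \<Rightarrow> ('s \<Rightarrow> real) \<Rightarrow> ('s \<Rightarrow> real) \<Rightarrow> 's \<Rightarrow> real" where
  "weight S m x \<sigma> = exp (x \<sigma> + m \<sigma>) / (\<Sum>\<rho>\<in>S. exp (x \<rho> + m \<rho>))"

definition avg :: "'s set \<Rightarrow> ('s \<Rightarrow> real) \<Rightarrow> ('s \<Rightarrow> real) \<Rightarrow> ('s \<Rightarrow> real) \<Rightarrow> real" where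
  "avg S m x f = (\<Sum>\<sigma>\<in>S. weight S m x \<sigma> * f \<sigma>)"

lemma partition_pos:
  "finite S \<Longrightarrow> S \<noteq> {} \<Longrightarrow> (\<Sum>\<rho>\<in>S. exp (x \<rho> + m \<rho> :: real)) > 0"
  by (intro sum_pos) auto

lemma weight_nonneg: "0 \<le> weight S m x \<sigma>"
  by (simp add: weight_def sum_nonneg)

lemma sum_weight:
  assumes "finite S" "S \<noteq> {}"
  shows "(\<Sum>\<sigma>\<in>S. weight S m x \<sigma>) = 1"
  using partition_pos[OF assms, of x m]
  by (simp add: weight_def sum_divide_distrib [symmetric])

lemma weight_le_1:
  assumes "finite S" "\<sigma> \<in> S"
  shows "weight S m x \<sigma> \<le> 1"
proof -
  have "S \<noteq> {}" using assms(2) by auto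
  then show ?thesis
    using member_le_sum[of \<sigma> S "weight S m x"] assms sum_weight[of S m x]
    by (simp add: weight_nonneg)
qed

lemma avg_ge:
  assumes "finite S" "S \<noteq> {}" "\<And>\<sigma>. \<sigma> \<in> S \<Longrightarrow> a \<le> f \<sigma>"
  shows "a \<le> avg S m x f"
proof -
  have "(\<Sum>\<sigma>\<in>S. weight S m x \<sigma> * a) \<le> avg S m x f"
    unfolding avg_def using assms(3) by (intro sum_mono mult_left_mono weight_nonneg)
  then show ?thesis
    using sum_weight[OF assms(1,2), of m x] by (simp add: sum_distrib_right [symmetric])
qed

lemma avg_le:
  assumes "finite S" "S \<noteq> {}" "\<And>\<sigma>. \<sigma> \<in> S \<Longrightarrow> f \<sigma> \<le> b"
  shows "avg S m x f \<le> b"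
proof -
  have "avg S m x f \<le> (\<Sum>\<sigma>\<in>S. weight S m x \<sigma> * b)"
    unfolding avg_def using assms(3) by (intro sum_mono mult_left_mono weight_nonneg)
  then show ?thesis
    using sum_weight[OF assms(1,2), of m x] by (simp add: sum_distrib_right [symmetric])
qed

lemma weight_has_derivative:
  assumes S: "finite S" "S \<noteq> {}" and \<sigma>: "\<sigma> \<in> S"
    and x: "\<And>\<rho>. \<rho> \<in> S \<Longrightarrow> ((\<lambda>s. x s \<rho>) has_real_derivative x' \<rho>) (at t)"
  shows "((\<lambda>s. weight S m (x s) \<sigma>) has_real_derivative
    weight S m (x t) \<sigma> * (x' \<sigma> - avg S m (x t) x')) (at t)"
proof -
  define Z where "Z s = (\<Sum>\<rho>\<in>S. exp (x s \<rho> + m \<rho>))" for s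
  have Z: "Z s > 0" for s unfolding Z_def by (rule partition_pos[OF S])
  have e: "((\<lambda>s. exp (x s \<rho> + m \<rho>)) has_real_derivative exp (x t \<rho> + m \<rho>) * x' \<rho>) (at t)" if "\<rho> \<in> S" for \<rho>
    using x[OF that] by (auto intro!: derivative_eq_intros)
  have "(Z has_real_derivative (\<Sum>\<rho>\<in>S. exp (x t \<rho> + m \<rho>) * x' \<rho>)) (at t)"
    unfolding Z_def [abs_def] by (intro DERIV_sum e)
  also have "(\<Sum>\<rho>\<in>S. exp (x t \<rho> + m \<rho>) * x' \<rho>) = Z t * avg S m (x t) x'"
    using Z[of t] by (simp add: avg_def weight_def Z_def sum_distrib_left)
  finally have dZ: "(Z has_real_derivative Z t * avg S m (x t) x') (at t)" .
  have "((\<lambda>s. exp (x s \<sigma> + m \<sigma>) / Z s) has_real_derivative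
      exp (x t \<sigma> + m \<sigma>) / Z t * (x' \<sigma> - avg S m (x t) x')) (at t)"
    using DERIV_divide[OF e[OF \<sigma>] dZ] Z[of t]
    by (auto elim!: DERIV_cong simp: field_simps)
  then show ?thesis by (simp add: weight_def Z_def)
qed

lemma avg_has_derivative:
  assumes S: "finite S" "S \<noteq> {}"
    and x: "\<And>\<rho>. \<rho> \<in> S \<Longrightarrow> ((\<lambda>s. x s \<rho>) has_real_derivative x' \<rho>) (at t)"
    and f: "\<And>\<rho>. \<rho> \<in> S \<Longrightarrow> ((\<lambda>s. f s \<rho>) has_real_derivative f' \<rho>) (at t)"
  shows "((\<lambda>s. avg S m (x s) (f s)) has_real_derivative
    avg S m (x t) f' + (\<Sum>\<kappa>\<in>S. weight S m (x t) \<kappa> * (f t \<kappa> - avg S m (x t) (f t)) * x' \<kappa>)) (at t)"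
proof -
  have "((\<lambda>s. avg S m (x s) (f s)) has_real_derivative
    (\<Sum>\<sigma>\<in>S. weight S m (x t) \<sigma> * (x' \<sigma> - avg S m (x t) x') * f t \<sigma>
      + f' \<sigma> * weight S m (x t) \<sigma>)) (at t)"
    unfolding avg_def [of S m _ "f _"]
    by (intro DERIV_sum DERIV_mult weight_has_derivative[OF S _ x] f)
  moreover have "(\<Sum>\<sigma>\<in>S. weight S m (x t) \<sigma> * (x' \<sigma> - avg S m (x t) x') * f t \<sigma>)
      = (\<Sum>\<kappa>\<in>S. weight S m (x t) \<kappa> * (f t \<kappa> - avg S m (x t) (f t)) * x' \<kappa>)"
  proof -
    have "(\<Sum>\<sigma>\<in>S. weight S m (x t) \<sigma> * (x' \<sigma> - avg S m (x t) x') * f t \<sigma>)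
      = (\<Sum>\<sigma>\<in>S. weight S m (x t) \<sigma> * f t \<sigma> * x' \<sigma>) - avg S m (x t) x' * avg S m (x t) (f t)"
      unfolding avg_def[of S m "x t" "f t"]
      by (simp add: algebra_simps sum_subtractf sum_distrib_left)
    also have "\<dots> = (\<Sum>\<kappa>\<in>S. weight S m (x t) \<kappa> * (f t \<kappa> - avg S m (x t) (f t)) * x' \<kappa>)"
      unfolding avg_def[of S m "x t" x']
      by (simp add: algebra_simps sum_subtractf sum_distrib_left)
    finally show ?thesis .
  qed
  moreover have "(\<Sum>\<sigma>\<in>S. f' \<sigma> * weight S m (x t) \<sigma>) = avg S m (x t) f'"
    by (simp add: avg_def mult.commute)
  ultimately show ?thesis
    by (simp add: sum.distrib add.commute)
qed

lemma weight_measurable: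
  assumes "finite S" "\<sigma> \<in> S" "\<And>\<rho>. \<rho> \<in> S \<Longrightarrow> X \<rho> \<in> borel_measurable M"
  shows "(\<lambda>g. weight S m (\<lambda>\<rho>. X \<rho> g) \<sigma>) \<in> borel_measurable M"
proof -
  have "(\<lambda>g. exp (X \<rho> g + m \<rho>)) \<in> borel_measurable M" if "\<rho> \<in> S" for \<rho>
    using assms(3)[OF that] by measurable
  then show ?thesis
    unfolding weight_def using assms(2) by (intro borel_measurable_divide borel_measurable_sum) auto
qed

lemma weight_continuous:
  assumes "finite S" "\<sigma> \<in> S" "\<And>\<rho>. \<rho> \<in> S \<Longrightarrow> continuous_on A (\<lambda>y. x y \<rho>)"
  shows "continuous_on A (\<lambda>y. weight S m (x y) \<sigma>)"
proof -
  have "S \<noteq> {}" using assms(2) by auto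
  then have "(\<Sum>\<rho>\<in>S. exp (x y \<rho> + m \<rho>)) \<noteq> 0" for y
    using partition_pos[OF assms(1), of "x y" m] by linarith
  then show ?thesis
    unfolding weight_def using assms(2,3) by (intro continuous_intros) auto
qed

text \<open>Chebyshev's inequality: the double sum of \<open>p\<^sub>i p\<^sub>j (u\<^sub>i - u\<^sub>j) (v\<^sub>i - v\<^sub>j)\<close> has nonnegative terms, and it
  is twice the difference of the two sides.\<close>

lemma chebyshev_correlation:
  fixes p u v :: "'a \<Rightarrow> real"
  assumes "\<And>i. i \<in> A \<Longrightarrow> p i \<ge> 0" "(\<Sum>i\<in>A. p i) = 1"
    and mono: "\<And>i j. i \<in> A \<Longrightarrow> j \<in> A \<Longrightarrow> u i \<le> u j \<Longrightarrow> v i \<le> v j"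
  shows "(\<Sum>i\<in>A. p i * u i) * (\<Sum>i\<in>A. p i * v i) \<le> (\<Sum>i\<in>A. p i * (u i * v i))"
proof -
  have "0 \<le> (\<Sum>i\<in>A. \<Sum>j\<in>A. p i * p j * ((u i - u j) * (v i - v j)))"
  proof (intro sum_nonneg)
    fix i j assume ij: "i \<in> A" "j \<in> A"
    then have "0 \<le> (u i - u j) * (v i - v j)"
      using mono[of i j] mono[of j i] by (cases "u i \<le> u j") (auto intro: mult_nonpos_nonpos)
    then show "0 \<le> p i * p j * ((u i - u j) * (v i - v j))"
      using ij assms(1) by simp
  qed
  also have "\<dots> = (\<Sum>i\<in>A. \<Sum>j\<in>A. p i * (u i * v i) * p j + p i * (p j * (u j * v j))
      - (p i * u i) * (p j * v j) - (p i * v i) * (p j * u j))"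
    by (intro sum.cong refl) (simp add: algebra_simps)
  also have "\<dots> = 2 * (\<Sum>i\<in>A. p i * (u i * v i)) - 2 * ((\<Sum>i\<in>A. p i * u i) * (\<Sum>i\<in>A. p i * v i))"
    by (simp add: sum.distrib sum_subtractf sum_distrib_left [symmetric] sum_distrib_right [symmetric]
        assms(2))
  finally show ?thesis by simp
qed

section \<open>Two coupled replicas along an interpolation\<close>

text \<open>The function \<open>F\<close> is the average of \<open>E = exp (lam t \<Delta>)\<close> over two replicas, and \<open>e\<close> is the average over
  the second replica when the first is fixed. The partial derivatives of \<open>F\<close> are \<open>F0\<close> in \<open>t\<close>,
  \<open>F1\<close> in one energy and \<open>F2\<close> in two energies.\<close>

locale replica_pair =
  fixes S :: "'s set" and m :: "'s \<Rightarrow> real" and \<Delta> :: "'s \<Rightarrow> 's \<Rightarrow> real" and lam lam' :: "real \<Rightarrow> real"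
    and s :: real
  assumes S: "finite S" "S \<noteq> {}"
    and sym: "\<And>\<sigma> \<tau>. \<Delta> \<sigma> \<tau> = \<Delta> \<tau> \<sigma>"
    and \<Delta>: "\<And>\<sigma> \<tau>. \<Delta> \<sigma> \<tau> \<ge> 0"
    and dlam: "\<And>t. (lam has_real_derivative lam' t) (at t)"
    and lam: "\<And>t. 0 \<le> lam t" "\<And>t. lam t \<le> s" "\<And>t. \<bar>lam' t\<bar> \<le> s"
begin

abbreviation w where "w \<equiv> weight S m"
abbreviation av where "av \<equiv> avg S m"
definition E where "E t \<sigma> \<tau> = exp (lam t * \<Delta> \<sigma> \<tau>)"
definition e where "e t x \<sigma> = av x (E t \<sigma>)"
definition F where "F t x = av x (e t x)"
definition F0 where "F0 t x = av x (\<lambda>\<sigma>. av x (\<lambda>\<tau>. lam' t * \<Delta> \<sigma> \<tau> * E t \<sigma> \<tau>))"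
definition F1 where "F1 t \<kappa> x = 2 * (w x \<kappa> * (e t x \<kappa> - F t x))"
definition F2 where "F2 t \<kappa> \<rho> x = 2 * w x \<kappa> * (((if \<rho> = \<kappa> then 1 else 0) - w x \<rho>) * (e t x \<kappa> - F t x)
    + w x \<rho> * (E t \<kappa> \<rho> - e t x \<kappa>) - 2 * (w x \<rho> * (e t x \<rho> - F t x)))"
definition D where "D = (\<Sum>\<sigma>\<in>S. \<Sum>\<tau>\<in>S. \<Delta> \<sigma> \<tau>)"

lemma av_swap:
  assumes "\<And>\<sigma> \<tau>. \<sigma> \<in> S \<Longrightarrow> \<tau> \<in> S \<Longrightarrow> f \<sigma> \<tau> = g \<tau> \<sigma>"
  shows "av x (\<lambda>\<sigma>. av x (f \<sigma>)) = av x (\<lambda>\<sigma>. av x (g \<sigma>))"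
proof -
  have "av x (\<lambda>\<sigma>. av x (f \<sigma>)) = (\<Sum>\<sigma>\<in>S. \<Sum>\<tau>\<in>S. w x \<sigma> * w x \<tau> * f \<sigma> \<tau>)"
    by (simp add: avg_def sum_distrib_left mult_ac)
  also have "\<dots> = (\<Sum>\<tau>\<in>S. \<Sum>\<sigma>\<in>S. w x \<sigma> * w x \<tau> * f \<sigma> \<tau>)"
    by (rule sum.swap)
  also have "\<dots> = (\<Sum>\<tau>\<in>S. \<Sum>\<sigma>\<in>S. w x \<tau> * (w x \<sigma> * g \<tau> \<sigma>))"
    using assms by (intro sum.cong refl) (simp add: mult_ac)
  also have "\<dots> = av x (\<lambda>\<sigma>. av x (g \<sigma>))"
    by (simp add: avg_def sum_distrib_left)
  finally show ?thesis .
qed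

lemma D: "\<sigma> \<in> S \<Longrightarrow> \<tau> \<in> S \<Longrightarrow> \<Delta> \<sigma> \<tau> \<le> D" "D \<ge> 0"
proof -
  show "D \<ge> 0" unfolding D_def by (intro sum_nonneg \<Delta>)
  assume st: "\<sigma> \<in> S" "\<tau> \<in> S"
  have "\<Delta> \<sigma> \<tau> \<le> (\<Sum>\<tau>\<in>S. \<Delta> \<sigma> \<tau>)"
    using st S \<Delta> by (intro member_le_sum) auto
  also have "\<dots> \<le> D"
    unfolding D_def using st S \<Delta> by (intro member_le_sum) (auto intro: sum_nonneg)
  finally show "\<Delta> \<sigma> \<tau> \<le> D" .
qed

lemma s_nonneg: "s \<ge> 0"
  using lam(1,2)[of 0] by linarith

lemma E_bounds: "0 \<le> E t \<sigma> \<tau>" "\<sigma> \<in> S \<Longrightarrow> \<tau> \<in> S \<Longrightarrow> E t \<sigma> \<tau> \<le> exp (s * D)"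
  unfolding E_def using lam D \<Delta> s_nonneg by (auto intro!: mult_mono)

lemma e_bounds: "\<sigma> \<in> S \<Longrightarrow> 0 \<le> e t x \<sigma>" "\<sigma> \<in> S \<Longrightarrow> e t x \<sigma> \<le> exp (s * D)"
  unfolding e_def using E_bounds by (auto intro!: avg_ge avg_le S)

lemma F_bounds: "0 \<le> F t x" "F t x \<le> exp (s * D)"
  unfolding F_def using e_bounds by (auto intro!: avg_ge avg_le S)

lemma w_bounds: "0 \<le> w x \<sigma>" "\<sigma> \<in> S \<Longrightarrow> w x \<sigma> \<le> 1"
  using weight_nonneg weight_le_1[OF S(1)] by auto

lemma F0_bound: "\<bar>F0 t x\<bar> \<le> s * D * exp (s * D)"
proof -
  let ?K = "s * D * exp (s * D)"
  have "\<bar>lam' t * \<Delta> \<sigma> \<tau> * E t \<sigma> \<tau>\<bar> \<le> ?K" if "\<sigma> \<in> S" "\<tau> \<in> S" for \<sigma> \<tau>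
    unfolding abs_mult using that lam \<Delta> D E_bounds s_nonneg by (intro mult_mono) auto
  note b = abs_le_D1[OF this] minus_le_iff[THEN iffD1, OF abs_le_D2[OF this]]
  have i: "- ?K \<le> av x (\<lambda>\<tau>. lam' t * \<Delta> \<sigma> \<tau> * E t \<sigma> \<tau>)"
    "av x (\<lambda>\<tau>. lam' t * \<Delta> \<sigma> \<tau> * E t \<sigma> \<tau>) \<le> ?K" if "\<sigma> \<in> S" for \<sigma>
    using b that by (auto intro!: avg_ge avg_le S)
  have "- ?K \<le> F0 t x" "F0 t x \<le> ?K"
    unfolding F0_def by (rule avg_ge[OF S i(1)], assumption) (rule avg_le[OF S i(2)], assumption)
  then show ?thesis by linarith
qed

lemma F1_bound: "\<kappa> \<in> S \<Longrightarrow> \<bar>F1 t \<kappa> x\<bar> \<le> 2 * exp (s * D)"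
proof -
  assume \<kappa>: "\<kappa> \<in> S"
  have "\<bar>e t x \<kappa> - F t x\<bar> \<le> exp (s * D)"
    using e_bounds[OF \<kappa>, of t x] F_bounds[of t x] by linarith
  then have "\<bar>w x \<kappa>\<bar> * \<bar>e t x \<kappa> - F t x\<bar> \<le> 1 * exp (s * D)"
    using w_bounds \<kappa> by (intro mult_mono) auto
  then show ?thesis
    unfolding F1_def by (simp add: abs_mult)
qed

lemma F2_bound: "\<kappa> \<in> S \<Longrightarrow> \<rho> \<in> S \<Longrightarrow> \<bar>F2 t \<kappa> \<rho> x\<bar> \<le> 8 * exp (s * D)"
proof -
  assume \<kappa>: "\<kappa> \<in> S" "\<rho> \<in> S"
  have *: "\<bar>a * b\<bar> \<le> exp (s * D)" if "\<bar>a\<bar> \<le> 1" "\<bar>b\<bar> \<le> exp (s * D)" for a b :: real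
    using mult_mono[OF that] by (simp add: abs_mult)
  have "\<bar>((if \<rho> = \<kappa> then 1 else 0) - w x \<rho>) * (e t x \<kappa> - F t x)\<bar> \<le> exp (s * D)"
    using e_bounds[OF \<kappa>(1), of t x] F_bounds[of t x] w_bounds(1)[of x \<rho>] w_bounds(2)[OF \<kappa>(2), of x]
    by (intro *) auto
  moreover have "\<bar>w x \<rho> * (E t \<kappa> \<rho> - e t x \<kappa>)\<bar> \<le> exp (s * D)"
    using e_bounds[OF \<kappa>(1), of t x] E_bounds(1)[of t \<kappa> \<rho>] E_bounds(2)[OF \<kappa>, of t]
      w_bounds(1)[of x \<rho>] w_bounds(2)[OF \<kappa>(2), of x]
    by (intro *) auto
  moreover have "\<bar>w x \<rho> * (e t x \<rho> - F t x)\<bar> \<le> exp (s * D)"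
    using e_bounds[OF \<kappa>(2), of t x] F_bounds[of t x] w_bounds(1)[of x \<rho>] w_bounds(2)[OF \<kappa>(2), of x]
    by (intro *) auto
  ultimately have "\<bar>((if \<rho> = \<kappa> then 1 else 0) - w x \<rho>) * (e t x \<kappa> - F t x)
    + w x \<rho> * (E t \<kappa> \<rho> - e t x \<kappa>) - 2 * (w x \<rho> * (e t x \<rho> - F t x))\<bar> \<le> 4 * exp (s * D)"
    by linarith
  then have "\<bar>2 * w x \<kappa>\<bar> * \<bar>((if \<rho> = \<kappa> then 1 else 0) - w x \<rho>) * (e t x \<kappa> - F t x)
    + w x \<rho> * (E t \<kappa> \<rho> - e t x \<kappa>) - 2 * (w x \<rho> * (e t x \<rho> - F t x))\<bar> \<le> (2 * 1) * (4 * exp (s * D))"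
    using w_bounds(1)[of x \<kappa>] w_bounds(2)[OF \<kappa>(1), of x] by (intro mult_mono) auto
  then show ?thesis
    unfolding F2_def by (simp add: abs_mult [symmetric])
qed

lemma e_derivative:
  assumes "\<And>\<rho>. \<rho> \<in> S \<Longrightarrow> ((\<lambda>y. x y \<rho>) has_real_derivative x' \<rho>) (at t)" "\<sigma> \<in> S"
  shows "((\<lambda>y. e u (x y) \<sigma>) has_real_derivative
    (\<Sum>\<kappa>\<in>S. w (x t) \<kappa> * (E u \<sigma> \<kappa> - e u (x t) \<sigma>) * x' \<kappa>)) (at t)"
proof -
  have "av z (\<lambda>_. 0) = 0" for z by (simp add: avg_def)
  then show ?thesis
    using avg_has_derivative[OF S assms(1), where f = "\<lambda>_. E u \<sigma>" and f' = "\<lambda>_. 0" and m = m]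
    by (simp add: e_def)
qed

lemma av_sum: "av x (\<lambda>\<sigma>. \<Sum>\<kappa>\<in>A. f \<sigma> \<kappa>) = (\<Sum>\<kappa>\<in>A. av x (\<lambda>\<sigma>. f \<sigma> \<kappa>))"
  unfolding avg_def by (simp add: sum_distrib_left) (rule sum.swap)

lemma av_const: "av x (\<lambda>_. c) = c"
  unfolding avg_def using sum_weight[OF S, of m x] by (simp add: sum_distrib_right [symmetric])

lemma av_diff: "av x (\<lambda>\<sigma>. f \<sigma> - g \<sigma>) = av x f - av x g"
  unfolding avg_def by (simp add: right_diff_distrib sum_subtractf)

lemma av_add: "av x (\<lambda>\<sigma>. f \<sigma> + g \<sigma>) = av x f + av x g"
  unfolding avg_def by (simp add: distrib_left sum.distrib)

lemma av_cmult: "av x (\<lambda>\<sigma>. c * f \<sigma>) = c * av x f" "av x (\<lambda>\<sigma>. f \<sigma> * c) = av x f * c"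
  unfolding avg_def by (simp_all add: sum_distrib_left sum_distrib_right mult_ac)

lemma E_sym: "E t \<sigma> \<tau> = E t \<tau> \<sigma>"
  by (simp add: E_def sym)

lemma av_e: "av x (\<lambda>\<sigma>. E t \<sigma> \<kappa>) = e t x \<kappa>"
  unfolding e_def by (intro arg_cong[where f = "av x"] ext E_sym)

text \<open>By the symmetry of \<open>\<Delta>\<close> the two replicas contribute equally to the derivative in an energy; hence
  the factor 2 in \<open>F1\<close>.\<close>

lemma F_derivative:
  assumes x: "\<And>\<rho>. \<rho> \<in> S \<Longrightarrow> ((\<lambda>y. x y \<rho>) has_real_derivative x' \<rho>) (at t)"
  shows "((\<lambda>y. F y (x y)) has_real_derivative
    F0 t (x t) + (\<Sum>\<kappa>\<in>S. F1 t \<kappa> (x t) * x' \<kappa>)) (at t)"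
proof -
  define G where "G = (\<Sum>\<kappa>\<in>S. w (x t) \<kappa> * (e t (x t) \<kappa> - F t (x t)) * x' \<kappa>)"
  have dE: "((\<lambda>y. E y \<sigma> \<tau>) has_real_derivative lam' t * \<Delta> \<sigma> \<tau> * E t \<sigma> \<tau>) (at t)" for \<sigma> \<tau>
    unfolding E_def using dlam[of t] by (auto intro!: derivative_eq_intros simp: mult_ac)
  define e' where "e' \<sigma> = av (x t) (\<lambda>\<tau>. lam' t * \<Delta> \<sigma> \<tau> * E t \<sigma> \<tau>)
      + (\<Sum>\<kappa>\<in>S. w (x t) \<kappa> * (E t \<sigma> \<kappa> - e t (x t) \<sigma>) * x' \<kappa>)" for \<sigma>
  have de: "((\<lambda>y. e y (x y) \<sigma>) has_real_derivative e' \<sigma>) (at t)" if "\<sigma> \<in> S" for \<sigma>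
    unfolding e_def e'_def by (rule avg_has_derivative[OF S x dE])
  have "((\<lambda>y. F y (x y)) has_real_derivative av (x t) e' + G) (at t)"
    unfolding F_def G_def by (rule avg_has_derivative[OF S x de])
  moreover have "av (x t) e' = F0 t (x t) + G"
  proof -
    have "av (x t) e' = F0 t (x t) + av (x t) (\<lambda>\<sigma>. \<Sum>\<kappa>\<in>S. w (x t) \<kappa> * x' \<kappa> * (E t \<sigma> \<kappa> - e t (x t) \<sigma>))"
      unfolding e'_def av_add F0_def by (simp add: mult_ac)
    also have "\<dots> = F0 t (x t) + (\<Sum>\<kappa>\<in>S. w (x t) \<kappa> * x' \<kappa> * (e t (x t) \<kappa> - F t (x t)))"
      unfolding av_sum av_cmult av_diff av_e F_def by simp
    finally show ?thesis by (simp add: G_def mult_ac)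
  qed
  moreover have "F0 t (x t) + (\<Sum>\<kappa>\<in>S. F1 t \<kappa> (x t) * x' \<kappa>) = F0 t (x t) + G + G"
    unfolding F1_def G_def by (simp add: sum_distrib_left mult_ac flip: sum.distrib)
  ultimately show ?thesis by (simp add: add_ac)
qed

lemma F_derivative_fixed:
  assumes x: "\<And>\<rho>. \<rho> \<in> S \<Longrightarrow> ((\<lambda>y. x y \<rho>) has_real_derivative x' \<rho>) (at t)"
  shows "((\<lambda>y. F u (x y)) has_real_derivative (\<Sum>\<kappa>\<in>S. F1 u \<kappa> (x t) * x' \<kappa>)) (at t)"
proof -
  define G where "G = (\<Sum>\<kappa>\<in>S. w (x t) \<kappa> * (e u (x t) \<kappa> - F u (x t)) * x' \<kappa>)"
  define e' where "e' \<sigma> = (\<Sum>\<kappa>\<in>S. w (x t) \<kappa> * (E u \<sigma> \<kappa> - e u (x t) \<sigma>) * x' \<kappa>)" for \<sigma>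
  have "((\<lambda>y. F u (x y)) has_real_derivative av (x t) e' + G) (at t)"
    unfolding F_def G_def e'_def by (rule avg_has_derivative[OF S x e_derivative[OF x]])
  moreover have "av (x t) e' = G"
  proof -
    have "av (x t) e' = av (x t) (\<lambda>\<sigma>. \<Sum>\<kappa>\<in>S. w (x t) \<kappa> * x' \<kappa> * (E u \<sigma> \<kappa> - e u (x t) \<sigma>))"
      unfolding e'_def by (simp add: mult_ac)
    also have "\<dots> = (\<Sum>\<kappa>\<in>S. w (x t) \<kappa> * x' \<kappa> * (e u (x t) \<kappa> - F u (x t)))"
      unfolding av_sum av_cmult av_diff av_e F_def by simp
    finally show ?thesis by (simp add: G_def mult_ac)
  qed
  moreover have "(\<Sum>\<kappa>\<in>S. F1 u \<kappa> (x t) * x' \<kappa>) = G + G"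
    unfolding F1_def G_def by (simp add: sum_distrib_left mult_ac flip: sum.distrib)
  ultimately show ?thesis by (simp add: add_ac)
qed

lemma F1_derivative:
  assumes \<kappa>: "\<kappa> \<in> S" and x: "\<And>\<rho>. \<rho> \<in> S \<Longrightarrow> ((\<lambda>y. x y \<rho>) has_real_derivative x' \<rho>) (at t)"
  shows "((\<lambda>y. F1 u \<kappa> (x y)) has_real_derivative (\<Sum>\<rho>\<in>S. F2 u \<kappa> \<rho> (x t) * x' \<rho>)) (at t)"
proof -
  let ?w = "w (x t)" and ?e = "e u (x t)" and ?F = "F u (x t)"
  have "((\<lambda>y. F1 u \<kappa> (x y)) has_real_derivative
      2 * (?w \<kappa> * (x' \<kappa> - av (x t) x') * (?e \<kappa> - ?F)
        + ((\<Sum>\<rho>\<in>S. ?w \<rho> * (E u \<kappa> \<rho> - ?e \<kappa>) * x' \<rho>) - (\<Sum>\<rho>\<in>S. F1 u \<rho> (x t) * x' \<rho>)) * ?w \<kappa>)) (at t)"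
    unfolding F1_def[of u \<kappa>]
    by (intro DERIV_cmult DERIV_mult DERIV_diff weight_has_derivative[OF S \<kappa> x] e_derivative[OF x \<kappa>]
        F_derivative_fixed x)
  moreover have "x' \<kappa> - av (x t) x' = (\<Sum>\<rho>\<in>S. ((if \<rho> = \<kappa> then 1 else 0) - ?w \<rho>) * x' \<rho>)"
  proof -
    have "(\<Sum>\<rho>\<in>S. (if \<rho> = \<kappa> then 1 else 0) * x' \<rho>) = (\<Sum>\<rho>\<in>S. if \<rho> = \<kappa> then x' \<rho> else 0)"
      by (intro sum.cong) auto
    also have "\<dots> = x' \<kappa>"
      using S \<kappa> by (simp add: sum.delta')
    finally show ?thesis
      unfolding avg_def by (simp add: left_diff_distrib sum_subtractf)
  qed
  ultimately have "((\<lambda>y. F1 u \<kappa> (x y)) has_real_derivative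
      2 * (?w \<kappa> * (\<Sum>\<rho>\<in>S. ((if \<rho> = \<kappa> then 1 else 0) - ?w \<rho>) * x' \<rho>) * (?e \<kappa> - ?F)
        + ((\<Sum>\<rho>\<in>S. ?w \<rho> * (E u \<kappa> \<rho> - ?e \<kappa>) * x' \<rho>) - (\<Sum>\<rho>\<in>S. F1 u \<rho> (x t) * x' \<rho>)) * ?w \<kappa>)) (at t)"
    by simp
  moreover have "(\<Sum>\<rho>\<in>S. F2 u \<kappa> \<rho> (x t) * x' \<rho>) =
      2 * (?w \<kappa> * (\<Sum>\<rho>\<in>S. ((if \<rho> = \<kappa> then 1 else 0) - ?w \<rho>) * x' \<rho>) * (?e \<kappa> - ?F)
        + ((\<Sum>\<rho>\<in>S. ?w \<rho> * (E u \<kappa> \<rho> - ?e \<kappa>) * x' \<rho>) - (\<Sum>\<rho>\<in>S. F1 u \<rho> (x t) * x' \<rho>)) * ?w \<kappa>)"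
    unfolding F2_def F1_def sum_distrib_left sum_distrib_right sum_subtractf [symmetric] sum.distrib [symmetric]
    by (intro sum.cong refl) (simp add: algebra_simps)
  ultimately show ?thesis by simp
qed

text \<open>The sum is twice \<open>\<langle>A\<^sub>1\<^sub>2 E\<^sub>1\<^sub>2\<rangle> - 4 \<langle>A\<^sub>1\<^sub>3 E\<^sub>1\<^sub>2\<rangle> + 3 \<langle>A\<^sub>3\<^sub>4 E\<^sub>1\<^sub>2\<rangle>\<close> in terms of four replicas. The constant
  \<open>\<gamma>\<close> cancels, since a common random shift of all energies leaves the Gibbs measure unchanged. The
  middle term is dropped, and the last one is at most \<open>3 \<langle>\<Delta> E\<rangle>\<close> by Chebyshev's inequality because
  \<open>E\<close> is an increasing function of \<open>\<Delta>\<close>.\<close>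

lemma contraction:
  fixes A :: "'s \<Rightarrow> 's \<Rightarrow> real"
  assumes A: "\<And>\<sigma> \<tau>. \<sigma> \<in> S \<Longrightarrow> \<tau> \<in> S \<Longrightarrow> A \<sigma> \<tau> = \<alpha> * \<Delta> \<sigma> \<tau> + \<gamma>" and \<alpha>: "\<alpha> \<ge> 0"
    and diag: "\<And>\<sigma>. \<sigma> \<in> S \<Longrightarrow> \<Delta> \<sigma> \<sigma> = d"
  shows "(\<Sum>\<kappa>\<in>S. \<Sum>\<rho>\<in>S. A \<kappa> \<rho> * F2 t \<kappa> \<rho> x) \<le> 8 * \<alpha> * av x (\<lambda>\<sigma>. av x (\<lambda>\<tau>. \<Delta> \<sigma> \<tau> * E t \<sigma> \<tau>))"
proof -
  let ?w = "w x" and ?e = "e t x" and ?F = "F t x" and ?E = "E t"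
  have dg: "(\<Sum>\<rho>\<in>S. A \<kappa> \<rho> * (if \<rho> = \<kappa> then 1 else 0)) = \<alpha> * d + \<gamma>" if "\<kappa> \<in> S" for \<kappa>
  proof -
    have "(\<Sum>\<rho>\<in>S. A \<kappa> \<rho> * (if \<rho> = \<kappa> then 1 else 0)) = (\<Sum>\<rho>\<in>S. if \<rho> = \<kappa> then A \<kappa> \<rho> else 0)"
      by (intro sum.cong) auto
    also have "\<dots> = \<alpha> * d + \<gamma>"
      using S that A[OF that that] diag[OF that] by (simp add: sum.delta')
    finally show ?thesis .
  qed
  have 1: "(\<Sum>\<rho>\<in>S. A \<kappa> \<rho> * F2 t \<kappa> \<rho> x) = ?w \<kappa> * (2 * (\<alpha> * d + \<gamma>) * (?e \<kappa> - ?F)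
      + 2 * av x (\<lambda>\<rho>. A \<kappa> \<rho> * (?E \<kappa> \<rho> - 2 * ?e \<kappa> - 2 * ?e \<rho> + 3 * ?F)))" if "\<kappa> \<in> S" for \<kappa>
  proof -
    have "(\<Sum>\<rho>\<in>S. A \<kappa> \<rho> * F2 t \<kappa> \<rho> x) = (\<Sum>\<rho>\<in>S. ?w \<kappa> * (2 * (?e \<kappa> - ?F) * (A \<kappa> \<rho> * (if \<rho> = \<kappa> then 1 else 0))
        + 2 * (?w \<rho> * (A \<kappa> \<rho> * (?E \<kappa> \<rho> - 2 * ?e \<kappa> - 2 * ?e \<rho> + 3 * ?F)))))"
      unfolding F2_def by (intro sum.cong refl) (simp add: algebra_simps)
    also have "\<dots> = ?w \<kappa> * (2 * (?e \<kappa> - ?F) * (\<Sum>\<rho>\<in>S. A \<kappa> \<rho> * (if \<rho> = \<kappa> then 1 else 0))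
        + 2 * av x (\<lambda>\<rho>. A \<kappa> \<rho> * (?E \<kappa> \<rho> - 2 * ?e \<kappa> - 2 * ?e \<rho> + 3 * ?F)))"
      unfolding avg_def sum_distrib_left [symmetric] sum.distrib by (simp add: sum_distrib_left)
    finally show ?thesis
      unfolding dg[OF that] by (simp add: algebra_simps)
  qed
  have 2: "av x (\<lambda>\<rho>. A \<kappa> \<rho> * (?E \<kappa> \<rho> - 2 * ?e \<kappa> - 2 * ?e \<rho> + 3 * ?F))
      = \<alpha> * (av x (\<lambda>\<rho>. \<Delta> \<kappa> \<rho> * ?E \<kappa> \<rho>) - 2 * av x (\<lambda>\<rho>. \<Delta> \<kappa> \<rho> * ?e \<kappa>) - 2 * av x (\<lambda>\<rho>. \<Delta> \<kappa> \<rho> * ?e \<rho>)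
        + 3 * av x (\<lambda>\<rho>. \<Delta> \<kappa> \<rho> * ?F)) + \<gamma> * (?F - ?e \<kappa>)" if "\<kappa> \<in> S" for \<kappa>
  proof -
    have "av x (\<lambda>\<rho>. A \<kappa> \<rho> * (?E \<kappa> \<rho> - 2 * ?e \<kappa> - 2 * ?e \<rho> + 3 * ?F))
      = av x (\<lambda>\<rho>. \<alpha> * (\<Delta> \<kappa> \<rho> * ?E \<kappa> \<rho> - 2 * (\<Delta> \<kappa> \<rho> * ?e \<kappa>) - 2 * (\<Delta> \<kappa> \<rho> * ?e \<rho>) + 3 * (\<Delta> \<kappa> \<rho> * ?F))
        + \<gamma> * (?E \<kappa> \<rho> - 2 * ?e \<kappa> - 2 * ?e \<rho> + 3 * ?F))"
      unfolding avg_def using that by (intro sum.cong refl) (simp add: A algebra_simps)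
    also have "\<dots> = \<alpha> * (av x (\<lambda>\<rho>. \<Delta> \<kappa> \<rho> * ?E \<kappa> \<rho>) - 2 * av x (\<lambda>\<rho>. \<Delta> \<kappa> \<rho> * ?e \<kappa>) - 2 * av x (\<lambda>\<rho>. \<Delta> \<kappa> \<rho> * ?e \<rho>)
        + 3 * av x (\<lambda>\<rho>. \<Delta> \<kappa> \<rho> * ?F)) + \<gamma> * (av x (?E \<kappa>) - 2 * ?e \<kappa> - 2 * av x ?e + 3 * ?F)"
      by (simp only: av_add av_diff av_cmult av_const)
    also have "av x (?E \<kappa>) = ?e \<kappa>" by (simp add: e_def)
    also have "av x ?e = ?F" by (simp add: F_def)
    finally show ?thesis by (simp add: algebra_simps)
  qed
  define T1 where "T1 = av x (\<lambda>\<sigma>. av x (\<lambda>\<tau>. \<Delta> \<sigma> \<tau> * ?E \<sigma> \<tau>))"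
  define T2 where "T2 = av x (\<lambda>\<sigma>. av x (\<lambda>\<tau>. \<Delta> \<sigma> \<tau> * ?e \<sigma>))"
  define T3 where "T3 = av x (\<lambda>\<sigma>. av x (\<lambda>\<tau>. \<Delta> \<sigma> \<tau>))"
  have T2': "av x (\<lambda>\<sigma>. av x (\<lambda>\<tau>. \<Delta> \<sigma> \<tau> * ?e \<tau>)) = T2"
    unfolding T2_def by (rule av_swap) (simp add: sym)
  have T2: "T2 \<ge> 0"
    unfolding T2_def avg_def [of S m x] using \<Delta> e_bounds w_bounds
    by (intro sum_nonneg mult_nonneg_nonneg) auto
  have "(\<Sum>\<kappa>\<in>S. \<Sum>\<rho>\<in>S. A \<kappa> \<rho> * F2 t \<kappa> \<rho> x) = av x (\<lambda>\<kappa>. 2 * (\<alpha> * d + \<gamma>) * (?e \<kappa> - ?F)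
      + 2 * (\<alpha> * (av x (\<lambda>\<rho>. \<Delta> \<kappa> \<rho> * ?E \<kappa> \<rho>) - 2 * av x (\<lambda>\<rho>. \<Delta> \<kappa> \<rho> * ?e \<kappa>) - 2 * av x (\<lambda>\<rho>. \<Delta> \<kappa> \<rho> * ?e \<rho>)
        + 3 * (av x (\<lambda>\<rho>. \<Delta> \<kappa> \<rho>) * ?F)) + \<gamma> * (?F - ?e \<kappa>)))"
    unfolding avg_def [of S m x "\<lambda>\<kappa>. _ \<kappa> + _ \<kappa>"]
    by (intro sum.cong refl) (simp add: 1 2 av_cmult)
  also have "\<dots> = 2 * (\<alpha> * d + \<gamma>) * (av x ?e - ?F) + 2 * (\<alpha> * (T1 - 2 * T2 - 2 * T2 + 3 * (T3 * ?F)) + \<gamma> * (?F - av x ?e))"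
    by (simp only: av_add av_diff av_cmult(1) av_const T1_def T2_def[symmetric] T2' T3_def av_cmult(2)[of x _ ?F])
  also have "\<dots> = 2 * \<alpha> * (T1 - 4 * T2 + 3 * (T3 * ?F))"
    by (simp add: F_def algebra_simps)
  also have "\<dots> \<le> 2 * \<alpha> * (4 * T1)"
  proof (rule mult_left_mono)
    have pr: "av x (\<lambda>\<sigma>. av x (f \<sigma>)) = (\<Sum>p\<in>S\<times>S. (?w (fst p) * ?w (snd p)) * f (fst p) (snd p))" for f
      by (simp add: avg_def sum_distrib_left sum.cartesian_product split_def mult_ac)
    have "T3 * ?F \<le> T1"
    proof -
      have "?F = av x (\<lambda>\<sigma>. av x (?E \<sigma>))" by (simp add: F_def e_def [abs_def])
      moreover have "(\<Sum>p\<in>S\<times>S. ?w (fst p) * ?w (snd p)) = 1"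
        using pr[of "\<lambda>_ _. 1"] by (simp add: av_const)
      ultimately show ?thesis
        unfolding T3_def T1_def pr
        using chebyshev_correlation[of "S \<times> S" "\<lambda>p. ?w (fst p) * ?w (snd p)"
            "\<lambda>p. \<Delta> (fst p) (snd p)" "\<lambda>p. ?E (fst p) (snd p)"] w_bounds(1) lam(1)[of t]
        unfolding pr by (simp add: E_def mult_left_mono)
    qed
    then show "T1 - 4 * T2 + 3 * (T3 * ?F) \<le> 4 * T1" using T2 by linarith
  qed (use \<alpha> in simp)
  finally show ?thesis by (simp add: T1_def)
qed

end

section \<open>Concentration of the overlap\<close>

definition overlap :: "nat \<Rightarrow> (nat \<Rightarrow> real) \<Rightarrow> (nat \<Rightarrow> real) \<Rightarrow> real" where
  "overlap N \<sigma> \<tau> = (\<Sum>i\<in>{1..N}. \<sigma> i * \<tau> i) / real N"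

lemma finite_spins [simp]: "finite (spins N)"
  unfolding spins_def by (intro finite_PiE) auto

lemma spins_nonempty [simp]: "spins N \<noteq> {}"
  unfolding spins_def by (simp add: PiE_eq_empty_iff)

lemma spins_cases: "\<sigma> \<in> spins N \<Longrightarrow> i \<in> {1..N} \<Longrightarrow> \<sigma> i = -1 \<or> \<sigma> i = 1"
  unfolding spins_def by (drule (1) PiE_mem) auto

lemma spin_square: "\<sigma> \<in> spins N \<Longrightarrow> i \<in> {1..N} \<Longrightarrow> \<sigma> i * \<sigma> i = 1"
  using spins_cases[of \<sigma> N i] by auto

lemma abs_spin: "\<sigma> \<in> spins N \<Longrightarrow> i \<in> {1..N} \<Longrightarrow> \<bar>\<sigma> i\<bar> = 1"
  using spins_cases[of \<sigma> N i] by auto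

lemma finite_pairs [simp]: "finite (pairs N)"
proof -
  have "pairs N \<subseteq> {1..N} \<times> {1..N}" by (auto simp: pairs_def)
  then show ?thesis by (rule finite_subset) simp
qed

lemma pairs_Suc: "pairs (Suc N) = pairs N \<union> (\<lambda>i. (i, Suc N)) ` {1..N}"
  by (auto simp: pairs_def le_Suc_eq)

lemma sum_pairs:
  fixes a :: "nat \<Rightarrow> real"
  shows "(\<Sum>(i, j)\<in>pairs N. a i * a j) = ((\<Sum>i\<in>{1..N}. a i)\<^sup>2 - (\<Sum>i\<in>{1..N}. (a i)\<^sup>2)) / 2"
proof (induction N)
  case 0
  have "pairs 0 = {}" by (auto simp: pairs_def)
  then show ?case by simp
next
  case (Suc N)
  have inj: "inj_on (\<lambda>i. (i, Suc N)) {1..N}" by (auto simp: inj_on_def)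
  have "(\<Sum>(i, j)\<in>pairs (Suc N). a i * a j) =
      (\<Sum>(i, j)\<in>pairs N. a i * a j) + (\<Sum>(i, j)\<in>(\<lambda>i. (i, Suc N)) ` {1..N}. a i * a j)"
    unfolding pairs_Suc by (rule sum.union_disjoint) (simp, simp, auto simp: pairs_def)
  also have "(\<Sum>(i, j)\<in>(\<lambda>i. (i, Suc N)) ` {1..N}. a i * a j) = (\<Sum>i\<in>{1..N}. a i) * a (Suc N)"
    by (subst sum.reindex[OF inj]) (simp add: sum_distrib_right)
  finally show ?case
    by (simp add: Suc.IH power2_eq_square algebra_simps diff_divide_distrib add_divide_distrib)
qed

text \<open>Hoeffding's lemma for a variable with values in \<open>{-1, 1}\<close> and mean \<open>q\<close>.\<close>

lemma cosh_plus_mean_sinh_le: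
  fixes q l :: real
  assumes "0 \<le> q" "q \<le> 1"
  shows "(cosh l + q * sinh l) * exp (- (l * q)) \<le> exp (l\<^sup>2 / 2)"
proof -
  have main: "(cosh l + q * sinh l) * exp (- (l * q)) \<le> exp (l\<^sup>2 / 2)"
    if "l \<ge> 0" "-1 \<le> q" "q \<le> 1" for l q :: real
  proof -
    define p where "p = (1 + q) / 2"
    have p: "p \<ge> 0" "p \<le> 1" using that by (auto simp: p_def)
    have e: "exp (2 * l) = exp l * exp l"
      by (simp add: exp_add [symmetric])
    have pos: "1 + p * (exp (2 * l) - 1) > 0"
      using p that by (intro add_pos_nonneg) auto
    have eq: "exp (- l) * (1 + p * (exp (2 * l) - 1)) = cosh l + q * sinh l"
      unfolding e p_def by (simp add: cosh_def sinh_def exp_minus field_simps)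
    have "- (2 * l) * p + ln (1 + p * (exp (2 * l) - 1)) \<le> (2 * l)\<^sup>2 / 8"
      using Hoeffdings_lemma_aux[of "2 * l" p] that p by simp
    moreover have "- (2 * l) * p = - (l * q + l)" "(2 * l)\<^sup>2 / 8 = l\<^sup>2 / 2"
      by (simp_all add: p_def power_mult_distrib algebra_simps add_divide_distrib)
    ultimately have "ln (1 + p * (exp (2 * l) - 1)) \<le> l\<^sup>2 / 2 + (l * q + l)"
      by linarith
    then have "1 + p * (exp (2 * l) - 1) \<le> exp (l\<^sup>2 / 2 + (l * q + l))"
      using pos by (metis exp_le_cancel_iff exp_ln)
    then have "(exp (- l) * (1 + p * (exp (2 * l) - 1))) * exp (- (l * q))
        \<le> (exp (- l) * exp (l\<^sup>2 / 2 + (l * q + l))) * exp (- (l * q))"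
      by (intro mult_right_mono mult_left_mono) auto
    also have "\<dots> = exp (l\<^sup>2 / 2)"
      unfolding exp_add [symmetric] by simp
    finally show ?thesis unfolding eq .
  qed
  show ?thesis
  proof (cases "l \<ge> 0")
    case True
    then show ?thesis using main assms by simp
  next
    case False
    then show ?thesis using main[of "- l" "- q"] assms by simp
  qed
qed

text \<open>In a field \<open>y\<close>, the product of two independent spins at one site is \<open>\<plusminus>1\<close> with mean \<open>tanh\<^sup>2 y\<close>.\<close>

lemma spin_pair_sum:
  fixes y l q :: real
  shows "(\<Sum>a\<in>{-1, 1}. \<Sum>b\<in>{-1, 1}. exp (y * a) * exp (y * b) * exp (l * (a * b - q)))
    = (\<Sum>a\<in>{-1, 1}. exp (y * a))\<^sup>2 * ((cosh l + (tanh y)\<^sup>2 * sinh l) * exp (- (l * q)))"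
proof -
  have z: "(\<Sum>a\<in>{-1, 1}. exp (y * a)) = 2 * cosh y"
    by (simp add: cosh_def)
  have t: "(2 * cosh y)\<^sup>2 * (tanh y)\<^sup>2 = (2 * sinh y)\<^sup>2"
    by (simp add: tanh_def power_divide power_mult_distrib)
  have "(2 * cosh y)\<^sup>2 * ((cosh l + (tanh y)\<^sup>2 * sinh l) * exp (- (l * q)))
      = ((2 * cosh y)\<^sup>2 * cosh l + ((2 * cosh y)\<^sup>2 * (tanh y)\<^sup>2) * sinh l) * exp (- (l * q))"
    by (simp add: algebra_simps)
  also have "\<dots> = ((2 * cosh y)\<^sup>2 * cosh l + (2 * sinh y)\<^sup>2 * sinh l) * exp (- (l * q))"
    unfolding t ..
  also have "\<dots> = (\<Sum>a\<in>{-1, 1}. \<Sum>b\<in>{-1, 1}. exp (y * a) * exp (y * b) * exp (l * (a * b - q)))"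
  proof -
    have e: "exp (l * (1 - q)) = exp l * exp (- (l * q))" "exp (l * (- 1 - q)) = exp (- l) * exp (- (l * q))"
      by (simp_all add: exp_add [symmetric] algebra_simps)
    have 1: "exp y * exp (- y) = 1" by (simp add: exp_add [symmetric])
    have alg: "((2 * ((u + v) / 2))\<^sup>2 * ((a + b) / 2) + (2 * ((u - v) / 2))\<^sup>2 * ((a - b) / 2)) * k
        = v * v * (a * k) + v * u * (b * k) + (u * v * (b * k) + u * u * (a * k))"
      if "u * v = 1" for u v a b k :: real
    proof -
      have "((2 * ((u + v) / 2))\<^sup>2 * ((a + b) / 2) + (2 * ((u - v) / 2))\<^sup>2 * ((a - b) / 2)) * k
        = (u * u + v * v) * a * k + 2 * (u * v) * b * k"
        by (simp add: power2_eq_square field_simps)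
      then show ?thesis by (simp add: algebra_simps)
    qed
    have "exp (y * - 1) * exp (y * - 1) * exp (l * (- 1 * - 1 - q)) = exp (- y) * exp (- y) * (exp l * exp (- (l * q)))"
      "exp (y * - 1) * exp (y * 1) * exp (l * (- 1 * 1 - q)) = exp (- y) * exp y * (exp (- l) * exp (- (l * q)))"
      "exp (y * 1) * exp (y * - 1) * exp (l * (1 * - 1 - q)) = exp y * exp (- y) * (exp (- l) * exp (- (l * q)))"
      "exp (y * 1) * exp (y * 1) * exp (l * (1 * 1 - q)) = exp y * exp y * (exp l * exp (- (l * q)))"
      using e by simp_all
    then have "(\<Sum>a\<in>{-1, 1}. \<Sum>b\<in>{-1, 1}. exp (y * a) * exp (y * b) * exp (l * (a * b - q)))
      = exp (- y) * exp (- y) * (exp l * exp (- (l * q))) + exp (- y) * exp y * (exp (- l) * exp (- (l * q)))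
        + (exp y * exp (- y) * (exp (- l) * exp (- (l * q))) + exp y * exp y * (exp l * exp (- (l * q))))"
      by (simp del: mult_minus_right mult_1_right)
    then show ?thesis
      unfolding cosh_def sinh_def using alg[OF 1, of "exp l" "exp (- l)" "exp (- (l * q))"]
      by (simp add: scaleR_conv_of_real)
  qed
  finally show ?thesis unfolding z ..
qed

lemma sum_spins_prod:
  "(\<Sum>\<sigma>\<in>spins N. \<Prod>i\<in>{1..N}. f i (\<sigma> i)) = (\<Prod>i\<in>{1..N}. \<Sum>a\<in>{-1, 1}. f i a :: real)"
  unfolding spins_def by (subst prod_sum_PiE) auto

text \<open>The interpolation runs from independent spins in the fields \<open>\<beta> \<surd>q z\<^sub>j + h\<close> at \<open>t = 0\<close> to the
  Sherrington--Kirkpatrick model at \<open>t = \<pi>/2\<close>. The Gaussian \<open>z\<^sub>j\<close> is stored at the index \<open>(0, j)\<close>,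
  which is not a coupling. The exponent \<open>lam\<close> decreases from \<open>s\<close> to \<open>s - 2 \<beta>\<^sup>2\<close>, exactly as
  fast as needed to absorb the derivative of the covariance.\<close>

locale sk_model =
  fixes N :: nat and \<beta> h s :: real
  assumes N: "1 \<le> N" and \<beta>: "0 < \<beta>" "\<beta> < 1 / 2" and s: "2 * \<beta>\<^sup>2 \<le> s" "2 * s < 1"
begin

definition q where "q = sk_q \<beta> h"
definition m where "m \<sigma> = h * (\<Sum>i\<in>{1..N}. \<sigma> i)" for \<sigma> :: "nat \<Rightarrow> real"
definition \<Delta> where "\<Delta> \<sigma> \<tau> = real N * (overlap N \<sigma> \<tau> - q)\<^sup>2"
definition lam where "lam t = s - 2 * \<beta>\<^sup>2 * (sin t)\<^sup>2" for t :: real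
definition lam' where "lam' t = - (4 * \<beta>\<^sup>2 * (sin t * cos t))" for t :: real

lemma q: "0 \<le> q" "q < 1" "q = overlap_map \<beta> h q"
  using sk_q_fixed_point[OF \<beta>, of h] by (auto simp: q_def)

lemma abs_sin_cos_le: "\<bar>sin t * cos t\<bar> \<le> 1 / (2::real)"
proof -
  have "\<bar>sin (2 * t)\<bar> \<le> 1" by simp
  then show ?thesis unfolding sin_double by (simp add: abs_mult)
qed

sublocale replica_pair "spins N" m \<Delta> lam lam' s
proof
  show "(lam has_real_derivative lam' t) (at t)" for t
    unfolding lam_def lam'_def by (auto intro!: derivative_eq_intros)
  have "2 * \<beta>\<^sup>2 * (sin t)\<^sup>2 \<le> 2 * \<beta>\<^sup>2 * 1" for t :: real
    by (intro mult_left_mono) (auto simp: abs_square_le_1)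
  from order_trans[OF this, of s] show "0 \<le> lam t" "lam t \<le> s" for t
    unfolding lam_def using s(1) by auto
  show "\<bar>lam' t\<bar> \<le> s" for t
  proof -
    have "\<bar>lam' t\<bar> = 4 * \<beta>\<^sup>2 * \<bar>sin t * cos t\<bar>"
      by (simp add: lam'_def abs_mult)
    also have "\<dots> \<le> 4 * \<beta>\<^sup>2 * (1 / 2)"
      by (intro mult_left_mono abs_sin_cos_le) auto
    finally show ?thesis using s(1) by simp
  qed
qed (auto simp: \<Delta>_def overlap_def mult.commute)

definition I where "I = pairs N \<union> Pair 0 ` {1..N}"

definition c where "c \<sigma> p t = (case p of (i, j) \<Rightarrow>
    if i = 0 then cos t * (\<beta> * sqrt q * \<sigma> j) else sin t * (\<beta> / sqrt (real N) * (\<sigma> i * \<sigma> j)))"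
  for \<sigma> :: "nat \<Rightarrow> real" and p :: "nat \<times> nat" and t :: real

definition c' where "c' \<sigma> p t = (case p of (i, j) \<Rightarrow>
    if i = 0 then - sin t * (\<beta> * sqrt q * \<sigma> j) else cos t * (\<beta> / sqrt (real N) * (\<sigma> i * \<sigma> j)))"
  for \<sigma> :: "nat \<Rightarrow> real" and p :: "nat \<times> nat" and t :: real

definition X where "X t g = (\<lambda>\<sigma>. \<Sum>p\<in>I. c \<sigma> p t * g p)" for t :: real and g :: "nat \<times> nat \<Rightarrow> real"

lemma finite_I: "finite I"
  by (simp add: I_def)

lemma sum_I: "(\<Sum>p\<in>I. f p) = (\<Sum>p\<in>pairs N. f p) + (\<Sum>j\<in>{1..N}. f (0, j) :: real)"
proof -
  have "(\<Sum>p\<in>I. f p) = (\<Sum>p\<in>pairs N. f p) + (\<Sum>p\<in>Pair 0 ` {1..N}. f p)"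
    unfolding I_def by (rule sum.union_disjoint) (simp, simp, auto simp: pairs_def)
  then show ?thesis by (simp add: sum.reindex inj_on_def)
qed

lemma prod_I: "(\<Prod>p\<in>I. f p) = (\<Prod>p\<in>pairs N. f p) * (\<Prod>j\<in>{1..N}. f (0, j) :: real)"
proof -
  have "(\<Prod>p\<in>I. f p) = (\<Prod>p\<in>pairs N. f p) * (\<Prod>p\<in>Pair 0 ` {1..N}. f p)"
    unfolding I_def by (rule prod.union_disjoint) (simp, simp, auto simp: pairs_def)
  then show ?thesis by (simp add: prod.reindex inj_on_def)
qed

lemma pairs_nonzero: "(i, j) \<in> pairs N \<Longrightarrow> i \<noteq> 0 \<and> i \<in> {1..N} \<and> j \<in> {1..N}"
  by (auto simp: pairs_def)

lemma coefficient_bounds: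
  assumes "\<sigma> \<in> spins N" "p \<in> I"
  shows "\<bar>c \<sigma> p t\<bar> \<le> \<beta>" "\<bar>c' \<sigma> p t\<bar> \<le> \<beta>"
proof -
  obtain i j where p: "p = (i, j)" by fastforce
  have j: "j \<in> {1..N}" and i: "i = 0 \<or> i \<in> {1..N}"
    using assms(2) pairs_nonzero by (auto simp: p I_def)
  have sq: "0 \<le> sqrt q" "sqrt q \<le> 1" "0 \<le> 1 / sqrt (real N)" "1 / sqrt (real N) \<le> 1"
    using q N by auto
  have b: "\<bar>u\<bar> * (\<bar>\<beta>\<bar> * \<bar>v\<bar> * \<bar>z\<bar>) \<le> \<beta>" if "\<bar>u\<bar> \<le> 1" "\<bar>v\<bar> \<le> 1" "\<bar>z\<bar> = 1" for u v z :: real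
  proof -
    have "\<bar>u\<bar> * (\<bar>\<beta>\<bar> * \<bar>v\<bar> * \<bar>z\<bar>) \<le> 1 * (\<bar>\<beta>\<bar> * 1 * 1)"
      using that by (intro mult_mono) auto
    then show ?thesis using \<beta> by simp
  qed
  have zj: "\<bar>\<sigma> j\<bar> = 1" using abs_spin[OF assms(1) j] .
  show "\<bar>c \<sigma> p t\<bar> \<le> \<beta>"
    using b[of "cos t" "sqrt q" "\<sigma> j"] b[of "sin t" "1 / sqrt (real N)" "\<sigma> i * \<sigma> j"]
      sq zj abs_spin[OF assms(1), of i] i
    by (auto simp: c_def p abs_mult)
  show "\<bar>c' \<sigma> p t\<bar> \<le> \<beta>"
    using b[of "sin t" "sqrt q" "\<sigma> j"] b[of "cos t" "1 / sqrt (real N)" "\<sigma> i * \<sigma> j"]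
      sq zj abs_spin[OF assms(1), of i] i
    by (auto simp: c'_def p abs_mult)
qed

text \<open>The couplings contribute \<open>(\<beta>\<^sup>2/2) (N R\<^sup>2 - 1)\<close> and the site fields \<open>- \<beta>\<^sup>2 q N R\<close>. The variance of the
  site fields is chosen to complete the square \<open>(\<beta>\<^sup>2/2) N (R - q)\<^sup>2\<close>.\<close>

lemma covariance_derivative:
  assumes "\<sigma> \<in> spins N" "\<tau> \<in> spins N"
  shows "(\<Sum>p\<in>I. c' \<sigma> p t * c \<tau> p t) = (sin t * cos t * (\<beta>\<^sup>2 / 2)) * \<Delta> \<sigma> \<tau>
    + sin t * cos t * (- (\<beta>\<^sup>2 / 2) - \<beta>\<^sup>2 * real N * q\<^sup>2 / 2)"
proof -
  define Y where "Y = (\<Sum>i\<in>{1..N}. \<sigma> i * \<tau> i)"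
  have N0: "real N > 0" using N by simp
  have sq2: "(\<Sum>i\<in>{1..N}. (\<sigma> i * \<tau> i)\<^sup>2) = real N"
  proof -
    have "(\<sigma> i * \<tau> i)\<^sup>2 = 1" if "i \<in> {1..N}" for i
      using spins_cases[OF assms(1) that] spins_cases[OF assms(2) that] by auto
    then show ?thesis by simp
  qed
  have "(\<Sum>p\<in>pairs N. c' \<sigma> p t * c \<tau> p t)
      = (\<Sum>(i, j)\<in>pairs N. (sin t * cos t * (\<beta>\<^sup>2 / real N)) * ((\<sigma> i * \<tau> i) * (\<sigma> j * \<tau> j)))"
  proof (intro sum.cong refl)
    fix p assume p: "p \<in> pairs N"
    obtain i j where ij: "p = (i, j)" by fastforce
    have "i \<noteq> 0" using p pairs_nonzero ij by auto
    then have "c' \<sigma> p t * c \<tau> p t = sin t * cos t * ((\<beta> / sqrt (real N)) * (\<beta> / sqrt (real N))) * ((\<sigma> i * \<tau> i) * (\<sigma> j * \<tau> j))"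
      by (simp add: c_def c'_def ij mult_ac)
    also have "(\<beta> / sqrt (real N)) * (\<beta> / sqrt (real N)) = \<beta>\<^sup>2 / real N"
      using N0 by (simp add: power2_eq_square)
    finally show "c' \<sigma> p t * c \<tau> p t = (case p of (i, j) \<Rightarrow> (sin t * cos t * (\<beta>\<^sup>2 / real N)) * ((\<sigma> i * \<tau> i) * (\<sigma> j * \<tau> j)))"
      by (simp add: ij)
  qed
  also have "\<dots> = (sin t * cos t * (\<beta>\<^sup>2 / real N)) * (\<Sum>(i, j)\<in>pairs N. (\<sigma> i * \<tau> i) * (\<sigma> j * \<tau> j))"
    by (simp add: sum_distrib_left split_def)
  also have "\<dots> = (sin t * cos t * (\<beta>\<^sup>2 / real N)) * ((Y\<^sup>2 - real N) / 2)"
    unfolding sum_pairs[of "\<lambda>i. \<sigma> i * \<tau> i"] sq2 Y_def ..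
  finally have 1: "(\<Sum>p\<in>pairs N. c' \<sigma> p t * c \<tau> p t) = \<dots>" .
  have 2: "(\<Sum>j\<in>{1..N}. c' \<sigma> (0, j) t * c \<tau> (0, j) t) = - (sin t * cos t * (\<beta>\<^sup>2 * q) * Y)"
  proof -
    have "c' \<sigma> (0, j) t * c \<tau> (0, j) t = - (sin t * cos t * (\<beta>\<^sup>2 * q)) * (\<sigma> j * \<tau> j)" for j
    proof -
      have "c' \<sigma> (0, j) t * c \<tau> (0, j) t = - (sin t * cos t * (\<beta>\<^sup>2 * (sqrt q * sqrt q))) * (\<sigma> j * \<tau> j)"
        by (simp add: c_def c'_def power2_eq_square mult_ac del: real_sqrt_mult_self)
      then show ?thesis using q(1) by simp
    qed
    then show ?thesis by (simp add: Y_def sum_distrib_left sum_negf)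
  qed
  have ov: "overlap N \<sigma> \<tau> = Y / real N" by (simp add: overlap_def Y_def)
  show ?thesis
    unfolding sum_I 1 2 \<Delta>_def ov using N0
    by (simp add: field_simps power2_eq_square)
qed

lemma X_measurable: "(\<lambda>g. X t g \<sigma>) \<in> borel_measurable (gaussian_coords I)"
  unfolding X_def
  by (intro borel_measurable_sum borel_measurable_times borel_measurable_const measurable_gaussian_coord)

lemma av_measurable:
  assumes "\<And>\<rho>. \<rho> \<in> spins N \<Longrightarrow> Z \<rho> \<in> borel_measurable M" "\<And>\<sigma>. \<sigma> \<in> spins N \<Longrightarrow> f \<sigma> \<in> borel_measurable M"
  shows "(\<lambda>g. av (\<lambda>\<rho>. Z \<rho> g) (\<lambda>\<sigma>. f \<sigma> g)) \<in> borel_measurable M"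
  unfolding avg_def using assms by (intro borel_measurable_sum borel_measurable_times weight_measurable) auto

definition \<phi> where "\<phi> t = (LINT g|gaussian_coords I. F t (X t g))"

text \<open>By \<open>contraction\<close>, the Gaussian part of the derivative is at most
  \<open>4 \<beta>\<^sup>2 sin t cos t \<langle>\<Delta> E\<rangle>\<close>, which the decrease of \<open>lam\<close> compensates pointwise.\<close>

lemma coupled_average_decreasing: "\<phi> (pi / 2) \<le> \<phi> 0"
  and integrable_coupled_average: "integrable (gaussian_coords I) (\<lambda>g. F t (X t g))"
proof -
  have b: "\<exists>C. \<forall>t x. \<bar>f t x\<bar> \<le> C * exp (a * (\<Sum>v\<in>V. (x v)\<^sup>2))"
    if "\<And>t x. \<bar>f t x\<bar> \<le> K" "a > 0" for a K V and f :: "real \<Rightarrow> ((nat \<Rightarrow> real) \<Rightarrow> real) \<Rightarrow> real"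
  proof (intro exI[of _ K] allI)
    fix t :: real and x :: "(nat \<Rightarrow> real) \<Rightarrow> real"
    have "K \<ge> 0" using that(1)[of t x] by simp
    then have "K * 1 \<le> K * exp (a * (\<Sum>v\<in>V. (x v)\<^sup>2))"
      using that(2) by (intro mult_left_mono) (auto simp: sum_nonneg)
    then show "\<bar>f t x\<bar> \<le> K * exp (a * (\<Sum>v\<in>V. (x v)\<^sup>2))"
      using that(1)[of t x] by linarith
  qed
  have dc: "(c \<sigma> p has_real_derivative c' \<sigma> p t) (at t)" for \<sigma> p t
  proof -
    obtain i j where p: "p = (i, j)" by fastforce
    have d: "((\<lambda>t. cos t * u) has_real_derivative - sin t * u) (at t)"
      "((\<lambda>t. sin t * u) has_real_derivative cos t * u) (at t)" for u :: real
      by (auto intro!: derivative_eq_intros)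
    show ?thesis
    proof (cases "i = 0")
      case True
      then have "c \<sigma> p = (\<lambda>t. cos t * (\<beta> * sqrt q * \<sigma> j))"
        "c' \<sigma> p t = - sin t * (\<beta> * sqrt q * \<sigma> j)"
        by (simp_all add: c_def c'_def p fun_eq_iff)
      then show ?thesis using d(1) by metis
    next
      case False
      then have "c \<sigma> p = (\<lambda>t. sin t * (\<beta> / sqrt (real N) * (\<sigma> i * \<sigma> j)))"
        "c' \<sigma> p t = cos t * (\<beta> / sqrt (real N) * (\<sigma> i * \<sigma> j))"
        by (simp_all add: c_def c'_def p fun_eq_iff)
      then show ?thesis using d(2) by metis
    qed
  qed
  have bF: "\<exists>C. \<forall>t x. \<bar>F t x\<bar> \<le> C * exp (a * (\<Sum>v\<in>spins N. (x v)\<^sup>2))" if "a > 0" for a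
    using F_bounds that by (intro b[of _ "exp (s * D)"]) (auto simp: abs_le_iff intro: order_trans[of _ 0])
  have bF0: "\<exists>C. \<forall>t x. \<bar>F0 t x\<bar> \<le> C * exp (a * (\<Sum>v\<in>spins N. (x v)\<^sup>2))" if "a > 0" for a
    by (rule b[OF F0_bound that])
  have bF1: "\<exists>C. \<forall>t x. \<bar>F1 t v x\<bar> \<le> C * exp (a * (\<Sum>v\<in>spins N. (x v)\<^sup>2))" if "a > 0" "v \<in> spins N" for a v
    by (rule b[OF F1_bound[OF that(2)] that(1)])
  have bF2: "\<exists>C. \<forall>x. \<bar>F2 t v u x\<bar> \<le> C * exp (a * (\<Sum>v\<in>spins N. (x v)\<^sup>2))"
    if "a > 0" "v \<in> spins N" "u \<in> spins N" for a t v u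
    using b[OF F2_bound[OF that(2,3)] that(1)] by fast
  have wm: "(\<lambda>g. w (\<lambda>v. Z v g) \<sigma>) \<in> borel_measurable M"
    if "\<And>v. v \<in> spins N \<Longrightarrow> Z v \<in> borel_measurable M" "\<sigma> \<in> spins N" for Z \<sigma> and M :: "(nat \<times> nat \<Rightarrow> real) measure"
    using that by (intro weight_measurable) auto
  have em: "(\<lambda>g. e t (\<lambda>v. Z v g) \<sigma>) \<in> borel_measurable M"
    if "\<And>v. v \<in> spins N \<Longrightarrow> Z v \<in> borel_measurable M" for Z t \<sigma> and M :: "(nat \<times> nat \<Rightarrow> real) measure"
    unfolding e_def using that by (intro av_measurable) auto
  have Fm: "(\<lambda>g. F t (\<lambda>v. Z v g)) \<in> borel_measurable M"
    if "\<And>v. v \<in> spins N \<Longrightarrow> Z v \<in> borel_measurable M" for Z t and M :: "(nat \<times> nat \<Rightarrow> real) measure"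
    unfolding F_def using that by (intro av_measurable em) auto
  have F0m: "(\<lambda>g. F0 t (\<lambda>v. Z v g)) \<in> borel_measurable M"
    if "\<And>v. v \<in> spins N \<Longrightarrow> Z v \<in> borel_measurable M" for Z t and M :: "(nat \<times> nat \<Rightarrow> real) measure"
    unfolding F0_def using that by (intro av_measurable) auto
  have F1m: "(\<lambda>g. F1 t \<kappa> (\<lambda>v. Z v g)) \<in> borel_measurable M"
    if "\<kappa> \<in> spins N" "\<And>v. v \<in> spins N \<Longrightarrow> Z v \<in> borel_measurable M" for Z t \<kappa> and M :: "(nat \<times> nat \<Rightarrow> real) measure"
    unfolding F1_def
    by (intro borel_measurable_times borel_measurable_diff borel_measurable_const wm[OF that(2,1)]
        em[OF that(2)] Fm[OF that(2)])
  have F2m: "(\<lambda>g. F2 t \<kappa> \<rho> (\<lambda>v. Z v g)) \<in> borel_measurable M"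
    if "\<kappa> \<in> spins N" "\<rho> \<in> spins N" "\<And>v. v \<in> spins N \<Longrightarrow> Z v \<in> borel_measurable M"
    for Z t \<kappa> \<rho> and M :: "(nat \<times> nat \<Rightarrow> real) measure"
    unfolding F2_def
    by (intro borel_measurable_times borel_measurable_diff borel_measurable_add borel_measurable_const
        wm[OF that(3,1)] wm[OF that(3,2)] em[OF that(3)] Fm[OF that(3)])
  have F2c: "continuous_on UNIV (\<lambda>y. F2 t \<kappa> \<rho> (x y))"
    if "\<kappa> \<in> spins N" "\<rho> \<in> spins N" "\<And>v. v \<in> spins N \<Longrightarrow> continuous_on UNIV (\<lambda>y::real. x y v)" for t \<kappa> \<rho> x
  proof -
    have wc: "continuous_on UNIV (\<lambda>y. w (x y) \<sigma>)" if "\<sigma> \<in> spins N" for \<sigma>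
      using that \<open>\<And>v. v \<in> spins N \<Longrightarrow> continuous_on UNIV (\<lambda>y. x y v)\<close> by (intro weight_continuous) auto
    have ec: "continuous_on UNIV (\<lambda>y. e t (x y) \<sigma>)" for \<sigma>
      unfolding e_def avg_def by (intro continuous_intros wc)
    have Fc: "continuous_on UNIV (\<lambda>y. F t (x y))"
      unfolding F_def avg_def by (intro continuous_intros wc ec)
    show ?thesis
      unfolding F2_def by (intro continuous_intros wc ec Fc that)
  qed
  note gi = gaussian_interpolation[of I "spins N" c c' \<beta> F F0 F1 F2, OF finite_I finite_spins dc
      coefficient_bounds(1) coefficient_bounds(2) F_derivative F1_derivative F2c bF bF0 bF1 bF2 Fm F0m F1m F2m]
  have Xe: "X t g = (\<lambda>v. \<Sum>i\<in>I. c v i t * g i)" for t g by (simp add: X_def)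
  note gi' = gi[folded Xe]
  show "integrable (gaussian_coords I) (\<lambda>g. F t (X t g))"
    by (rule gi'(2); assumption)
  have int0: "integrable (gaussian_coords I) (\<lambda>g. F0 t (X t g))" for t
    by (rule gi'(3); assumption)
  have int2: "integrable (gaussian_coords I) (\<lambda>g. F2 t v u (X t g))" if "v \<in> spins N" "u \<in> spins N" for t v u
    by (rule gi'(4); (assumption | rule that))
  have der: "(\<phi> has_real_derivative (LINT g|gaussian_coords I. F0 t (X t g)) +
      (\<Sum>v\<in>spins N. \<Sum>u\<in>spins N. (\<Sum>i\<in>I. c' v i t * c u i t) * (LINT g|gaussian_coords I. F2 t v u (X t g)))) (at t)" for t
    unfolding \<phi>_def [abs_def] by (rule gi'(1); assumption)
  show "\<phi> (pi / 2) \<le> \<phi> 0"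
  proof (rule DERIV_nonpos_imp_nonincreasing[where f = \<phi>])
    fix t :: real assume t: "0 \<le> t" "t \<le> pi / 2"
    define C where "C v u = (\<Sum>i\<in>I. c' v i t * c u i t)" for v u
    have sc: "sin t * cos t \<ge> 0"
      using t by (intro mult_nonneg_nonneg sin_ge_zero cos_ge_zero) auto
    have pw: "F0 t x + (\<Sum>v\<in>spins N. \<Sum>u\<in>spins N. C v u * F2 t v u x) \<le> 0" for x
    proof -
      have "(\<Sum>v\<in>spins N. \<Sum>u\<in>spins N. C v u * F2 t v u x)
          \<le> 8 * (sin t * cos t * (\<beta>\<^sup>2 / 2)) * av x (\<lambda>\<sigma>. av x (\<lambda>\<tau>. \<Delta> \<sigma> \<tau> * E t \<sigma> \<tau>))"
      proof (rule contraction)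
        show "\<Delta> \<sigma> \<sigma> = real N * (1 - q)\<^sup>2" if "\<sigma> \<in> spins N" for \<sigma>
          using spin_square[OF that] N by (simp add: \<Delta>_def overlap_def)
      qed (use covariance_derivative sc in \<open>auto simp: C_def\<close>)
      moreover have "F0 t x = lam' t * av x (\<lambda>\<sigma>. av x (\<lambda>\<tau>. \<Delta> \<sigma> \<tau> * E t \<sigma> \<tau>))"
        unfolding F0_def by (simp add: av_cmult mult.assoc)
      ultimately show ?thesis
        by (simp add: lam'_def mult_ac)
    qed
    have "(LINT g|gaussian_coords I. F0 t (X t g)) +
      (\<Sum>v\<in>spins N. \<Sum>u\<in>spins N. C v u * (LINT g|gaussian_coords I. F2 t v u (X t g)))
      = (LINT g|gaussian_coords I. F0 t (X t g) + (\<Sum>v\<in>spins N. \<Sum>u\<in>spins N. C v u * F2 t v u (X t g)))"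
      using int0 int2 by (simp add: Bochner_Integration.integral_add Bochner_Integration.integral_sum)
    also have "\<dots> \<le> (LINT g|gaussian_coords I. 0)"
      using pw int0 int2 by (intro integral_mono) auto
    also have "\<dots> = 0" by simp
    finally show "\<exists>y. (\<phi> has_real_derivative y) (at t) \<and> y \<le> 0"
      using der[of t] unfolding C_def by blast
  qed simp
qed

end

lemma power_div_fact_le_exp:
  fixes x :: real
  assumes "0 \<le> x"
  shows "x ^ k / fact k \<le> exp x"
proof -
  have s: "summable (\<lambda>n. x ^ n /\<^sub>R fact n)" by (rule summable_exp_generic)
  have "(\<Sum>n\<in>{k}. x ^ n /\<^sub>R fact n) \<le> (\<Sum>n. x ^ n /\<^sub>R fact n)"
    using assms by (intro sum_le_suminf s) auto
  then show ?thesis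
    by (simp add: exp_def divide_inverse mult.commute)
qed

context sk_model
begin

lemma decoupled_energy:
  "X 0 g \<sigma> + m \<sigma> = (\<Sum>i\<in>{1..N}. (\<beta> * g (0, i) * sqrt q + h) * \<sigma> i)"
proof -
  have "(\<Sum>p\<in>pairs N. c \<sigma> p 0 * g p) = 0"
  proof (intro sum.neutral ballI)
    fix p assume "p \<in> pairs N"
    then show "c \<sigma> p 0 * g p = 0"
      by (cases p) (use pairs_nonzero in \<open>auto simp: c_def\<close>)
  qed
  moreover have "(\<Sum>j\<in>{1..N}. c \<sigma> (0, j) 0 * g (0, j)) = (\<Sum>j\<in>{1..N}. (\<beta> * g (0, j) * sqrt q) * \<sigma> j)"
    by (intro sum.cong refl) (simp add: c_def)
  ultimately show ?thesis
    unfolding X_def sum_I m_def by (simp add: sum_distrib_left distrib_right sum.distrib)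
qed

lemma decoupled_exponential:
  "(\<Sum>\<sigma>\<in>spins N. \<Sum>\<tau>\<in>spins N. w (X 0 g) \<sigma> * w (X 0 g) \<tau> * exp (l * ((\<Sum>i\<in>{1..N}. \<sigma> i * \<tau> i) - real N * q)))
    = (\<Prod>i\<in>{1..N}. (cosh l + (tanh (\<beta> * g (0, i) * sqrt q + h))\<^sup>2 * sinh l) * exp (- (l * q)))"
proof -
  define y where "y i = \<beta> * g (0, i) * sqrt q + h" for i
  define Z where "Z = (\<Prod>i\<in>{1..N}. \<Sum>a\<in>{-1, 1}. exp (y i * a))"
  have Zpos: "Z > 0"
    unfolding Z_def by (intro prod_pos sum_pos ballI) auto
  have ex: "exp (X 0 g \<sigma> + m \<sigma>) = (\<Prod>i\<in>{1..N}. exp (y i * \<sigma> i))" for \<sigma>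
    unfolding decoupled_energy y_def by (simp add: exp_sum)
  have Z: "(\<Sum>\<rho>\<in>spins N. exp (X 0 g \<rho> + m \<rho>)) = Z"
    unfolding ex Z_def by (rule sum_spins_prod)
  have l: "exp (l * ((\<Sum>i\<in>{1..N}. \<sigma> i * \<tau> i) - real N * q)) = (\<Prod>i\<in>{1..N}. exp (l * (\<sigma> i * \<tau> i - q)))"
    for \<sigma> \<tau> :: "nat \<Rightarrow> real"
    by (subst exp_sum [symmetric]) (auto simp: sum_distrib_left [symmetric] sum_subtractf)
  have "(\<Sum>\<sigma>\<in>spins N. \<Sum>\<tau>\<in>spins N. w (X 0 g) \<sigma> * w (X 0 g) \<tau> * exp (l * ((\<Sum>i\<in>{1..N}. \<sigma> i * \<tau> i) - real N * q)))
      = (\<Sum>\<sigma>\<in>spins N. \<Sum>\<tau>\<in>spins N. (\<Prod>i\<in>{1..N}. exp (y i * \<sigma> i) * exp (y i * \<tau> i) * exp (l * (\<sigma> i * \<tau> i - q))) / Z\<^sup>2)"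
    unfolding weight_def Z unfolding ex l by (intro sum.cong refl) (simp add: prod.distrib power2_eq_square)
  also have "\<dots> = (\<Sum>\<sigma>\<in>spins N. \<Prod>i\<in>{1..N}. \<Sum>b\<in>{-1, 1}. exp (y i * \<sigma> i) * exp (y i * b) * exp (l * (\<sigma> i * b - q))) / Z\<^sup>2"
    unfolding sum_divide_distrib [symmetric] by (subst sum_spins_prod) (rule refl)
  also have "\<dots> = (\<Prod>i\<in>{1..N}. \<Sum>a\<in>{-1, 1}. \<Sum>b\<in>{-1, 1}. exp (y i * a) * exp (y i * b) * exp (l * (a * b - q))) / Z\<^sup>2"
    by (subst sum_spins_prod) (rule refl)
  also have "\<dots> = (\<Prod>i\<in>{1..N}. (\<Sum>a\<in>{-1, 1}. exp (y i * a))\<^sup>2 *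
      ((cosh l + (tanh (y i))\<^sup>2 * sinh l) * exp (- (l * q)))) / Z\<^sup>2"
    unfolding spin_pair_sum ..
  also have "\<dots> = (\<Prod>i\<in>{1..N}. (\<Sum>a\<in>{-1, 1}. exp (y i * a))\<^sup>2) *
      (\<Prod>i\<in>{1..N}. (cosh l + (tanh (y i))\<^sup>2 * sinh l) * exp (- (l * q))) / Z\<^sup>2"
    by (simp only: prod.distrib)
  also have "(\<Prod>i\<in>{1..N}. (\<Sum>a\<in>{-1, 1}. exp (y i * a))\<^sup>2) = Z\<^sup>2"
    unfolding Z_def by (rule prod_power_distrib [symmetric])
  also have "Z\<^sup>2 * (\<Prod>i\<in>{1..N}. (cosh l + (tanh (y i))\<^sup>2 * sinh l) * exp (- (l * q))) / Z\<^sup>2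
      = (\<Prod>i\<in>{1..N}. (cosh l + (tanh (y i))\<^sup>2 * sinh l) * exp (- (l * q)))"
    using Zpos by simp
  finally show ?thesis unfolding y_def .
qed

lemma weights_measurable: "\<sigma> \<in> spins N \<Longrightarrow> (\<lambda>g. w (X t g) \<sigma>) \<in> borel_measurable (gaussian_coords I)"
  using weight_measurable[of "spins N" \<sigma> "\<lambda>v g. X t g v" "gaussian_coords I" m] X_measurable by simp

lemma weights_integrable:
  assumes "\<sigma> \<in> spins N" "\<tau> \<in> spins N"
  shows "integrable (gaussian_coords I) (\<lambda>g. w (X t g) \<sigma> * w (X t g) \<tau>)"
proof -
  interpret G: prob_space "gaussian_coords I" by (rule prob_space_gaussian_coords)
  have "\<bar>w (X t g) \<sigma> * w (X t g) \<tau>\<bar> \<le> 1" for g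
    using w_bounds assms by (auto simp: abs_mult intro!: mult_le_one)
  then show ?thesis
    using weights_measurable assms by (intro G.integrable_const_bound[of _ 1]) auto
qed

text \<open>At \<open>t = 0\<close> the sites are independent, also after averaging over the fields, and \<open>\<sigma>\<^sub>i \<tau>\<^sub>i\<close> has mean \<open>q\<close>
  by the self-consistency equation. Hoeffding's lemma therefore makes \<open>N (R - q)\<close> subgaussian with
  variance \<open>N\<close>.\<close>

lemma decoupled_average: "\<phi> 0 \<le> 1 / sqrt (1 - 2 * s)"
proof -
  interpret G: prob_space "gaussian_coords I" by (rule prob_space_gaussian_coords)
  define \<pi> where "\<pi> p = (LINT g|gaussian_coords I. w (X 0 g) (fst p) * w (X 0 g) (snd p))" for p
  define Y where "Y p = (\<Sum>i\<in>{1..N}. fst p i * snd p i) - real N * q" for p :: "(nat \<Rightarrow> real) \<times> (nat \<Rightarrow> real)"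
  let ?S = "spins N \<times> spins N"
  have \<pi>: "\<pi> p \<ge> 0" for p
    unfolding \<pi>_def using w_bounds by (intro Bochner_Integration.integral_nonneg) auto
  have swap: "(\<Sum>p\<in>?S. \<pi> p * f p) =
      (LINT g|gaussian_coords I. (\<Sum>\<sigma>\<in>spins N. \<Sum>\<tau>\<in>spins N. w (X 0 g) \<sigma> * w (X 0 g) \<tau> * f (\<sigma>, \<tau>)))" for f
    unfolding \<pi>_def sum.cartesian_product split_def
    using weights_integrable by (subst Bochner_Integration.integral_sum) (auto intro!: sum.cong)
  have moment: "(\<Sum>p\<in>?S. \<pi> p * exp (l * Y p)) \<le> exp (l\<^sup>2 * real N / 2)" for l
  proof -
    define f where "f p z = (if fst p = 0 then (cosh l + (tanh (\<beta> * z * sqrt q + h))\<^sup>2 * sinh l) * exp (- (l * q)) else 1)"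
      for p :: "nat \<times> nat" and z :: real
    have tm: "(\<lambda>z. (tanh (\<beta> * z * sqrt q + h))\<^sup>2) \<in> borel_measurable borel"
      by (intro borel_measurable_continuous_onI continuous_intros) auto
    have ti: "integrable std_gaussian (\<lambda>z. (tanh (\<beta> * z * sqrt q + h))\<^sup>2)"
      using tm tanh_square_le_1 by (intro gauss1.integrable_const_bound[of _ 1]) auto
    have fi: "integrable std_gaussian (f p)" for p
      unfolding f_def [abs_def] using ti by (cases "fst p = 0") auto
    have f0: "(LINT z|std_gaussian. f (0, i) z) = (cosh l + q * sinh l) * exp (- (l * q))" for i
    proof -
      have "(LINT z|std_gaussian. f (0, i) z) = (cosh l + overlap_map \<beta> h q * sinh l) * exp (- (l * q))"
        unfolding f_def overlap_map_def using ti gauss1.prob_space by simp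
      then show ?thesis using q(3) by simp
    qed
    have f1: "f p = (\<lambda>_. 1)" if "p \<in> pairs N" for p
      using that by (auto simp: f_def pairs_def)
    have "(\<Sum>p\<in>?S. \<pi> p * exp (l * Y p)) = (LINT g|gaussian_coords I. (\<Prod>p\<in>I. f p (g p)))"
      unfolding swap Y_def fst_conv snd_conv decoupled_exponential prod_I using f1
      by (intro Bochner_Integration.integral_cong refl) (simp add: f_def)
    also have "\<dots> = (\<Prod>p\<in>I. LINT z|std_gaussian. f p z)"
      by (intro integral_prod_gaussian_coords finite_I fi)
    also have "\<dots> = ((cosh l + q * sinh l) * exp (- (l * q))) ^ N"
      unfolding prod_I f0 using f1 gauss1.prob_space by simp
    also have "\<dots> \<le> exp (l\<^sup>2 / 2) ^ N"
    proof (intro power_mono cosh_plus_mean_sinh_le mult_nonneg_nonneg)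
      show "0 \<le> cosh l + q * sinh l"
      proof -
        have "0 \<le> (1 - q) * cosh l + q * exp l"
          using q by (intro add_nonneg_nonneg mult_nonneg_nonneg) auto
        also have "\<dots> = cosh l + q * sinh l"
          unfolding cosh_plus_sinh [of l, symmetric] by (simp add: algebra_simps)
        finally show ?thesis .
      qed
    qed (use q in auto)
    also have "\<dots> = exp (l\<^sup>2 * real N / 2)"
      by (simp add: exp_of_nat_mult [symmetric] mult_ac)
    finally show ?thesis .
  qed
  have "(\<integral>\<^sup>+p. ennreal (\<pi> p * exp (s / real N * (Y p)\<^sup>2)) \<partial>count_space ?S)
      \<le> ennreal (1 / sqrt (1 - 2 * (s / real N) * real N))"
  proof (rule subgaussian_exp_square)
    show "sigma_finite_measure (count_space ?S)"
      by (intro sigma_finite_measure_count_space_finite) auto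
    show "(\<integral>\<^sup>+p. ennreal (\<pi> p * exp (l * Y p)) \<partial>count_space ?S) \<le> ennreal (exp (l\<^sup>2 * real N / 2))" for l
      using moment[of l] \<pi> by (simp add: nn_integral_count_space_finite sum_ennreal ennreal_leI)
  qed (use \<pi> s s_nonneg N in auto)
  then have "(\<Sum>p\<in>?S. \<pi> p * exp (s / real N * (Y p)\<^sup>2)) \<le> 1 / sqrt (1 - 2 * s)"
    using \<pi> N s by (simp add: nn_integral_count_space_finite sum_ennreal)
  also have "(\<Sum>p\<in>?S. \<pi> p * exp (s / real N * (Y p)\<^sup>2)) = \<phi> 0"
  proof -
    have "s / real N * (Y (\<sigma>, \<tau>))\<^sup>2 = lam 0 * \<Delta> \<sigma> \<tau>" for \<sigma> \<tau>
    proof -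
      have "Y (\<sigma>, \<tau>) = real N * (overlap N \<sigma> \<tau> - q)"
        using N by (simp add: Y_def overlap_def algebra_simps)
      then show ?thesis
        using N by (simp add: \<Delta>_def lam_def power_mult_distrib power2_eq_square)
    qed
    then show ?thesis
      unfolding swap \<phi>_def F_def e_def [abs_def] E_def avg_def
      by (simp add: sum_distrib_left mult.assoc)
  qed
  finally show ?thesis .
qed

lemma gibbs_average_eq_av:
  "gibbs_average \<beta> h N G f = av (\<lambda>\<sigma>. \<Sum>p\<in>pairs N. \<beta> / sqrt (real N) * (\<sigma> (fst p) * \<sigma> (snd p)) * G p) f"
proof -
  have "- hamiltonian \<beta> h N G \<sigma> = (\<Sum>p\<in>pairs N. \<beta> / sqrt (real N) * (\<sigma> (fst p) * \<sigma> (snd p)) * G p) + m \<sigma>" for \<sigma>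
    by (simp add: hamiltonian_def m_def split_def sum_distrib_left mult_ac)
  then show ?thesis
    by (simp add: gibbs_average_def gibbs_weight_def partition_function_def avg_def weight_def mult.commute)
qed

text \<open>At \<open>t = \<pi>/2\<close> the site fields have disappeared and \<open>F\<close> is the two-replica average of the model.\<close>

lemma exponential_overlap_moment:
  defines "f \<equiv> \<lambda>G. gibbs_average \<beta> h N G (\<lambda>\<sigma>. gibbs_average \<beta> h N G (\<lambda>\<tau>.
      exp ((s - 2 * \<beta>\<^sup>2) * (real N * (overlap N \<sigma> \<tau> - sk_q \<beta> h)\<^sup>2))))"
  shows "integrable (gaussian_coords (pairs N)) f" "(LINT G|gaussian_coords (pairs N). f G) \<le> 1 / sqrt (1 - 2 * s)"
proof -
  have Xe: "X (pi / 2) g = (\<lambda>\<sigma>. \<Sum>p\<in>pairs N. \<beta> / sqrt (real N) * (\<sigma> (fst p) * \<sigma> (snd p)) * g p)" for g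
  proof
    fix \<sigma>
    have "(\<Sum>p\<in>pairs N. c \<sigma> p (pi / 2) * g p)
        = (\<Sum>p\<in>pairs N. \<beta> / sqrt (real N) * (\<sigma> (fst p) * \<sigma> (snd p)) * g p)"
    proof (intro sum.cong refl)
      fix p assume "p \<in> pairs N"
      then have "fst p \<noteq> 0" by (auto simp: pairs_def)
      then show "c \<sigma> p (pi / 2) * g p = \<beta> / sqrt (real N) * (\<sigma> (fst p) * \<sigma> (snd p)) * g p"
        by (simp add: c_def split_def)
    qed
    moreover have "(\<Sum>j\<in>{1..N}. c \<sigma> (0, j) (pi / 2) * g (0, j)) = 0"
      by (simp add: c_def)
    ultimately show "X (pi / 2) g \<sigma> = (\<Sum>p\<in>pairs N. \<beta> / sqrt (real N) * (\<sigma> (fst p) * \<sigma> (snd p)) * g p)"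
      unfolding X_def sum_I by simp
  qed
  have fe: "f g = F (pi / 2) (X (pi / 2) g)" for g
  proof -
    have "E (pi / 2) \<sigma> = (\<lambda>\<tau>. exp ((s - 2 * \<beta>\<^sup>2) * (real N * (overlap N \<sigma> \<tau> - sk_q \<beta> h)\<^sup>2)))" for \<sigma>
      by (simp add: E_def fun_eq_iff lam_def \<Delta>_def q_def)
    then show ?thesis
      unfolding f_def F_def e_def [abs_def] gibbs_average_eq_av Xe [symmetric] by simp
  qed
  have dep: "f (restrict g (pairs N)) = f g" for g
  proof -
    have "X (pi / 2) (restrict g (pairs N)) = X (pi / 2) g"
      unfolding Xe by (intro ext sum.cong) auto
    then show ?thesis unfolding fe by simp
  qed
  have meas: "f \<in> borel_measurable (gaussian_coords (pairs N))"
    unfolding f_def gibbs_average_eq_av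
    by (intro av_measurable borel_measurable_sum borel_measurable_times borel_measurable_const measurable_gaussian_coord)
  have sub: "pairs N \<subseteq> I" by (simp add: I_def)
  note marg = gaussian_coords_marginal[OF finite_I sub meas dep]
  have int: "integrable (gaussian_coords I) f"
    using integrable_coupled_average[of "pi / 2"] by (simp add: fe [abs_def])
  then show "integrable (gaussian_coords (pairs N)) f" using marg(1) by simp
  have "(LINT G|gaussian_coords (pairs N). f G) = (LINT G|gaussian_coords I. f G)"
    by (rule marg(2) [symmetric])
  also have "\<dots> = \<phi> (pi / 2)"
    by (simp add: \<phi>_def fe)
  also have "\<dots> \<le> \<phi> 0" by (rule coupled_average_decreasing)
  also have "\<dots> \<le> 1 / sqrt (1 - 2 * s)" by (rule decoupled_average)
  finally show "(LINT G|gaussian_coords (pairs N). f G) \<le> 1 / sqrt (1 - 2 * s)" .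
qed

end

lemma gibbs_average_mono:
  assumes "\<And>\<sigma>. \<sigma> \<in> spins N \<Longrightarrow> f \<sigma> \<le> f' \<sigma>"
  shows "gibbs_average \<beta> h N G f \<le> gibbs_average \<beta> h N G f'"
  unfolding gibbs_average_def gibbs_weight_def partition_function_def
  using assms by (intro sum_mono mult_right_mono) (auto intro!: divide_nonneg_nonneg sum_nonneg)

lemma gibbs_average_cmult:
  "gibbs_average \<beta> h N G (\<lambda>\<sigma>. c * f \<sigma>) = c * gibbs_average \<beta> h N G f"
  by (simp add: gibbs_average_def sum_distrib_left mult.assoc)

definition overlap_moment :: "real \<Rightarrow> real \<Rightarrow> nat \<Rightarrow> nat \<Rightarrow> (nat \<times> nat \<Rightarrow> real) \<Rightarrow> real" where
  "overlap_moment \<beta> h N n G = gibbs_average \<beta> h N G (\<lambda>\<sigma>. gibbs_average \<beta> h N G (\<lambda>\<tau>.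
      \<bar>overlap N \<sigma> \<tau> - sk_q \<beta> h\<bar> ^ n))"

text \<open>A moment of order \<open>2k\<close> is dominated by the exponential of \<open>b N (R - q)\<^sup>2\<close> at the price of a factor
  \<open>k! / (b N)\<^sup>k\<close>.\<close>

theorem overlap_concentration:
  assumes \<beta>0: "0 < \<beta>\<^sub>0" "\<beta>\<^sub>0 < 1 / 2"
  shows "\<exists>K. \<forall>N \<beta> h. 1 \<le> N \<and> 0 < \<beta> \<and> \<beta> \<le> \<beta>\<^sub>0 \<longrightarrow>
    integrable (gaussian_coords (pairs N)) (overlap_moment \<beta> h N (2 * k)) \<and>
    (LINT G|gaussian_coords (pairs N). overlap_moment \<beta> h N (2 * k) G) \<le> K / real N ^ k"
proof -
  (* s must stay below 1/2 and exceed 2 \<beta>^2; b bounds s - 2 \<beta>^2 from below for all \<beta> \<le> \<beta>0 *)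
  define s where "s = 1 / 4 + \<beta>\<^sub>0\<^sup>2"
  define b where "b = 1 / 4 - \<beta>\<^sub>0\<^sup>2"
  have "\<beta>\<^sub>0\<^sup>2 < (1/2)\<^sup>2"
    using \<beta>0 by (intro power_strict_mono) auto
  then have b0: "\<beta>\<^sub>0\<^sup>2 < 1/4" by (simp add: power2_eq_square)
  then have b: "b > 0" by (simp add: b_def)
  define K where "K = fact k / b ^ k * (1 / sqrt (1 - 2 * s))"
  show ?thesis
  proof (intro exI[of _ K] allI impI)
    fix N :: nat and \<beta> h :: real
    assume A: "1 \<le> N \<and> 0 < \<beta> \<and> \<beta> \<le> \<beta>\<^sub>0"
    have sq: "\<beta>\<^sup>2 \<le> \<beta>\<^sub>0\<^sup>2" using A by (intro power_mono) auto
    have s: "2 * \<beta>\<^sup>2 \<le> s" using sq b0 unfolding s_def by linarith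
    have "2 * s = 1 / 2 + 2 * \<beta>\<^sub>0\<^sup>2" by (simp add: s_def distrib_left)
    then have s': "2 * s < 1" using b0 by linarith
    interpret sk_model N \<beta> h s
      by standard (use A \<beta>0 s s' in auto)
    have N0: "real N > 0" using A by simp
    define f where "f G = gibbs_average \<beta> h N G (\<lambda>\<sigma>. gibbs_average \<beta> h N G (\<lambda>\<tau>.
      exp ((s - 2 * \<beta>\<^sup>2) * (real N * (overlap N \<sigma> \<tau> - sk_q \<beta> h)\<^sup>2))))" for G
    define C where "C = fact k / (b * real N) ^ k"
    have C: "C \<ge> 0" using b N0 by (simp add: C_def)
    note ex = exponential_overlap_moment [folded f_def [abs_def]]
    have pw: "\<bar>x\<bar> ^ (2 * k) \<le> C * exp ((s - 2 * \<beta>\<^sup>2) * (real N * x\<^sup>2))" for x :: real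
    proof -
      have "(b * (real N * x\<^sup>2)) ^ k / fact k \<le> exp (b * (real N * x\<^sup>2))"
        using b by (intro power_div_fact_le_exp) auto
      also have "\<dots> \<le> exp ((s - 2 * \<beta>\<^sup>2) * (real N * x\<^sup>2))"
        using sq unfolding exp_le_cancel_iff by (intro mult_right_mono) (auto simp: s_def b_def)
      finally have "C * ((b * (real N * x\<^sup>2)) ^ k / fact k) \<le> C * exp ((s - 2 * \<beta>\<^sup>2) * (real N * x\<^sup>2))"
        using C by (rule mult_left_mono)
      moreover have "C * ((b * (real N * x\<^sup>2)) ^ k / fact k) = \<bar>x\<bar> ^ (2 * k)"
        using b N0 by (simp add: C_def power_mult_distrib power_mult)
      ultimately show ?thesis by simp
    qed
    have le: "overlap_moment \<beta> h N (2 * k) G \<le> C * f G" for G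
      unfolding overlap_moment_def f_def gibbs_average_cmult [symmetric]
      by (intro gibbs_average_mono pw)
    have nn: "0 \<le> overlap_moment \<beta> h N (2 * k) G" for G
      unfolding overlap_moment_def gibbs_average_eq_av
      by (intro avg_ge) auto
    have meas: "overlap_moment \<beta> h N (2 * k) \<in> borel_measurable (gaussian_coords (pairs N))"
      unfolding overlap_moment_def [abs_def] gibbs_average_eq_av
      by (intro av_measurable borel_measurable_sum borel_measurable_times borel_measurable_const measurable_gaussian_coord)
    have int: "integrable (gaussian_coords (pairs N)) (overlap_moment \<beta> h N (2 * k))"
    proof (rule Bochner_Integration.integrable_bound[OF integrable_mult_right[OF ex(1), of C] meas])
      show "AE G in gaussian_coords (pairs N). norm (overlap_moment \<beta> h N (2 * k) G) \<le> norm (C * f G)"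
        using le nn by (intro always_eventually allI) (metis abs_of_nonneg order_trans real_norm_def)
    qed
    have "(LINT G|gaussian_coords (pairs N). overlap_moment \<beta> h N (2 * k) G) \<le> (LINT G|gaussian_coords (pairs N). C * f G)"
      using le int ex(1) by (intro integral_mono) auto
    also have "\<dots> = C * (LINT G|gaussian_coords (pairs N). f G)" by simp
    also have "\<dots> \<le> C * (1 / sqrt (1 - 2 * s))"
      using ex(2) C by (rule mult_left_mono)
    also have "\<dots> = K / real N ^ k"
      by (simp add: C_def K_def power_mult_distrib)
    finally show "integrable (gaussian_coords (pairs N)) (overlap_moment \<beta> h N (2 * k)) \<and>
      (LINT G|gaussian_coords (pairs N). overlap_moment \<beta> h N (2 * k) G) \<le> K / real N ^ k"
      using int by simp
  qed
qed

section \<open>Products of centred test functions\<close>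

text \<open>A smooth test function together with its derivatives: \<open>A p\<close> plays the role of the derivative of
  order \<open>p\<close>.\<close>

locale test_family =
  fixes A :: "nat \<Rightarrow> real \<Rightarrow> real"
  assumes A_deriv: "\<And>p x. (A p has_real_derivative A (Suc p) x) (at x)"
    and A_growth: "\<And>p a. a > 0 \<Longrightarrow> \<exists>C. \<forall>x. \<bar>A p x\<bar> \<le> C * exp (a * x\<^sup>2)"
begin

lemma A_continuous: "continuous_on S (A p)"
  using A_deriv by (meson DERIV_isCont continuous_at_imp_continuous_on)

lemma A_measurable [measurable]: "A p \<in> borel_measurable borel"
  by (intro borel_measurable_continuous_onI A_continuous)

end

lemma square_sum_le: "(x + y)\<^sup>2 \<le> 2 * x\<^sup>2 + 2 * (y::real)\<^sup>2"
  using sum_squares_bound[of x y] by (simp add: power2_sum)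

locale smoothed_family = test_family +
  fixes \<rho> :: real
  assumes \<rho>: "0 \<le> \<rho>" "\<rho> \<le> 1"
begin

text \<open>Gaussian smoothing commutes with differentiation, so \<open>W p\<close> is the derivative of order \<open>p\<close> of \<open>W 0\<close>.\<close>

definition W where "W p x = (LINT z|std_gaussian. A p (x + \<rho> * z))"

lemma shift_square: "(x + \<rho> * z)\<^sup>2 \<le> 2 * x\<^sup>2 + 2 * z\<^sup>2"
proof -
  have "\<rho>\<^sup>2 * z\<^sup>2 \<le> 1 * z\<^sup>2"
    using \<rho> by (intro mult_right_mono) (auto simp: power_le_one)
  then show ?thesis
    using square_sum_le[of x "\<rho> * z"] by (simp add: power_mult_distrib)
qed

lemma A_shift_bound:
  assumes "0 \<le> a" "\<And>x. \<bar>A p x\<bar> \<le> C * exp (a * x\<^sup>2)"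
  shows "\<bar>A p (x + \<rho> * z)\<bar> \<le> C * exp (2 * a * x\<^sup>2) * exp (2 * a * z\<^sup>2)"
proof -
  have C: "C \<ge> 0" using assms(2)[of 0] by simp
  have "\<bar>A p (x + \<rho> * z)\<bar> \<le> C * exp (a * (x + \<rho> * z)\<^sup>2)" by (rule assms(2))
  also have "\<dots> \<le> C * exp (a * (2 * x\<^sup>2 + 2 * z\<^sup>2))"
    using assms(1) C shift_square by (intro mult_left_mono) (auto intro!: mult_left_mono)
  also have "\<dots> = C * exp (2 * a * x\<^sup>2) * exp (2 * a * z\<^sup>2)"
    by (simp add: exp_add [symmetric] algebra_simps)
  finally show ?thesis .
qed

lemma exp_square_integrable: "4 * a < 1 \<Longrightarrow> integrable std_gaussian (\<lambda>z. K * exp (2 * a * z\<^sup>2))"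
  using exp_square_std_gaussian[of "2 * a"] by (intro integrable_mult_right) (auto simp: has_bochner_integral_iff)

lemma A_shift_integrable: "integrable std_gaussian (\<lambda>z. A p (x + \<rho> * z))"
proof -
  obtain C where C: "\<And>x. \<bar>A p x\<bar> \<le> C * exp (1 / 8 * x\<^sup>2)"
    using A_growth[of "1/8" p] by auto
  have C0: "C \<ge> 0" using C[of 0] by simp
  have b: "\<bar>A p (x + \<rho> * z)\<bar> \<le> C * exp (2 * (1/8) * x\<^sup>2) * exp (2 * (1/8) * z\<^sup>2)" for z
    by (rule A_shift_bound[OF _ C]) simp
  show ?thesis
  proof (rule Bochner_Integration.integrable_bound)
    show "integrable std_gaussian (\<lambda>z. C * exp (2 * (1/8) * x\<^sup>2) * exp (2 * (1/8) * z\<^sup>2))"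
      by (rule exp_square_integrable) simp
    show "AE z in std_gaussian. norm (A p (x + \<rho> * z)) \<le> norm (C * exp (2 * (1/8) * x\<^sup>2) * exp (2 * (1/8) * z\<^sup>2))"
      using b C0 by (intro always_eventually allI) (simp add: abs_mult)
  qed measurable
qed

lemma W_bound:
  assumes "0 \<le> a" "8 * a \<le> 1" "\<And>x. \<bar>A p x\<bar> \<le> C * exp (a * x\<^sup>2)"
  shows "\<bar>W p x\<bar> \<le> 2 * C * exp (2 * a * x\<^sup>2)"
proof -
  have C: "C \<ge> 0" using assms(3)[of 0] by simp
  have e: "(LINT z|std_gaussian. exp (2 * a * z\<^sup>2)) \<le> 2"
  proof -
    have "(LINT z|std_gaussian. exp (2 * a * z\<^sup>2)) = 1 / sqrt (1 - 2 * (2 * a))"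
      using exp_square_std_gaussian[of "2 * a"] assms by (simp add: has_bochner_integral_iff)
    also have "\<dots> \<le> 1 / sqrt (1 / 4)"
      using assms by (intro divide_left_mono real_sqrt_le_mono mult_pos_pos) auto
    also have "sqrt (1 / 4) = (1 / 2 :: real)"
      by (rule real_sqrt_unique) (auto simp: power2_eq_square)
    finally show ?thesis by simp
  qed
  have "\<bar>W p x\<bar> \<le> (LINT z|std_gaussian. \<bar>A p (x + \<rho> * z)\<bar>)"
    unfolding W_def by (rule integral_abs_bound)
  also have "\<dots> \<le> (LINT z|std_gaussian. C * exp (2 * a * x\<^sup>2) * exp (2 * a * z\<^sup>2))"
    using A_shift_integrable A_shift_bound[OF assms(1,3)] assms(2)
    by (intro integral_mono exp_square_integrable) auto
  also have "\<dots> = C * exp (2 * a * x\<^sup>2) * (LINT z|std_gaussian. exp (2 * a * z\<^sup>2))"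
    by simp
  also have "\<dots> \<le> C * exp (2 * a * x\<^sup>2) * 2"
    using e C by (intro mult_left_mono) auto
  finally show ?thesis by (simp add: mult_ac)
qed

lemma W_growth:
  assumes "a > 0"
  shows "\<exists>C. \<forall>x. \<bar>W p x\<bar> \<le> C * exp (a * x\<^sup>2)"
proof -
  define b where "b = min (a / 2) (1 / 8)"
  have b: "b > 0" "8 * b \<le> 1" "2 * b \<le> a" using assms by (auto simp: b_def)
  obtain C where C: "\<And>x. \<bar>A p x\<bar> \<le> C * exp (b * x\<^sup>2)"
    using A_growth[OF b(1), of p] by auto
  have C0: "C \<ge> 0" using C[of 0] by simp
  have "\<bar>W p x\<bar> \<le> 2 * C * exp (a * x\<^sup>2)" for x
  proof -
    have "\<bar>W p x\<bar> \<le> 2 * C * exp (2 * b * x\<^sup>2)"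
      using b C by (intro W_bound) auto
    also have "\<dots> \<le> 2 * C * exp (a * x\<^sup>2)"
      using C0 b by (intro mult_left_mono) (auto intro!: mult_right_mono)
    finally show ?thesis .
  qed
  then show ?thesis by blast
qed

lemma W_deriv: "(W p has_real_derivative W (Suc p) x) (at x)"
proof -
  obtain C where C: "\<And>x. \<bar>A (Suc p) x\<bar> \<le> C * exp (1 / 8 * x\<^sup>2)"
    using A_growth[of "1/8" "Suc p"] by auto
  have C0: "C \<ge> 0" using C[of 0] by simp
  define K where "K = C * exp (2 * (1/8) * (\<bar>x\<bar> + 1)\<^sup>2)"
  have "((\<lambda>y. LINT z|std_gaussian. A p (y + \<rho> * z)) has_real_derivative
      (LINT z|std_gaussian. A (Suc p) (x + \<rho> * z))) (at x)"
  proof (rule has_real_derivative_integral[where S = "{x - 1<..<x + 1}" and w = "\<lambda>z. K * exp (2 * (1/8) * z\<^sup>2)"])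
    show "((\<lambda>s. A p (s + \<rho> * z)) has_real_derivative A (Suc p) (s + \<rho> * z)) (at s)" for s z
    proof -
      have "((\<lambda>s. s + \<rho> * z) has_real_derivative 1) (at s)"
        by (auto intro!: derivative_eq_intros)
      from DERIV_chain2[OF A_deriv this] show ?thesis by simp
    qed
    show "\<bar>A (Suc p) (s + \<rho> * z)\<bar> \<le> K * exp (2 * (1/8) * z\<^sup>2)" if "s \<in> {x - 1<..<x + 1}" for s z
    proof -
      have "\<bar>s\<bar> \<le> \<bar>x\<bar> + 1" using that by auto
      then have "s\<^sup>2 \<le> (\<bar>x\<bar> + 1)\<^sup>2" by (metis abs_ge_zero power2_abs power_mono)
      then have "C * exp (2 * (1/8) * s\<^sup>2) \<le> K"
        unfolding K_def using C0 by (intro mult_left_mono) auto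
      then have "C * exp (2 * (1/8) * s\<^sup>2) * exp (2 * (1/8) * z\<^sup>2) \<le> K * exp (2 * (1/8) * z\<^sup>2)"
        by (intro mult_right_mono) auto
      moreover have "\<bar>A (Suc p) (s + \<rho> * z)\<bar> \<le> C * exp (2 * (1/8) * s\<^sup>2) * exp (2 * (1/8) * z\<^sup>2)"
        by (rule A_shift_bound[OF _ C]) simp
      ultimately show ?thesis by linarith
    qed
    show "integrable std_gaussian (\<lambda>z. K * exp (2 * (1/8) * z\<^sup>2))"
      by (rule exp_square_integrable) simp
    show "integrable std_gaussian (\<lambda>z. A p (s + \<rho> * z))" for s
      by (rule A_shift_integrable)
  qed auto
  then show ?thesis
    by (simp add: W_def [abs_def])
qed

lemma W_continuous: "continuous_on S (W p)"
  using W_deriv by (meson DERIV_isCont continuous_at_imp_continuous_on)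

lemma W_measurable [measurable]: "W p \<in> borel_measurable borel"
  by (intro borel_measurable_continuous_onI W_continuous)

text \<open>The coordinate 0 of \<open>x\<close> is the common field \<open>r\<close>, the coordinate \<open>a\<close> the centred field of replica
  \<open>a\<close>. The number \<open>\<gamma> a\<close> is 1 while the smoothed term is present and becomes 0 once the factor has
  been differentiated in \<open>x a\<close>. With this bookkeeping the products of factors are closed under
  partial derivatives; a derivative in \<open>x 0\<close> preserves the centring of every factor. The
  functions \<open>Pr1\<close> and \<open>Pr2\<close> below are the first and second partial derivatives of \<open>Pr\<close>.\<close>

definition factor where "factor p \<gamma> x a = A (p a) (x 0 + x a) - \<gamma> a * W (p a) (x 0)"
  for p :: "nat \<Rightarrow> nat" and \<gamma> x :: "nat \<Rightarrow> real" and a :: nat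

definition Pr where "Pr n p \<gamma> x = (\<Prod>a\<in>{1..n}. factor p \<gamma> x a)" for n :: nat

abbreviation inc :: "(nat \<Rightarrow> nat) \<Rightarrow> nat \<Rightarrow> nat \<Rightarrow> nat" where "inc p a \<equiv> p(a := Suc (p a))"

definition Pr1 where "Pr1 n p \<gamma> v x =
  (if v = 0 then \<Sum>a\<in>{1..n}. Pr n (inc p a) \<gamma> x else Pr n (inc p v) (\<gamma>(v := 0)) x)" for n v :: nat

definition Pr2 where "Pr2 n p \<gamma> v u x =
  (if v = 0 then \<Sum>a\<in>{1..n}. Pr1 n (inc p a) \<gamma> u x else Pr1 n (inc p v) (\<gamma>(v := 0)) u x)" for n v u :: nat

lemma Pr_cong: "(\<And>a. a \<in> {1..n} \<Longrightarrow> \<gamma> a = \<gamma>' a) \<Longrightarrow> Pr n p \<gamma> x = Pr n p \<gamma>' x"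
  unfolding Pr_def factor_def by (intro prod.cong) auto

lemma Pr_update:
  assumes "a \<in> {1..n}"
  shows "Pr n (p(a := k)) (\<gamma>(a := c)) x = (A k (x 0 + x a) - c * W k (x 0)) * (\<Prod>b\<in>{1..n} - {a}. factor p \<gamma> x b)"
proof -
  have "Pr n (p(a := k)) (\<gamma>(a := c)) x = factor (p(a := k)) (\<gamma>(a := c)) x a *
      (\<Prod>b\<in>{1..n} - {a}. factor (p(a := k)) (\<gamma>(a := c)) x b)"
    unfolding Pr_def using assms by (subst prod.remove[of _ a]) auto
  also have "(\<Prod>b\<in>{1..n} - {a}. factor (p(a := k)) (\<gamma>(a := c)) x b) = (\<Prod>b\<in>{1..n} - {a}. factor p \<gamma> x b)"
    by (intro prod.cong) (auto simp: factor_def)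
  finally show ?thesis
    unfolding factor_def [of "p(a := k)"] fun_upd_same .
qed

lemma Pr_derivative:
  assumes x: "\<And>v. v \<in> {0..n} \<Longrightarrow> ((\<lambda>y. x y v) has_real_derivative x' v) (at t)"
  shows "((\<lambda>y. Pr n p \<gamma> (x y)) has_real_derivative (\<Sum>v\<in>{0..n}. Pr1 n p \<gamma> v (x t) * x' v)) (at t)"
proof -
  let ?x = "x t"
  have f: "((\<lambda>y. factor p \<gamma> (x y) a) has_real_derivative
      A (Suc (p a)) (?x 0 + ?x a) * (x' 0 + x' a) - \<gamma> a * (W (Suc (p a)) (?x 0) * x' 0)) (at t)"
    if "a \<in> {1..n}" for a
    unfolding factor_def
    using that by (intro DERIV_diff DERIV_cmult DERIV_chain2[OF A_deriv] DERIV_chain2[OF W_deriv] DERIV_add x) auto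
  have "((\<lambda>y. Pr n p \<gamma> (x y)) has_real_derivative
      (\<Sum>a\<in>{1..n}. (A (Suc (p a)) (?x 0 + ?x a) * (x' 0 + x' a) - \<gamma> a * (W (Suc (p a)) (?x 0) * x' 0))
        * (\<Prod>b\<in>{1..n} - {a}. factor p \<gamma> ?x b))) (at t)"
    unfolding Pr_def by (rule has_field_derivative_prod) (rule f)
  moreover have "(A (Suc (p a)) (?x 0 + ?x a) * (x' 0 + x' a) - \<gamma> a * (W (Suc (p a)) (?x 0) * x' 0))
        * (\<Prod>b\<in>{1..n} - {a}. factor p \<gamma> ?x b)
      = Pr n (inc p a) \<gamma> ?x * x' 0 + Pr1 n p \<gamma> a ?x * x' a" if "a \<in> {1..n}" for a
  proof -
    define Q where "Q = (\<Prod>b\<in>{1..n} - {a}. factor p \<gamma> ?x b)"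
    have 1: "Pr n (inc p a) \<gamma> ?x = (A (Suc (p a)) (?x 0 + ?x a) - \<gamma> a * W (Suc (p a)) (?x 0)) * Q"
      using Pr_update[OF that, of p "Suc (p a)" \<gamma> "\<gamma> a" ?x] unfolding Q_def fun_upd_triv .
    have "a \<noteq> 0" using that by simp
    then have 2: "Pr1 n p \<gamma> a ?x = A (Suc (p a)) (?x 0 + ?x a) * Q"
      using Pr_update[OF that, of p "Suc (p a)" \<gamma> 0 ?x] unfolding Q_def Pr1_def by simp
    show ?thesis
      unfolding 1 2 Q_def [symmetric] by algebra
  qed
  moreover have "(\<Sum>v\<in>{0..n}. Pr1 n p \<gamma> v ?x * x' v)
      = (\<Sum>a\<in>{1..n}. Pr n (inc p a) \<gamma> ?x * x' 0 + Pr1 n p \<gamma> a ?x * x' a)"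
  proof -
    have "{0..n} = insert 0 {1..n}" by auto
    then have "(\<Sum>v\<in>{0..n}. Pr1 n p \<gamma> v ?x * x' v) = Pr1 n p \<gamma> 0 ?x * x' 0 + (\<Sum>a\<in>{1..n}. Pr1 n p \<gamma> a ?x * x' a)"
      by simp
    then show ?thesis
      by (simp add: Pr1_def [of n p \<gamma> 0] sum.distrib sum_distrib_right)
  qed
  ultimately show ?thesis by simp
qed

lemma Pr1_derivative:
  assumes v: "v \<in> {0..n}" and x: "\<And>v. v \<in> {0..n} \<Longrightarrow> ((\<lambda>y. x y v) has_real_derivative x' v) (at t)"
  shows "((\<lambda>y. Pr1 n p \<gamma> v (x y)) has_real_derivative (\<Sum>u\<in>{0..n}. Pr2 n p \<gamma> v u (x t) * x' u)) (at t)"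
proof (cases "v = 0")
  case True
  have "((\<lambda>y. \<Sum>a\<in>{1..n}. Pr n (inc p a) \<gamma> (x y)) has_real_derivative
      (\<Sum>a\<in>{1..n}. \<Sum>u\<in>{0..n}. Pr1 n (inc p a) \<gamma> u (x t) * x' u)) (at t)"
    by (intro DERIV_sum Pr_derivative x)
  also have "(\<Sum>a\<in>{1..n}. \<Sum>u\<in>{0..n}. Pr1 n (inc p a) \<gamma> u (x t) * x' u) =
      (\<Sum>u\<in>{0..n}. Pr2 n p \<gamma> v u (x t) * x' u)"
    unfolding Pr2_def using True by (subst sum.swap) (simp add: sum_distrib_right)
  finally show ?thesis unfolding Pr1_def if_P[OF True] .
next
  case False
  then show ?thesis
    unfolding Pr1_def [of n p] Pr2_def using Pr_derivative[OF x] by simp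
qed

lemma Pr_continuous:
  assumes "\<And>v. v \<in> {0..n} \<Longrightarrow> continuous_on UNIV (\<lambda>y::real. x y v)"
  shows "continuous_on UNIV (\<lambda>y. Pr n p \<gamma> (x y))"
  unfolding Pr_def factor_def using assms
  by (intro continuous_intros continuous_on_compose2[OF A_continuous[of UNIV]]
      continuous_on_compose2[OF W_continuous[of UNIV]]) auto

lemma Pr1_continuous:
  assumes "\<And>v. v \<in> {0..n} \<Longrightarrow> continuous_on UNIV (\<lambda>y::real. x y v)"
  shows "continuous_on UNIV (\<lambda>y. Pr1 n p \<gamma> v (x y))"
  unfolding Pr1_def using assms by (cases "v = 0") (auto intro!: continuous_on_sum Pr_continuous)

lemma Pr2_continuous:
  assumes "\<And>v. v \<in> {0..n} \<Longrightarrow> continuous_on UNIV (\<lambda>y::real. x y v)"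
  shows "continuous_on UNIV (\<lambda>y. Pr2 n p \<gamma> v u (x y))"
  unfolding Pr2_def using assms by (cases "v = 0") (auto intro!: continuous_on_sum Pr1_continuous)

lemma Pr_measurable:
  assumes "\<And>v. v \<in> {0..n} \<Longrightarrow> Z v \<in> borel_measurable M"
  shows "(\<lambda>g. Pr n p \<gamma> (\<lambda>v. Z v g)) \<in> borel_measurable M"
proof -
  have "(\<lambda>g. factor p \<gamma> (\<lambda>v. Z v g) a) \<in> borel_measurable M" if "a \<in> {1..n}" for a
  proof -
    have [measurable]: "Z 0 \<in> borel_measurable M" "Z a \<in> borel_measurable M"
      using that by (auto intro: assms)
    show ?thesis unfolding factor_def by measurable
  qed
  then show ?thesis unfolding Pr_def by (intro borel_measurable_prod)
qed

lemma Pr1_measurable: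
  assumes "\<And>v. v \<in> {0..n} \<Longrightarrow> Z v \<in> borel_measurable M"
  shows "(\<lambda>g. Pr1 n p \<gamma> v (\<lambda>v. Z v g)) \<in> borel_measurable M"
  unfolding Pr1_def using assms by (cases "v = 0") (auto intro!: borel_measurable_sum Pr_measurable)

lemma Pr2_measurable:
  assumes "\<And>v. v \<in> {0..n} \<Longrightarrow> Z v \<in> borel_measurable M"
  shows "(\<lambda>g. Pr2 n p \<gamma> v u (\<lambda>v. Z v g)) \<in> borel_measurable M"
  unfolding Pr2_def using assms by (cases "v = 0") (auto intro!: borel_measurable_sum Pr1_measurable)

definition moderate where "moderate n f \<longleftrightarrow>
  (\<forall>a>0. \<exists>C. \<forall>x. \<bar>f x\<bar> \<le> C * exp (a * (\<Sum>v\<in>{0..n}. (x v)\<^sup>2)))" for n :: nat and f :: "(nat \<Rightarrow> real) \<Rightarrow> real"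

lemma moderate_sum:
  assumes "finite J" "\<And>j. j \<in> J \<Longrightarrow> moderate n (f j)"
  shows "moderate n (\<lambda>x. \<Sum>j\<in>J. f j x)"
  unfolding moderate_def
proof (intro allI impI)
  fix a :: real assume "a > 0"
  then have "\<forall>j\<in>J. \<exists>C. \<forall>x. \<bar>f j x\<bar> \<le> C * exp (a * (\<Sum>v\<in>{0..n}. (x v)\<^sup>2))"
    using assms(2) unfolding moderate_def by blast
  then obtain C where "\<forall>j\<in>J. \<forall>x. \<bar>f j x\<bar> \<le> C j * exp (a * (\<Sum>v\<in>{0..n}. (x v)\<^sup>2))"
    by (rule bchoice [THEN exE])
  then have C: "\<bar>f j x\<bar> \<le> C j * exp (a * (\<Sum>v\<in>{0..n}. (x v)\<^sup>2))" if "j \<in> J" for j x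
    using that by blast
  have "\<bar>\<Sum>j\<in>J. f j x\<bar> \<le> (\<Sum>j\<in>J. C j) * exp (a * (\<Sum>v\<in>{0..n}. (x v)\<^sup>2))" for x
    unfolding sum_distrib_right by (intro order_trans[OF sum_abs] sum_mono C)
  then show "\<exists>C. \<forall>x. \<bar>\<Sum>j\<in>J. f j x\<bar> \<le> C * exp (a * (\<Sum>v\<in>{0..n}. (x v)\<^sup>2))" by blast
qed

lemma Pr_moderate: "moderate n (Pr n p \<gamma>)"
  unfolding moderate_def
proof (intro allI impI)
  fix a :: real assume a: "a > 0"
  define b where "b = a / (2 * (real n + 1))"
  have b: "b > 0" using a by (simp add: b_def)
  have "\<exists>C. \<forall>x. \<bar>factor p \<gamma> x i\<bar> \<le> C * exp (2 * b * (\<Sum>v\<in>{0..n}. (x v)\<^sup>2))" if i: "i \<in> {1..n}" for i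
  proof -
    obtain C1 where C1: "\<And>x. \<bar>A (p i) x\<bar> \<le> C1 * exp (b * x\<^sup>2)"
      using A_growth[OF b, of "p i"] by auto
    obtain C2 where C2: "\<And>x. \<bar>W (p i) x\<bar> \<le> C2 * exp (b * x\<^sup>2)"
      using W_growth[OF b, of "p i"] by auto
    have C0: "C1 \<ge> 0" "C2 \<ge> 0" using C1[of 0] C2[of 0] by auto
    have "\<bar>factor p \<gamma> x i\<bar> \<le> (C1 + \<bar>\<gamma> i\<bar> * C2) * exp (2 * b * (\<Sum>v\<in>{0..n}. (x v)\<^sup>2))" for x
    proof -
      let ?S = "\<Sum>v\<in>{0..n}. (x v)\<^sup>2"
      have two: "(x 0)\<^sup>2 + (x i)\<^sup>2 \<le> ?S"
      proof -
        have "(x 0)\<^sup>2 + (x i)\<^sup>2 = (\<Sum>v\<in>{0, i}. (x v)\<^sup>2)" using i by auto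
        also have "\<dots> \<le> ?S" using i by (intro sum_mono2) auto
        finally show ?thesis .
      qed
      have s1: "(x 0 + x i)\<^sup>2 \<le> 2 * ?S"
        using square_sum_le[of "x 0" "x i"] two by linarith
      have s2: "(x 0)\<^sup>2 \<le> 2 * ?S"
        using two zero_le_power2[of "x i"] zero_le_power2[of "x 0"] by linarith
      have e: "exp (b * y) \<le> exp (2 * b * ?S)" if "y \<le> 2 * ?S" for y
        using mult_left_mono[OF that, of b] b by (simp add: mult_ac)
      have "\<bar>factor p \<gamma> x i\<bar> \<le> \<bar>A (p i) (x 0 + x i)\<bar> + \<bar>\<gamma> i\<bar> * \<bar>W (p i) (x 0)\<bar>"
        unfolding factor_def abs_mult [symmetric] by (rule abs_triangle_ineq4)
      also have "\<dots> \<le> C1 * exp (b * (x 0 + x i)\<^sup>2) + \<bar>\<gamma> i\<bar> * (C2 * exp (b * (x 0)\<^sup>2))"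
        by (intro add_mono C1 mult_left_mono C2) auto
      also have "\<dots> \<le> C1 * exp (2 * b * ?S) + \<bar>\<gamma> i\<bar> * (C2 * exp (2 * b * ?S))"
        using C0 by (intro add_mono mult_left_mono e s1 s2) auto
      finally show ?thesis by (simp add: algebra_simps)
    qed
    then show ?thesis by blast
  qed
  then have "\<forall>i\<in>{1..n}. \<exists>C. \<forall>x. \<bar>factor p \<gamma> x i\<bar> \<le> C * exp (2 * b * (\<Sum>v\<in>{0..n}. (x v)\<^sup>2))"
    by blast
  then obtain C where "\<forall>i\<in>{1..n}. \<forall>x. \<bar>factor p \<gamma> x i\<bar> \<le> C i * exp (2 * b * (\<Sum>v\<in>{0..n}. (x v)\<^sup>2))"
    by (rule bchoice [THEN exE])
  then have C: "\<bar>factor p \<gamma> x i\<bar> \<le> C i * exp (2 * b * (\<Sum>v\<in>{0..n}. (x v)\<^sup>2))" if "i \<in> {1..n}" for i x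
    using that by blast
  have "\<bar>Pr n p \<gamma> x\<bar> \<le> (\<Prod>i\<in>{1..n}. \<bar>C i\<bar>) * exp (a * (\<Sum>v\<in>{0..n}. (x v)\<^sup>2))" for x
  proof -
    let ?S = "\<Sum>v\<in>{0..n}. (x v)\<^sup>2"
    have S0: "?S \<ge> 0" by (intro sum_nonneg) auto
    have "\<bar>Pr n p \<gamma> x\<bar> = (\<Prod>i\<in>{1..n}. \<bar>factor p \<gamma> x i\<bar>)"
      unfolding Pr_def by (rule abs_prod)
    also have "\<dots> \<le> (\<Prod>i\<in>{1..n}. \<bar>C i\<bar> * exp (2 * b * ?S))"
    proof (intro prod_mono conjI)
      fix i assume "i \<in> {1..n}"
      from C[OF this, of x] show "\<bar>factor p \<gamma> x i\<bar> \<le> \<bar>C i\<bar> * exp (2 * b * ?S)"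
        by (rule order_trans) (auto intro!: mult_right_mono)
    qed auto
    also have "\<dots> = (\<Prod>i\<in>{1..n}. \<bar>C i\<bar>) * exp (real n * (2 * b * ?S))"
      by (simp add: prod.distrib exp_of_nat_mult)
    also have "\<dots> \<le> (\<Prod>i\<in>{1..n}. \<bar>C i\<bar>) * exp (a * ?S)"
    proof (intro mult_left_mono)
      have "real n * (2 * b) \<le> a"
        using a by (simp add: b_def field_simps)
      then have "real n * (2 * b) * ?S \<le> a * ?S" using S0 by (rule mult_right_mono)
      then show "exp (real n * (2 * b * ?S)) \<le> exp (a * ?S)" by (simp add: mult.assoc)
    qed (auto intro: prod_nonneg)
    finally show ?thesis .
  qed
  then show "\<exists>C. \<forall>x. \<bar>Pr n p \<gamma> x\<bar> \<le> C * exp (a * (\<Sum>v\<in>{0..n}. (x v)\<^sup>2))" by blast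
qed

lemma Pr1_moderate: "moderate n (Pr1 n p \<gamma> v)"
  unfolding Pr1_def [abs_def] by (cases "v = 0") (auto intro!: moderate_sum Pr_moderate)

lemma Pr2_moderate: "moderate n (Pr2 n p \<gamma> v u)"
  unfolding Pr2_def [abs_def] by (cases "v = 0") (auto intro!: moderate_sum Pr1_moderate)

end

section \<open>Averages over independent replicas\<close>

locale replica_average =
  fixes S :: "'s set" and w :: "'s \<Rightarrow> real" and n :: nat
  assumes finite_S: "finite S" and w_nonneg: "\<And>\<sigma>. \<sigma> \<in> S \<Longrightarrow> 0 \<le> w \<sigma>" and sum_w: "(\<Sum>\<sigma>\<in>S. w \<sigma>) = 1"
begin

definition R where "R = {1..n} \<rightarrow>\<^sub>E S"

definition rav where "rav f = (\<Sum>s\<in>R. (\<Prod>a\<in>{1..n}. w (s a)) * f s)" for f :: "(nat \<Rightarrow> 's) \<Rightarrow> real"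

lemma R_mem: "s \<in> R \<Longrightarrow> a \<in> {1..n} \<Longrightarrow> s a \<in> S"
  unfolding R_def by (rule PiE_mem)

lemma weight_product_nonneg: "s \<in> R \<Longrightarrow> 0 \<le> (\<Prod>a\<in>{1..n}. w (s a))"
  by (intro prod_nonneg ballI w_nonneg R_mem)

lemma rav_prod: "(\<Sum>\<sigma>\<in>S. w \<sigma> * f \<sigma>) ^ n = rav (\<lambda>s. \<Prod>a\<in>{1..n}. f (s a))"
proof -
  have "(\<Prod>a\<in>{1..n}. \<Sum>\<sigma>\<in>S. w \<sigma> * f \<sigma>) = (\<Sum>s\<in>R. \<Prod>a\<in>{1..n}. w (s a) * f (s a))"
    unfolding R_def using finite_S by (intro prod_sum_PiE) auto
  then show ?thesis by (simp add: rav_def prod.distrib)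
qed

lemma rav_1: "rav (\<lambda>_. 1) = 1"
  using rav_prod[of "\<lambda>_. 1"] sum_w by simp

lemma rav_const: "rav (\<lambda>_. c) = c"
  using rav_1 by (simp add: rav_def sum_distrib_right [symmetric])

lemma rav_mono: "(\<And>s. s \<in> R \<Longrightarrow> f s \<le> g s) \<Longrightarrow> rav f \<le> rav g"
  unfolding rav_def by (intro sum_mono mult_left_mono weight_product_nonneg)

lemma rav_cong: "(\<And>s. s \<in> R \<Longrightarrow> f s = g s) \<Longrightarrow> rav f = rav g"
  unfolding rav_def by (intro sum.cong) auto

lemma rav_add: "rav (\<lambda>s. f s + g s) = rav f + rav g"
  by (simp add: rav_def distrib_left sum.distrib)

lemma rav_cmult: "rav (\<lambda>s. c * f s) = c * rav f" "rav (\<lambda>s. f s * c) = rav f * c"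
  by (simp_all add: rav_def sum_distrib_left sum_distrib_right mult_ac)

lemma rav_sum: "rav (\<lambda>s. \<Sum>j\<in>J. f j s) = (\<Sum>j\<in>J. rav (f j))"
  unfolding rav_def by (simp add: sum_distrib_left) (rule sum.swap)

lemma abs_rav_le: "\<bar>rav f\<bar> \<le> rav (\<lambda>s. \<bar>f s\<bar>)"
  unfolding rav_def using weight_product_nonneg
  by (intro order_trans[OF sum_abs] sum_mono) (simp add: abs_mult)

text \<open>Replica \<open>a\<close> may be replaced by a fresh independent sample.\<close>

lemma rav_resample:
  assumes a: "a \<in> {1..n}"
  shows "rav f = rav (\<lambda>s. \<Sum>\<sigma>\<in>S. w \<sigma> * f (s(a := \<sigma>)))"
proof -
  define J where "J = {1..n} - {a}"
  have J: "{1..n} = insert a J" "a \<notin> J" "finite J" using a by (auto simp: J_def)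
  have split: "rav f = (\<Sum>\<sigma>\<in>S. \<Sum>s\<in>J \<rightarrow>\<^sub>E S. w \<sigma> * (\<Prod>b\<in>J. w (s b)) * f (s(a := \<sigma>)))" for f
  proof -
    have R: "R = (\<lambda>(\<sigma>, s). s(a := \<sigma>)) ` (S \<times> (J \<rightarrow>\<^sub>E S))"
      unfolding R_def J(1) by (rule PiE_insert_eq)
    have inj: "inj_on (\<lambda>(\<sigma>, s). s(a := \<sigma>)) (S \<times> (J \<rightarrow>\<^sub>E S))"
      using J(2) by (rule inj_combinator)
    have "rav f = (\<Sum>(\<sigma>, s)\<in>S \<times> (J \<rightarrow>\<^sub>E S). (\<Prod>b\<in>{1..n}. w ((s(a := \<sigma>)) b)) * f (s(a := \<sigma>)))"
      unfolding rav_def R by (subst sum.reindex[OF inj]) (simp add: split_def)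
    also have "\<dots> = (\<Sum>(\<sigma>, s)\<in>S \<times> (J \<rightarrow>\<^sub>E S). w \<sigma> * (\<Prod>b\<in>J. w (s b)) * f (s(a := \<sigma>)))"
    proof (intro sum.cong refl, clarify)
      fix \<sigma> s
      have "(\<Prod>b\<in>J. w ((s(a := \<sigma>)) b)) = (\<Prod>b\<in>J. w (s b))"
        using J(2) by (intro prod.cong) auto
      then show "(\<Prod>b\<in>{1..n}. w ((s(a := \<sigma>)) b)) * f (s(a := \<sigma>)) = w \<sigma> * (\<Prod>b\<in>J. w (s b)) * f (s(a := \<sigma>))"
        unfolding J(1) using J by simp
    qed
    finally show ?thesis by (simp add: sum.cartesian_product)
  qed
  have "rav (\<lambda>s. \<Sum>\<sigma>\<in>S. w \<sigma> * f (s(a := \<sigma>)))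
      = (\<Sum>\<tau>\<in>S. w \<tau> * (\<Sum>s\<in>J \<rightarrow>\<^sub>E S. (\<Prod>b\<in>J. w (s b)) * (\<Sum>\<sigma>\<in>S. w \<sigma> * f (s(a := \<sigma>)))))"
    unfolding split by (simp add: sum_distrib_left mult.assoc)
  also have "\<dots> = (\<Sum>s\<in>J \<rightarrow>\<^sub>E S. (\<Prod>b\<in>J. w (s b)) * (\<Sum>\<sigma>\<in>S. w \<sigma> * f (s(a := \<sigma>))))"
    unfolding sum_distrib_right [symmetric] sum_w by simp
  also have "\<dots> = (\<Sum>s\<in>J \<rightarrow>\<^sub>E S. \<Sum>\<sigma>\<in>S. w \<sigma> * (\<Prod>b\<in>J. w (s b)) * f (s(a := \<sigma>)))"
    by (simp add: sum_distrib_left mult_ac)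
  also have "\<dots> = rav f"
    unfolding split by (rule sum.swap)
  finally show ?thesis ..
qed

lemma rav_single:
  assumes "a \<in> {1..n}"
  shows "rav (\<lambda>s. f (s a)) = (\<Sum>\<sigma>\<in>S. w \<sigma> * f \<sigma>)"
  by (subst rav_resample[OF assms]) (simp add: rav_const)

lemma rav_pair:
  assumes "a \<in> {1..n}" "b \<in> {1..n}" "a \<noteq> b"
  shows "rav (\<lambda>s. f (s a) (s b)) = (\<Sum>\<sigma>\<in>S. w \<sigma> * (\<Sum>\<tau>\<in>S. w \<tau> * f \<sigma> \<tau>))"
proof -
  have "rav (\<lambda>s. f (s a) (s b)) = rav (\<lambda>s. \<Sum>\<tau>\<in>S. w \<tau> * f (s a) \<tau>)"
    using assms(3) by (subst rav_resample[OF assms(2)]) simp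
  also have "\<dots> = (\<Sum>\<sigma>\<in>S. w \<sigma> * (\<Sum>\<tau>\<in>S. w \<tau> * f \<sigma> \<tau>))"
    by (rule rav_single[OF assms(1)])
  finally show ?thesis .
qed

text \<open>Jensen's inequality for an even power.\<close>

lemma power_mean:
  assumes "even m"
  shows "\<bar>\<Sum>\<sigma>\<in>S. w \<sigma> * f \<sigma>\<bar> ^ m \<le> (\<Sum>\<sigma>\<in>S. w \<sigma> * \<bar>f \<sigma>\<bar> ^ m)"
proof -
  have "S \<noteq> {}" using sum_w by auto
  then have "(\<Sum>\<sigma>\<in>S. w \<sigma> *\<^sub>R f \<sigma>) ^ m \<le> (\<Sum>\<sigma>\<in>S. w \<sigma> * f \<sigma> ^ m)"
    using convex_on_sum[OF finite_S _ convex_power_even[OF assms] sum_w, of f] w_nonneg by simp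
  then show ?thesis
    using assms by (simp add: power_even_abs)
qed

end

section \<open>The interpolation between cavity fields and independent Gaussians\<close>

locale cavity = smoothed_family A \<rho> + replica_average "spins N" w n
  for A :: "nat \<Rightarrow> real \<Rightarrow> real" and \<rho> :: real and N :: nat and w :: "(nat \<Rightarrow> real) \<Rightarrow> real" and n :: nat +
  fixes q C :: real
  assumes N: "1 \<le> N" and n: "1 \<le> n" "even n" and \<rho>_square: "\<rho>\<^sup>2 = 1 - q"
    and A_bound: "\<And>p x. p \<le> 2 * n \<Longrightarrow> \<bar>A p x\<bar> \<le> C * exp (1 / (64 * (real n + 1)) * x\<^sup>2)"
begin

definition unit_spin where "unit_spin \<sigma> j = \<sigma> j / sqrt (real N)" for \<sigma> :: "nat \<Rightarrow> real" and j :: nat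
definition mean where "mean j = (\<Sum>\<sigma>\<in>spins N. w \<sigma> * unit_spin \<sigma> j)" for j
definition dev where "dev \<sigma> j = unit_spin \<sigma> j - mean j" for \<sigma> j

text \<open>The covariance discrepancies: for \<open>b \<noteq> 0\<close>, the covariance of the centred fields of the replicas \<open>a\<close> and
  \<open>b\<close> minus that of independent Gaussians of variance \<open>\<rho>\<^sup>2\<close>; for \<open>b = 0\<close>, the covariance
  of the centred field of replica \<open>a\<close> with the common field \<open>r\<close>.\<close>

definition cov where "cov s a b =
    (if b = 0 then (\<Sum>j\<in>{1..N}. dev (s a) j * mean j)
     else (\<Sum>j\<in>{1..N}. dev (s a) j * dev (s b) j) - (if a = b then \<rho>\<^sup>2 else 0))"
  for s :: "nat \<Rightarrow> nat \<Rightarrow> real" and a b :: nat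

definition I where "I = {1..N + n}"

text \<open>The coordinates \<open>i \<le> N\<close> carry the Gaussians \<open>g\<close> of the cavity field, and \<open>N + a\<close> carries the auxiliary
  Gaussian of replica \<open>a\<close>. At \<open>t = 0\<close> the centred field of replica \<open>a\<close> is this auxiliary Gaussian
  times \<open>\<rho>\<close>, and at \<open>t = \<pi>/2\<close> it is the true one.\<close>

definition coef where "coef s v i t =
    (if i \<le> N then (if v = 0 then mean i else sin t * dev (s v) i)
     else if v \<noteq> 0 \<and> i = N + v then cos t * \<rho> else 0)"
  for s :: "nat \<Rightarrow> nat \<Rightarrow> real" and v i :: nat and t :: real

definition coef' where "coef' s v i t =
    (if i \<le> N then (if v = 0 then 0 else cos t * dev (s v) i)
     else if v \<noteq> 0 \<and> i = N + v then - sin t * \<rho> else 0)"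
  for s :: "nat \<Rightarrow> nat \<Rightarrow> real" and v i :: nat and t :: real

definition X where "X s t g = (\<lambda>v. \<Sum>i\<in>I. coef s v i t * g i)"
  for s :: "nat \<Rightarrow> nat \<Rightarrow> real" and t :: real and g :: "nat \<Rightarrow> real"

definition EP where "EP p \<gamma> s t = (LINT g|gaussian_coords I. Pr n p \<gamma> (X s t g))"

lemma finite_I: "finite I" by (simp add: I_def)

lemma sum_I: "(\<Sum>i\<in>I. f i) = (\<Sum>i\<in>{1..N}. f i) + (\<Sum>a\<in>{1..n}. f (N + a) :: real)"
proof -
  have "I = {1..N} \<union> (+) N ` {1..n}"
    unfolding I_def by (auto simp: image_iff intro!: exI[of _ "_ - N"] bexI[of _ "_ - N"])
  moreover have "(\<Sum>i\<in>{1..N} \<union> (+) N ` {1..n}. f i) = (\<Sum>i\<in>{1..N}. f i) + (\<Sum>i\<in>(+) N ` {1..n}. f i)"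
    by (rule sum.union_disjoint) auto
  moreover have "(\<Sum>i\<in>(+) N ` {1..n}. f i) = (\<Sum>a\<in>{1..n}. f (N + a))"
    by (subst sum.reindex) auto
  ultimately show ?thesis by simp
qed

lemma inverse_sqrt_N_le: "1 / sqrt (real N) \<le> 1"
  using N by auto

lemma abs_unit_spin: "\<sigma> \<in> spins N \<Longrightarrow> j \<in> {1..N} \<Longrightarrow> \<bar>unit_spin \<sigma> j\<bar> = 1 / sqrt (real N)"
  using abs_spin[of \<sigma> N j] by (simp add: unit_spin_def)

lemma abs_mean:
  assumes j: "j \<in> {1..N}"
  shows "\<bar>mean j\<bar> \<le> 1 / sqrt (real N)"
proof -
  have "\<bar>mean j\<bar> \<le> (\<Sum>\<sigma>\<in>spins N. w \<sigma> * (1 / sqrt (real N)))"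
    unfolding mean_def
  proof (intro order_trans[OF sum_abs] sum_mono)
    fix \<sigma> assume \<sigma>: "\<sigma> \<in> spins N"
    show "\<bar>w \<sigma> * unit_spin \<sigma> j\<bar> \<le> w \<sigma> * (1 / sqrt (real N))"
      unfolding abs_mult abs_unit_spin[OF \<sigma> j] using w_nonneg[OF \<sigma>] by simp
  qed
  also have "\<dots> = 1 / sqrt (real N)"
    unfolding sum_distrib_right [symmetric] sum_w by simp
  finally show ?thesis .
qed

lemma abs_dev: "\<sigma> \<in> spins N \<Longrightarrow> j \<in> {1..N} \<Longrightarrow> \<bar>dev \<sigma> j\<bar> \<le> 2 * (1 / sqrt (real N))"
  using abs_unit_spin[of \<sigma> j] abs_mean[of j] unfolding dev_def by linarith

lemma coef_bounds:
  assumes s: "s \<in> R" and v: "v \<in> {0..n}" and i: "i \<in> I"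
  shows "\<bar>coef s v i t\<bar> \<le> 2" "\<bar>coef' s v i t\<bar> \<le> 2"
proof -
  have *: "\<bar>x * y\<bar> \<le> 2" if "\<bar>x\<bar> \<le> 1" "\<bar>y\<bar> \<le> 2" for x y :: real
    using mult_mono[OF that] by (simp add: abs_mult)
  have d: "\<bar>dev (s v) i\<bar> \<le> 2" if "i \<le> N" "v \<noteq> 0"
  proof -
    have "\<bar>dev (s v) i\<bar> \<le> 2 * (1 / sqrt (real N))"
      using that s v i by (intro abs_dev R_mem) (auto simp: I_def)
    then show ?thesis using inverse_sqrt_N_le by linarith
  qed
  have m: "\<bar>mean i\<bar> \<le> 2" if "i \<le> N"
  proof -
    have "\<bar>mean i\<bar> \<le> 1 / sqrt (real N)"
      using that i by (intro abs_mean) (auto simp: I_def)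
    then show ?thesis using inverse_sqrt_N_le by linarith
  qed
  have r: "\<bar>\<rho>\<bar> \<le> 2" using \<rho> by auto
  show "\<bar>coef s v i t\<bar> \<le> 2"
    unfolding coef_def using d m r *[of "sin t"] *[of "cos t"] by auto
  show "\<bar>coef' s v i t\<bar> \<le> 2"
    unfolding coef'_def using d m r *[of "- sin t"] *[of "cos t"] by auto
qed

lemma coef_deriv: "(coef s v i has_real_derivative coef' s v i t) (at t)"
proof -
  have d: "((\<lambda>t. sin t * u) has_real_derivative cos t * u) (at t)"
    "((\<lambda>t. cos t * u) has_real_derivative - sin t * u) (at t)" for u :: real
    by (auto intro!: derivative_eq_intros)
  show ?thesis
    unfolding coef_def [abs_def] coef'_def using d by auto
qed

lemma kernel:
  assumes "v \<in> {0..n}" "u \<in> {0..n}"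
  shows "(\<Sum>i\<in>I. coef' s v i t * coef s u i t) =
    (if v = 0 then 0 else if u = 0 then cos t * cov s v 0 else sin t * cos t * cov s v u)"
proof (cases "v = 0")
  case True
  have "coef' s 0 i t = 0" for i by (auto simp: coef'_def)
  then show ?thesis using True by simp
next
  case False
  have 1: "(\<Sum>i\<in>{1..N}. coef' s v i t * coef s u i t) =
      (if u = 0 then cos t * (\<Sum>j\<in>{1..N}. dev (s v) j * mean j)
       else sin t * cos t * (\<Sum>j\<in>{1..N}. dev (s v) j * dev (s u) j))"
    using False by (auto simp: coef_def coef'_def sum_distrib_left mult_ac intro!: sum.cong)
  have "(\<Sum>a\<in>{1..n}. coef' s v (N + a) t * coef s u (N + a) t) =
      (\<Sum>a\<in>{1..n}. if a = v then (if u = v then - (sin t * cos t * \<rho>\<^sup>2) else 0) else 0)"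
    using False by (intro sum.cong) (auto simp: coef_def coef'_def power2_eq_square)
  also have "\<dots> = (if u = v then - (sin t * cos t * \<rho>\<^sup>2) else 0)"
    using False assms by (simp add: sum.delta')
  finally have 2: "(\<Sum>a\<in>{1..n}. coef' s v (N + a) t * coef s u (N + a) t) = \<dots>" .
  show ?thesis
    unfolding sum_I 1 2 cov_def using False by (auto simp: algebra_simps)
qed

text \<open>Each term consists of one covariance discrepancy and two further derivatives of the product. The
  common field does not move, so it is never the first of the two coordinates; a derivative in
  it spreads over the factors \<open>b\<close> without touching their centring.\<close>

lemma
  assumes s: "s \<in> R"
  shows Pr_integrable: "integrable (gaussian_coords I) (\<lambda>g. Pr n p \<gamma> (X s t g))"
    and EP_derivative: "(EP p \<gamma> s has_real_derivative
      (\<Sum>a\<in>{1..n}. \<Sum>b\<in>{1..n}. sin t * cos t * (cov s a b * EP (inc (inc p a) b) (\<gamma>(a := 0, b := 0)) s t)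
        + cos t * (cov s a 0 * EP (inc (inc p a) b) (\<gamma>(a := 0)) s t))) (at t)"
proof -
  have b0: "\<exists>C. \<forall>t x. \<bar>0::real\<bar> \<le> C * exp (a * (\<Sum>v\<in>{0..n}. (x v)\<^sup>2))" for a :: real
    by (intro exI[of _ 0]) auto
  have b1: "\<exists>C. \<forall>t x. \<bar>f x\<bar> \<le> C * exp (a * (\<Sum>v\<in>{0..n}. (x v)\<^sup>2))"
    if "moderate n f" "a > 0" for f and a :: real
    using that unfolding moderate_def by blast
  have b2: "\<exists>C. \<forall>x. \<bar>f x\<bar> \<le> C * exp (a * (\<Sum>v\<in>{0..n}. (x v)\<^sup>2))"
    if "moderate n f" "a > 0" for f and a :: real
    using that unfolding moderate_def by blast
  have d0: "((\<lambda>y. Pr n p \<gamma> (x y)) has_real_derivative 0 + (\<Sum>v\<in>{0..n}. Pr1 n p \<gamma> v (x t) * x' v)) (at t)"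
    if "\<And>v. v \<in> {0..n} \<Longrightarrow> ((\<lambda>y. x y v) has_real_derivative x' v) (at t)" for p \<gamma> x x' t
    using Pr_derivative[OF that] by simp
  note gi = gaussian_interpolation[of I "{0..n}" "coef s" "coef' s" 2 "\<lambda>_. Pr n p \<gamma>" "\<lambda>_ _. 0"
      "\<lambda>_. Pr1 n p \<gamma>" "\<lambda>_. Pr2 n p \<gamma>" for p \<gamma>, OF finite_I finite_atLeastAtMost coef_deriv
      coef_bounds(1)[OF s] coef_bounds(2)[OF s] d0 Pr1_derivative Pr2_continuous b1[OF Pr_moderate] b0
      b1[OF Pr1_moderate] b2[OF Pr2_moderate] Pr_measurable borel_measurable_const Pr1_measurable Pr2_measurable,
      folded X_def]
  have int: "integrable (gaussian_coords I) (\<lambda>g. Pr n p \<gamma> (X s t g))" for p \<gamma> t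
    by (rule gi(2); assumption)
  then show "integrable (gaussian_coords I) (\<lambda>g. Pr n p \<gamma> (X s t g))" .
  have "((\<lambda>t. LINT g|gaussian_coords I. Pr n p \<gamma> (X s t g)) has_real_derivative
      (LINT g|gaussian_coords I. 0) +
      (\<Sum>v\<in>{0..n}. \<Sum>u\<in>{0..n}. (\<Sum>i\<in>I. coef' s v i t * coef s u i t) *
        (LINT g|gaussian_coords I. Pr2 n p \<gamma> v u (X s t g)))) (at t)"
    by (rule gi(1); assumption)
  moreover have "(\<Sum>v\<in>{0..n}. \<Sum>u\<in>{0..n}. (\<Sum>i\<in>I. coef' s v i t * coef s u i t) *
        (LINT g|gaussian_coords I. Pr2 n p \<gamma> v u (X s t g))) =
    (\<Sum>a\<in>{1..n}. \<Sum>b\<in>{1..n}. sin t * cos t * (cov s a b * EP (inc (inc p a) b) (\<gamma>(a := 0, b := 0)) s t)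
        + cos t * (cov s a 0 * EP (inc (inc p a) b) (\<gamma>(a := 0)) s t))"
  proof -
    have ins: "{0..n} = insert 0 {1..n}" by auto
    have L: "(LINT g|gaussian_coords I. Pr2 n p \<gamma> a 0 (X s t g)) = (\<Sum>b\<in>{1..n}. EP (inc (inc p a) b) (\<gamma>(a := 0)) s t)"
      "\<And>b. b \<in> {1..n} \<Longrightarrow> (LINT g|gaussian_coords I. Pr2 n p \<gamma> a b (X s t g)) = EP (inc (inc p a) b) (\<gamma>(a := 0, b := 0)) s t"
      if "a \<in> {1..n}" for a
    proof -
      have a: "a \<noteq> 0" using that by simp
      show "(LINT g|gaussian_coords I. Pr2 n p \<gamma> a 0 (X s t g)) = (\<Sum>b\<in>{1..n}. EP (inc (inc p a) b) (\<gamma>(a := 0)) s t)"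
        unfolding Pr2_def if_not_P[OF a] Pr1_def if_P[OF refl] EP_def
        by (rule Bochner_Integration.integral_sum) (rule int)
      fix b assume "b \<in> {1..n}"
      then have b: "b \<noteq> 0" by simp
      show "(LINT g|gaussian_coords I. Pr2 n p \<gamma> a b (X s t g)) = EP (inc (inc p a) b) (\<gamma>(a := 0, b := 0)) s t"
        unfolding Pr2_def if_not_P[OF a] Pr1_def if_not_P[OF b] EP_def ..
    qed
    have z: "(\<Sum>u\<in>{0..n}. (\<Sum>i\<in>I. coef' s 0 i t * coef s u i t) * (LINT g|gaussian_coords I. Pr2 n p \<gamma> 0 u (X s t g))) = 0"
      using kernel[of 0 _ s t] by (intro sum.neutral) auto
    have row: "(\<Sum>u\<in>{0..n}. (\<Sum>i\<in>I. coef' s a i t * coef s u i t) * (LINT g|gaussian_coords I. Pr2 n p \<gamma> a u (X s t g)))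
      = (\<Sum>b\<in>{1..n}. sin t * cos t * (cov s a b * EP (inc (inc p a) b) (\<gamma>(a := 0, b := 0)) s t)
        + cos t * (cov s a 0 * EP (inc (inc p a) b) (\<gamma>(a := 0)) s t))" if a: "a \<in> {1..n}" for a
    proof -
      have "(\<Sum>u\<in>{0..n}. (\<Sum>i\<in>I. coef' s a i t * coef s u i t) * (LINT g|gaussian_coords I. Pr2 n p \<gamma> a u (X s t g)))
        = cos t * cov s a 0 * (\<Sum>b\<in>{1..n}. EP (inc (inc p a) b) (\<gamma>(a := 0)) s t)
          + (\<Sum>b\<in>{1..n}. (\<Sum>i\<in>I. coef' s a i t * coef s b i t) * (LINT g|gaussian_coords I. Pr2 n p \<gamma> a b (X s t g)))"
        unfolding ins using a kernel[of a 0 s t] by (simp add: L(1))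
      also have "(\<Sum>b\<in>{1..n}. (\<Sum>i\<in>I. coef' s a i t * coef s b i t) * (LINT g|gaussian_coords I. Pr2 n p \<gamma> a b (X s t g)))
        = (\<Sum>b\<in>{1..n}. sin t * cos t * (cov s a b * EP (inc (inc p a) b) (\<gamma>(a := 0, b := 0)) s t))"
      proof (intro sum.cong refl)
        fix b assume b: "b \<in> {1..n}"
        then show "(\<Sum>i\<in>I. coef' s a i t * coef s b i t) * (LINT g|gaussian_coords I. Pr2 n p \<gamma> a b (X s t g))
          = sin t * cos t * (cov s a b * EP (inc (inc p a) b) (\<gamma>(a := 0, b := 0)) s t)"
          using a kernel[of a b s t] L(2)[OF a b] by simp
      qed
      finally show ?thesis
        unfolding sum.distrib sum_distrib_left mult.assoc by (simp only: add.commute)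
    qed
    have "(\<Sum>v\<in>{0..n}. \<Sum>u\<in>{0..n}. (\<Sum>i\<in>I. coef' s v i t * coef s u i t) *
        (LINT g|gaussian_coords I. Pr2 n p \<gamma> v u (X s t g)))
      = (\<Sum>u\<in>{0..n}. (\<Sum>i\<in>I. coef' s 0 i t * coef s u i t) * (LINT g|gaussian_coords I. Pr2 n p \<gamma> 0 u (X s t g)))
        + (\<Sum>a\<in>{1..n}. \<Sum>u\<in>{0..n}. (\<Sum>i\<in>I. coef' s a i t * coef s u i t) *
        (LINT g|gaussian_coords I. Pr2 n p \<gamma> a u (X s t g)))"
      unfolding ins by (subst sum.insert) (auto simp del: sum.insert)
    also have "\<dots> = (\<Sum>a\<in>{1..n}. \<Sum>b\<in>{1..n}. sin t * cos t * (cov s a b * EP (inc (inc p a) b) (\<gamma>(a := 0, b := 0)) s t)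
        + cos t * (cov s a 0 * EP (inc (inc p a) b) (\<gamma>(a := 0)) s t))"
      unfolding z using row by (simp del: sum.insert)
    finally show ?thesis .
  qed
  ultimately show "(EP p \<gamma> s has_real_derivative
      (\<Sum>a\<in>{1..n}. \<Sum>b\<in>{1..n}. sin t * cos t * (cov s a b * EP (inc (inc p a) b) (\<gamma>(a := 0, b := 0)) s t)
        + cos t * (cov s a 0 * EP (inc (inc p a) b) (\<gamma>(a := 0)) s t))) (at t)"
    by (simp add: EP_def [abs_def])
qed

end

section \<open>Expansion of the cavity moment\<close>

lemma prod_list_le_of_powers:
  fixes T :: real
  assumes "\<And>x. x \<in> set xs \<Longrightarrow> 0 \<le> x \<and> x ^ length xs \<le> T" "xs \<noteq> []" "0 \<le> T"
  shows "prod_list xs \<le> T"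
proof -
  have "prod_list ys ^ n \<le> T ^ length ys" if "\<And>x. x \<in> set ys \<Longrightarrow> 0 \<le> x \<and> x ^ n \<le> T" for ys n
    using that
  proof (induction ys)
    case (Cons y ys)
    have y: "0 \<le> y" "y ^ n \<le> T" using Cons.prems by auto
    have "0 \<le> prod_list ys" using Cons.prems by (intro prod_list_nonneg) auto
    then have "y ^ n * prod_list ys ^ n \<le> T * T ^ length ys"
      using y assms(3) Cons by (intro mult_mono) auto
    then show ?case by (simp add: power_mult_distrib)
  qed simp
  from this[of xs "length xs"] assms(1) have "prod_list xs ^ length xs \<le> T ^ length xs" by blast
  then have "prod_list xs ^ Suc (length xs - 1) \<le> T ^ Suc (length xs - 1)"
    using assms(2) by simp
  then show ?thesis using assms(3) by (rule power_le_imp_le_base)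
qed

text \<open>A product of \<open>n\<close> numbers is controlled by their powers of order \<open>n\<close>; this replaces Hoelder's
  inequality.\<close>

lemma prod_le_of_powers:
  fixes T :: real
  assumes f: "\<And>a. a \<in> J \<Longrightarrow> 0 \<le> f a \<and> f a ^ card J \<le> T" and J: "finite J" "J \<noteq> {}" and T: "0 \<le> T"
  shows "(\<Prod>a\<in>J. f a) \<le> T"
proof -
  have "(\<Prod>a\<in>J. f a) ^ card J = (\<Prod>a\<in>J. f a ^ card J)"
    by (rule prod_power_distrib)
  also have "\<dots> \<le> (\<Prod>a\<in>J. T)"
    using f by (intro prod_mono) auto
  finally have "(\<Prod>a\<in>J. f a) ^ card J \<le> T ^ card J" by simp
  moreover have "card J = Suc (card J - 1)"
    using J by (simp add: card_gt_0_iff)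
  ultimately have "(\<Prod>a\<in>J. f a) ^ Suc (card J - 1) \<le> T ^ Suc (card J - 1)" by simp
  then show ?thesis using T by (rule power_le_imp_le_base)
qed

lemma abs_sum4_power_le:
  fixes a b c d :: real
  shows "\<bar>a + b + c + d\<bar> ^ n \<le> 4 ^ n * (\<bar>a\<bar> ^ n + \<bar>b\<bar> ^ n + \<bar>c\<bar> ^ n + \<bar>d\<bar> ^ n)"
proof -
  define M where "M = Max {\<bar>a\<bar>, \<bar>b\<bar>, \<bar>c\<bar>, \<bar>d\<bar>}"
  have M: "\<bar>a\<bar> \<le> M" "\<bar>b\<bar> \<le> M" "\<bar>c\<bar> \<le> M" "\<bar>d\<bar> \<le> M"
    unfolding M_def by (rule Max_ge; simp)+
  have "M \<in> {\<bar>a\<bar>, \<bar>b\<bar>, \<bar>c\<bar>, \<bar>d\<bar>}" unfolding M_def by (rule Max_in) auto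
  then have le: "M ^ n \<le> \<bar>a\<bar> ^ n + \<bar>b\<bar> ^ n + \<bar>c\<bar> ^ n + \<bar>d\<bar> ^ n"
    by (auto simp: add_nonneg_nonneg add.assoc add_increasing add_increasing2)
  have "\<bar>a + b + c + d\<bar> \<le> 4 * M" using M by linarith
  then have "\<bar>a + b + c + d\<bar> ^ n \<le> (4 * M) ^ n" by (intro power_mono) auto
  also have "\<dots> = 4 ^ n * M ^ n" by (rule power_mult_distrib)
  also have "\<dots> \<le> 4 ^ n * (\<bar>a\<bar> ^ n + \<bar>b\<bar> ^ n + \<bar>c\<bar> ^ n + \<bar>d\<bar> ^ n)"
    using le by (intro mult_left_mono) auto
  finally show ?thesis .
qed

lemma sum_count_list_le: "finite J \<Longrightarrow> (\<Sum>a\<in>J. count_list xs a) \<le> length xs"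
proof (induction xs)
  case (Cons x xs)
  have "(\<Sum>a\<in>J. count_list (x # xs) a) = (\<Sum>a\<in>J. (if x = a then 1 else 0) + count_list xs a)"
    by (intro sum.cong) auto
  also have "\<dots> = (\<Sum>a\<in>J. if x = a then 1 else 0) + (\<Sum>a\<in>J. count_list xs a)"
    by (rule sum.distrib)
  also have "(\<Sum>a\<in>J. if x = a then 1 else 0) \<le> (1::nat)"
    using Cons.prems by (simp add: sum.delta)
  finally show ?case using Cons by simp
qed simp

context cavity
begin

text \<open>A list \<open>L\<close> of pairs records which covariance discrepancies have been produced. It is a multigraph
  with loops on the replicas \<open>1, \<dots>, n\<close> and the additional vertex 0 for the common field. The degree
  of a replica counts loops twice, so that it is the number of derivatives taken in its
  coordinate, and \<open>Phi L p t\<close> is the term of the expansion that belongs to \<open>L\<close>.\<close>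

definition valid where "valid L \<longleftrightarrow> (\<forall>(a, b)\<in>set L. a \<in> {1..n} \<and> b \<in> {0..n})" for L :: "(nat \<times> nat) list"
definition deg where "deg L a = count_list (map fst L) a + count_list (map snd L) a" for L :: "(nat \<times> nat) list" and a :: nat
definition centring where "centring L a = (if deg L a = 0 then 1 else 0 :: real)" for L :: "(nat \<times> nat) list" and a :: nat
definition cov_product where "cov_product s L = prod_list (map (\<lambda>(a, b). cov s a b) L)" for s L
definition Phi where "Phi L p t = rav (\<lambda>s. cov_product s L * EP p (centring L) s t)" for L p t

lemma valid_Cons: "valid ((a, b) # L) \<longleftrightarrow> a \<in> {1..n} \<and> b \<in> {0..n} \<and> valid L"
  by (auto simp: valid_def)

lemma deg_Cons: "deg ((x, y) # L) a = (if x = a then 1 else 0) + (if y = a then 1 else 0) + deg L a"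
  by (simp add: deg_def)

lemma cov_product_Cons: "cov_product s ((a, b) # L) = cov s a b * cov_product s L"
  by (simp add: cov_product_def)

lemma centring_Cons: "centring ((x, y) # L) = (centring L)(x := 0, y := 0)"
  by (auto simp: centring_def deg_Cons fun_eq_iff)

lemma EP_cong: "(\<And>a. a \<in> {1..n} \<Longrightarrow> \<gamma> a = \<gamma>' a) \<Longrightarrow> EP p \<gamma> s t = EP p \<gamma>' s t"
  unfolding EP_def by (intro Bochner_Integration.integral_cong refl Pr_cong)

lemma Phi_derivative:
  "(Phi L p has_real_derivative (\<Sum>a\<in>{1..n}. \<Sum>b\<in>{1..n}.
      sin t * cos t * Phi ((a, b) # L) (inc (inc p a) b) t + cos t * Phi ((a, 0) # L) (inc (inc p a) b) t)) (at t)"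
proof -
  define D where "D s = (\<Sum>a\<in>{1..n}. \<Sum>b\<in>{1..n}. sin t * cos t * (cov s a b * EP (inc (inc p a) b) ((centring L)(a := 0, b := 0)) s t)
        + cos t * (cov s a 0 * EP (inc (inc p a) b) ((centring L)(a := 0)) s t))" for s
  have "(Phi L p has_real_derivative rav (\<lambda>s. cov_product s L * D s)) (at t)"
    unfolding Phi_def [abs_def] rav_def D_def by (intro DERIV_sum DERIV_cmult EP_derivative)
  also have "rav (\<lambda>s. cov_product s L * D s) = rav (\<lambda>s. \<Sum>a\<in>{1..n}. \<Sum>b\<in>{1..n}.
      sin t * cos t * (cov_product s ((a, b) # L) * EP (inc (inc p a) b) (centring ((a, b) # L)) s t)
      + cos t * (cov_product s ((a, 0) # L) * EP (inc (inc p a) b) (centring ((a, 0) # L)) s t))"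
  proof (rule rav_cong)
    fix s
    have g: "EP (inc (inc p a) b) (centring ((a, 0) # L)) s t = EP (inc (inc p a) b) ((centring L)(a := 0)) s t" for a b
      by (rule EP_cong) (auto simp: centring_Cons)
    show "cov_product s L * D s = (\<Sum>a\<in>{1..n}. \<Sum>b\<in>{1..n}.
      sin t * cos t * (cov_product s ((a, b) # L) * EP (inc (inc p a) b) (centring ((a, b) # L)) s t)
      + cos t * (cov_product s ((a, 0) # L) * EP (inc (inc p a) b) (centring ((a, 0) # L)) s t))"
      unfolding D_def g sum_distrib_left unfolding centring_Cons cov_product_Cons
      by (intro sum.cong refl) algebra
  qed
  also have "\<dots> = (\<Sum>a\<in>{1..n}. \<Sum>b\<in>{1..n}.
      sin t * cos t * Phi ((a, b) # L) (inc (inc p a) b) t + cos t * Phi ((a, 0) # L) (inc (inc p a) b) t)"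
    unfolding Phi_def rav_sum rav_add rav_cmult ..
  finally show ?thesis .
qed

subsection \<open>Vanishing of the low-order terms\<close>

text \<open>The fields at the start of the interpolation, where they do not depend on the replicas.\<close>

definition X0 where "X0 g v = (if v = 0 then \<Sum>j\<in>{1..N}. mean j * g j else \<rho> * g (N + v))" for g :: "nat \<Rightarrow> real" and v :: nat

lemma X_start:
  assumes "v \<in> {0..n}"
  shows "X s 0 g v = X0 g v"
proof (cases "v = 0")
  case True
  then show ?thesis unfolding X_def sum_I X0_def coef_def by simp
next
  case False
  have "(\<Sum>a\<in>{1..n}. coef s v (N + a) 0 * g (N + a)) = (\<Sum>a\<in>{1..n}. if a = v then \<rho> * g (N + v) else 0)"
    using False by (intro sum.cong) (auto simp: coef_def)
  also have "\<dots> = \<rho> * g (N + v)"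
    using False assms by (simp add: sum.delta')
  finally show ?thesis
    using False unfolding X_def sum_I X0_def by (simp add: coef_def)
qed

lemma Pr_cong_x: "(\<And>v. v \<in> {0..n} \<Longrightarrow> x v = x' v) \<Longrightarrow> Pr n p \<gamma> x = Pr n p \<gamma> x'"
  unfolding Pr_def factor_def by (intro prod.cong) auto

definition E0 where "E0 p \<gamma> = (LINT g|gaussian_coords I. Pr n p \<gamma> (X0 g))"

lemma Pr_start: "Pr n p \<gamma> (X s 0 g) = Pr n p \<gamma> (X0 g)"
  by (rule Pr_cong_x) (rule X_start)

lemma EP_start: "EP p \<gamma> s 0 = E0 p \<gamma>"
  unfolding EP_def E0_def Pr_start ..

lemma R_nonempty: "R \<noteq> {}"
proof
  assume "R = {}"
  then have "rav (\<lambda>_. 1) = 0" by (simp add: rav_def)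
  then show False using rav_1 by simp
qed

text \<open>Conditionally on all other coordinates, the undifferentiated factor \<open>a\<close> is the difference of
  \<open>A p (r + \<rho> z)\<close> and its mean over \<open>z\<close>.\<close>

lemma E0_vanishes:
  assumes a: "a \<in> {1..n}" and \<gamma>: "\<gamma> a = 1"
  shows "E0 p \<gamma> = 0"
proof -
  obtain s where s: "s \<in> R" using R_nonempty by auto
  define J where "J = I - {N + a}"
  have J: "I = insert (N + a) J" "N + a \<notin> J" "finite J"
    using a by (auto simp: J_def I_def)
  have "integrable (gaussian_coords I) (\<lambda>g. Pr n p \<gamma> (X0 g))"
    using Pr_integrable[OF s, of p \<gamma> 0] unfolding Pr_start .
  then have E0: "E0 p \<gamma> = (LINT g|gaussian_coords J. LINT y|std_gaussian. Pr n p \<gamma> (X0 (g(N + a := y))))"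
    unfolding E0_def J(1) by (rule integral_gaussian_coords_insert[OF J(3,2)])
  have inner: "(LINT y|std_gaussian. Pr n p \<gamma> (X0 (g(N + a := y)))) = 0" for g
  proof -
    define x where "x = X0 g 0"
    define Q where "Q = (\<Prod>b\<in>{1..n} - {a}. factor p \<gamma> (X0 g) b)"
    have "Pr n p \<gamma> (X0 (g(N + a := y))) = (A (p a) (x + \<rho> * y) - W (p a) x) * Q" for y
    proof -
      have x0: "X0 (g(N + a := y)) 0 = x"
        using a unfolding x_def X0_def by (auto intro!: sum.cong)
      have xa: "X0 (g(N + a := y)) a = \<rho> * y"
        using a by (simp add: X0_def)
      have xb: "X0 (g(N + a := y)) b = X0 g b" if "b \<in> {1..n} - {a}" for b
        using that by (auto simp: X0_def)
      have "(\<Prod>b\<in>{1..n} - {a}. factor p \<gamma> (X0 (g(N + a := y))) b) = Q"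
        unfolding Q_def factor_def using x0 xb by (intro prod.cong) (auto simp: x_def)
      moreover have "factor p \<gamma> (X0 (g(N + a := y))) a = A (p a) (x + \<rho> * y) - W (p a) x"
        unfolding factor_def x0 xa \<gamma> by simp
      ultimately show ?thesis
        unfolding Pr_def using a by (subst prod.remove[of _ a]) auto
    qed
    moreover have "(LINT y|std_gaussian. (A (p a) (x + \<rho> * y) - W (p a) x) * Q) = (W (p a) x - W (p a) x) * Q"
      using A_shift_integrable[of "p a" x] gauss1.prob_space
      by (simp add: W_def [of "p a" x, symmetric])
    ultimately show ?thesis by (simp only:) simp
  qed
  show ?thesis
    unfolding E0 inner by simp
qed

lemma sum_dev: "(\<Sum>\<sigma>\<in>spins N. w \<sigma> * dev \<sigma> j) = 0"
  unfolding dev_def using sum_w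
  by (simp add: right_diff_distrib sum_subtractf mean_def sum_distrib_right [symmetric])

lemma sum_dev_linear: "(\<Sum>\<sigma>\<in>spins N. w \<sigma> * (\<Sum>j\<in>{1..N}. dev \<sigma> j * z j)) = 0"
proof -
  have "(\<Sum>\<sigma>\<in>spins N. w \<sigma> * (\<Sum>j\<in>{1..N}. dev \<sigma> j * z j))
      = (\<Sum>j\<in>{1..N}. (\<Sum>\<sigma>\<in>spins N. w \<sigma> * dev \<sigma> j) * z j)"
    unfolding sum_distrib_left sum_distrib_right by (subst sum.swap) (simp add: mult.assoc)
  then show ?thesis by (simp add: sum_dev)
qed

lemma cov_update: "a \<noteq> 0 \<Longrightarrow> x \<noteq> a \<Longrightarrow> y \<noteq> a \<Longrightarrow> cov (s(a := \<sigma>)) x y = cov s x y"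
  by (simp add: cov_def)

lemma cov_product_update: "a \<noteq> 0 \<Longrightarrow> deg L a = 0 \<Longrightarrow> cov_product (s(a := \<sigma>)) L = cov_product s L"
proof (induction L)
  case (Cons e L)
  obtain x y where e: "e = (x, y)" by fastforce
  have xy: "x \<noteq> a" "y \<noteq> a" "deg L a = 0"
    using Cons.prems unfolding e deg_Cons by (auto split: if_splits)
  show ?case
    unfolding e cov_product_Cons cov_update[OF Cons.prems(1) xy(1,2)] Cons.IH[OF Cons.prems(1) xy(3)] ..
qed (simp add: cov_product_def)

text \<open>Exactly one entry of \<open>L\<close> contains \<open>a\<close>, and it is not a loop, so the product is linear in the
  centred spin vector of replica \<open>a\<close>.\<close>

lemma cov_product_centred:
  assumes a: "a \<in> {1..n}"
  shows "deg L a = 1 \<Longrightarrow> (\<Sum>\<sigma>\<in>spins N. w \<sigma> * cov_product (s(a := \<sigma>)) L) = 0"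
proof (induction L)
  case Nil
  then show ?case by (simp add: deg_def)
next
  case (Cons e L)
  obtain x y where e: "e = (x, y)" by fastforce
  have a0: "a \<noteq> 0" using a by simp
  consider "x = a" "y \<noteq> a" "deg L a = 0" | "x \<noteq> a" "y = a" "deg L a = 0" | "x \<noteq> a" "y \<noteq> a" "deg L a = 1"
    using Cons.prems unfolding e deg_Cons by (auto split: if_splits)
  then show ?case
  proof cases
    case 1
    define z where "z j = (if y = 0 then mean j else dev (s y) j)" for j
    have "cov (s(a := \<sigma>)) x y = (\<Sum>j\<in>{1..N}. dev \<sigma> j * z j)" for \<sigma>
      using 1 a0 by (auto simp: cov_def z_def intro!: sum.cong)
    then have "(\<Sum>\<sigma>\<in>spins N. w \<sigma> * cov_product (s(a := \<sigma>)) (e # L)) = (\<Sum>\<sigma>\<in>spins N. w \<sigma> * (\<Sum>j\<in>{1..N}. dev \<sigma> j * z j)) * cov_product s L"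
      unfolding e cov_product_Cons cov_product_update[OF a0 1(3)] by (simp add: sum_distrib_right mult.assoc)
    then show ?thesis unfolding sum_dev_linear mult_zero_left .
  next
    case 2
    have "cov (s(a := \<sigma>)) x y = (\<Sum>j\<in>{1..N}. dev \<sigma> j * dev (s x) j)" for \<sigma>
      using 2 a0 by (auto simp: cov_def mult.commute intro!: sum.cong)
    then have "(\<Sum>\<sigma>\<in>spins N. w \<sigma> * cov_product (s(a := \<sigma>)) (e # L)) = (\<Sum>\<sigma>\<in>spins N. w \<sigma> * (\<Sum>j\<in>{1..N}. dev \<sigma> j * dev (s x) j)) * cov_product s L"
      unfolding e cov_product_Cons cov_product_update[OF a0 2(3)] by (simp add: sum_distrib_right mult.assoc)
    then show ?thesis unfolding sum_dev_linear mult_zero_left .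
  next
    case 3
    have "(\<Sum>\<sigma>\<in>spins N. w \<sigma> * cov_product (s(a := \<sigma>)) (e # L)) = cov s x y * (\<Sum>\<sigma>\<in>spins N. w \<sigma> * cov_product (s(a := \<sigma>)) L)"
      unfolding e cov_product_Cons cov_update[OF a0 3(1,2)] by (simp add: sum_distrib_left mult_ac)
    then show ?thesis unfolding Cons.IH[OF 3(3)] mult_zero_right .
  qed
qed

text \<open>The degrees add up to at most twice the number of edges.\<close>

lemma exists_low_degree:
  assumes "length L < n"
  shows "\<exists>a\<in>{1..n}. deg L a \<le> 1"
proof (rule ccontr)
  assume H: "\<not> ?thesis"
  have "2 \<le> deg L a" if "a \<in> {1..n}" for a
  proof -
    have "\<not> deg L a \<le> 1" using H that by blast
    then show ?thesis by simp
  qed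
  then have "(\<Sum>a\<in>{1..n}. 2) \<le> (\<Sum>a\<in>{1..n}. deg L a)"
    by (rule sum_mono)
  also have "\<dots> = (\<Sum>a\<in>{1..n}. count_list (map fst L) a) + (\<Sum>a\<in>{1..n}. count_list (map snd L) a)"
    unfolding deg_def by (rule sum.distrib)
  also have "\<dots> \<le> length L + length L"
    using sum_count_list_le[of "{1..n}" "map fst L"] sum_count_list_le[of "{1..n}" "map snd L"] by simp
  finally show False using assms by simp
qed

text \<open>At \<open>t = 0\<close> the average over replicas and the Gaussian expectation factorize. A replica of degree 0
  kills the second factor, one of degree 1 the first.\<close>

lemma Phi_start:
  assumes "length L < n"
  shows "Phi L p 0 = 0"
proof -
  obtain a where a: "a \<in> {1..n}" "deg L a \<le> 1" using exists_low_degree[OF assms] by auto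
  have Phi: "Phi L p 0 = rav (\<lambda>s. cov_product s L) * E0 p (centring L)"
    unfolding Phi_def EP_start rav_cmult ..
  show ?thesis
  proof (cases "deg L a = 0")
    case True
    then show ?thesis unfolding Phi using E0_vanishes[OF a(1)] by (simp add: centring_def)
  next
    case False
    then have "deg L a = 1" using a by simp
    then have "rav (\<lambda>s. cov_product s L) = 0"
      by (subst rav_resample[OF a(1)]) (simp add: cov_product_centred[OF a(1)] rav_const)
    then show ?thesis unfolding Phi by simp
  qed
qed

subsection \<open>Bounds on the terms of full order\<close>

lemma C_nonneg: "C \<ge> 0"
  using A_bound[of 0 0] by simp

lemma coef_square_sums:
  assumes "s \<in> R" "v \<in> {1..n}"
  shows "(\<Sum>i\<in>I. (coef s 0 i t)\<^sup>2) \<le> 1" "(\<Sum>i\<in>I. (coef s v i t)\<^sup>2) \<le> 4"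
proof -
  have sq: "(1 / sqrt (real N))\<^sup>2 = 1 / real N" using N by (simp add: power_divide)
  have "(\<Sum>j\<in>{1..N}. (coef s 0 j t)\<^sup>2) \<le> (\<Sum>j\<in>{1..N}. 1 / real N)"
  proof (rule sum_mono)
    fix j assume "j \<in> {1..N}"
    then show "(coef s 0 j t)\<^sup>2 \<le> 1 / real N"
      unfolding sq [symmetric] using abs_mean[of j]
      by (intro abs_le_square_iff[THEN iffD1]) (auto simp: coef_def)
  qed
  moreover have "(\<Sum>a\<in>{1..n}. (coef s 0 (N + a) t)\<^sup>2) = 0"
    by (intro sum.neutral) (auto simp: coef_def)
  ultimately show "(\<Sum>i\<in>I. (coef s 0 i t)\<^sup>2) \<le> 1"
    unfolding sum_I using N by simp
  have "(\<Sum>j\<in>{1..N}. (coef s v j t)\<^sup>2) \<le> (\<Sum>j\<in>{1..N}. (sin t)\<^sup>2 * (4 / real N))"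
  proof (rule sum_mono)
    fix j assume j: "j \<in> {1..N}"
    have "\<bar>dev (s v) j\<bar> \<le> \<bar>2 * (1 / sqrt (real N))\<bar>"
      using abs_dev[OF R_mem[OF assms] j] by simp
    then have "(dev (s v) j)\<^sup>2 \<le> (2 * (1 / sqrt (real N)))\<^sup>2"
      by (rule abs_le_square_iff[THEN iffD1])
    then have "(dev (s v) j)\<^sup>2 \<le> 4 / real N"
      unfolding power_mult_distrib sq by simp
    then have "(sin t)\<^sup>2 * (dev (s v) j)\<^sup>2 \<le> (sin t)\<^sup>2 * (4 / real N)"
      by (intro mult_left_mono) auto
    then show "(coef s v j t)\<^sup>2 \<le> (sin t)\<^sup>2 * (4 / real N)"
      using assms j by (simp add: coef_def power_mult_distrib)
  qed
  also have "\<dots> = 4 * (sin t)\<^sup>2" using N by simp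
  finally have 1: "(\<Sum>j\<in>{1..N}. (coef s v j t)\<^sup>2) \<le> 4 * (sin t)\<^sup>2" .
  have "(\<Sum>a\<in>{1..n}. (coef s v (N + a) t)\<^sup>2) = (\<Sum>a\<in>{1..n}. if a = v then (cos t)\<^sup>2 * \<rho>\<^sup>2 else 0)"
    using assms by (intro sum.cong) (auto simp: coef_def power_mult_distrib)
  also have "\<dots> = (cos t)\<^sup>2 * \<rho>\<^sup>2" using assms by (simp add: sum.delta')
  also have "\<dots> \<le> (cos t)\<^sup>2 * 1"
    using \<rho> by (intro mult_left_mono) (auto simp: power_le_one)
  finally have "(\<Sum>a\<in>{1..n}. (coef s v (N + a) t)\<^sup>2) \<le> (cos t)\<^sup>2" by simp
  then show "(\<Sum>i\<in>I. (coef s v i t)\<^sup>2) \<le> 4"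
    unfolding sum_I using 1 sin_cos_squared_add[of t] zero_le_power2[of "cos t"] by linarith
qed

text \<open>The fields \<open>x 0 + x a\<close> and \<open>x 0\<close> are linear forms in the Gaussians with bounded coefficient vectors,
  uniformly in \<open>N\<close>, so that a small multiple of their squares is exponentially integrable. A
  product of \<open>n\<close> factors multiplies the exponent by at most \<open>n\<close>, which the choice of \<open>\<epsilon>\<close> absorbs.\<close>

lemma EP_bound:
  assumes s: "s \<in> R" and p: "\<And>a. p a \<le> 2 * n" and \<gamma>: "\<And>a. 0 \<le> \<gamma> a" "\<And>a. \<gamma> a \<le> 1"
  shows "\<bar>EP p \<gamma> s t\<bar> \<le> (3 * C) ^ n * (2 * (real n + 1))"
proof -
  define \<epsilon> where "\<epsilon> = 1 / (64 * (real n + 1))"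
  have \<epsilon>: "0 < \<epsilon>" "8 * \<epsilon> \<le> 1" "real n * (2 * \<epsilon>) \<le> 1 / 32"
    by (auto simp: \<epsilon>_def field_simps)
  define cy where "cy v i = (if v = 0 then coef s 0 i t else coef s 0 i t + coef s v i t)" for v i
  define y where "y g v = (\<Sum>i\<in>I. cy v i * g i)" for g v
  define T where "T g = (\<Sum>v\<in>{0..n}. exp (1 / 32 * (y g v)\<^sup>2))" for g
  have y0: "y g 0 = X s t g 0" for g by (simp add: y_def cy_def X_def)
  have ya: "y g a = X s t g 0 + X s t g a" if "a \<in> {1..n}" for g a
    using that by (simp add: y_def cy_def X_def distrib_right sum.distrib)
  have T0: "0 \<le> T g" for g unfolding T_def by (intro sum_nonneg) auto
  have pw: "\<bar>Pr n p \<gamma> (X s t g)\<bar> \<le> (3 * C) ^ n * T g" for g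
  proof -
    define u where "u a = max (exp (2 * \<epsilon> * (y g a)\<^sup>2)) (exp (2 * \<epsilon> * (y g 0)\<^sup>2))" for a
    have "\<bar>factor p \<gamma> (X s t g) a\<bar> \<le> 3 * C * u a" if a: "a \<in> {1..n}" for a
    proof -
      have b: "\<bar>A (p a) z\<bar> \<le> C * exp (\<epsilon> * z\<^sup>2)" for z
        using A_bound[OF p] by (simp add: \<epsilon>_def)
      have "\<bar>A (p a) (y g a)\<bar> \<le> C * exp (\<epsilon> * (y g a)\<^sup>2)" by (rule b)
      also have "\<dots> \<le> C * u a"
        using C_nonneg \<epsilon> by (intro mult_left_mono) (auto simp: u_def le_max_iff_disj intro!: disjI1 mult_right_mono)
      finally have 1: "\<bar>A (p a) (y g a)\<bar> \<le> C * u a" .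
      have "\<bar>W (p a) (y g 0)\<bar> \<le> 2 * C * exp (2 * \<epsilon> * (y g 0)\<^sup>2)"
        using \<epsilon> b by (intro W_bound) auto
      also have "\<dots> \<le> 2 * C * u a"
        using C_nonneg by (intro mult_left_mono) (auto simp: u_def)
      finally have 2: "\<bar>W (p a) (y g 0)\<bar> \<le> 2 * C * u a" .
      have "\<bar>\<gamma> a * W (p a) (y g 0)\<bar> \<le> 1 * \<bar>W (p a) (y g 0)\<bar>"
        unfolding abs_mult using \<gamma>[of a] by (intro mult_right_mono) auto
      then show ?thesis
        unfolding factor_def unfolding ya[OF a, symmetric] unfolding y0[symmetric] using 1 2 by linarith
    qed
    then have "\<bar>Pr n p \<gamma> (X s t g)\<bar> \<le> (\<Prod>a\<in>{1..n}. 3 * C * u a)"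
      unfolding Pr_def abs_prod by (intro prod_mono) auto
    also have "\<dots> = (3 * C) ^ n * (\<Prod>a\<in>{1..n}. u a)"
      by (simp add: prod.distrib)
    also have "\<dots> \<le> (3 * C) ^ n * T g"
    proof (intro mult_left_mono prod_le_of_powers)
      fix a assume a: "a \<in> {1..n}"
      have e: "exp (2 * \<epsilon> * z\<^sup>2) ^ n \<le> exp (1 / 32 * z\<^sup>2)" for z
      proof -
        have "exp (2 * \<epsilon> * z\<^sup>2) ^ n = exp (real n * (2 * \<epsilon>) * z\<^sup>2)"
          by (simp add: exp_of_nat_mult [symmetric] mult.assoc)
        also have "\<dots> \<le> exp (1 / 32 * z\<^sup>2)"
          unfolding exp_le_cancel_iff using \<epsilon>(3) by (intro mult_right_mono) auto
        finally show ?thesis .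
      qed
      have t: "exp (1 / 32 * (y g v)\<^sup>2) \<le> T g" if "v \<in> {0..n}" for v
        unfolding T_def using that by (intro member_le_sum) auto
      have "u a ^ n \<le> T g"
        unfolding u_def using e[of "y g a"] e[of "y g 0"] t[of a] t[of 0] a
        by (auto simp: max_def)
      then show "0 \<le> u a \<and> u a ^ card {1..n} \<le> T g"
        by (auto simp: u_def le_max_iff_disj)
    qed (use n T0 C_nonneg in auto)
    finally show ?thesis .
  qed
  have sq: "8 * (1 / 32) * (\<Sum>i\<in>I. (cy v i)\<^sup>2) \<le> 3" if v: "v \<in> {0..n}" for v
  proof (cases "v = 0")
    case True
    then show ?thesis
      using coef_square_sums(1)[OF s, of 1 t] n by (simp add: cy_def)
  next
    case False
    have "(\<Sum>i\<in>I. (cy v i)\<^sup>2) \<le> (\<Sum>i\<in>I. 2 * (coef s 0 i t)\<^sup>2 + 2 * (coef s v i t)\<^sup>2)"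
      using False unfolding cy_def by (intro sum_mono) (auto intro: square_sum_le)
    also have "\<dots> = 2 * (\<Sum>i\<in>I. (coef s 0 i t)\<^sup>2) + 2 * (\<Sum>i\<in>I. (coef s v i t)\<^sup>2)"
      by (simp add: sum.distrib sum_distrib_left)
    also have "\<dots> \<le> 2 * 1 + 2 * 4"
      using False v by (intro add_mono mult_left_mono coef_square_sums s) auto
    finally show ?thesis by simp
  qed
  have iT: "integrable (gaussian_coords I) (\<lambda>g. exp (1 / 32 * (y g v)\<^sup>2))"
    "(LINT g|gaussian_coords I. exp (1 / 32 * (y g v)\<^sup>2)) \<le> 2" if v: "v \<in> {0..n}" for v
    unfolding y_def using sq[OF v] by (intro exp_square_linear_form finite_I; simp)+
  have "\<bar>EP p \<gamma> s t\<bar> \<le> (LINT g|gaussian_coords I. \<bar>Pr n p \<gamma> (X s t g)\<bar>)"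
    unfolding EP_def by (rule integral_abs_bound)
  also have "\<dots> \<le> (LINT g|gaussian_coords I. (3 * C) ^ n * T g)"
    using pw Pr_integrable[OF s] iT unfolding T_def
    by (intro integral_mono integrable_mult_right Bochner_Integration.integrable_sum) auto
  also have "\<dots> = (3 * C) ^ n * (\<Sum>v\<in>{0..n}. LINT g|gaussian_coords I. exp (1 / 32 * (y g v)\<^sup>2))"
    unfolding T_def using iT by (simp add: Bochner_Integration.integral_sum)
  also have "\<dots> \<le> (3 * C) ^ n * (\<Sum>v\<in>{0..n}. 2)"
    using C_nonneg iT by (intro mult_left_mono sum_mono) auto
  finally show ?thesis by (simp add: algebra_simps)
qed

text \<open>The deviation of the overlap from \<open>q\<close>, averaged over no replica, one replica or both replicas.\<close>

definition ovl where "ovl \<sigma> \<tau> = overlap N \<sigma> \<tau> - q" for \<sigma> \<tau>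
definition ovl1 where "ovl1 \<sigma> = (\<Sum>\<tau>\<in>spins N. w \<tau> * ovl \<sigma> \<tau>)" for \<sigma>
definition ovl2 where "ovl2 = (\<Sum>\<sigma>\<in>spins N. w \<sigma> * ovl1 \<sigma>)"
definition overlap_power_mean where "overlap_power_mean = (\<Sum>\<sigma>\<in>spins N. w \<sigma> * (\<Sum>\<tau>\<in>spins N. w \<tau> * \<bar>ovl \<sigma> \<tau>\<bar> ^ n))"

lemma unit_spin_product: "(\<Sum>j\<in>{1..N}. unit_spin \<sigma> j * unit_spin \<tau> j) = ovl \<sigma> \<tau> + q"
proof -
  have "sqrt (real N) * sqrt (real N) = real N" by simp
  then show ?thesis
    by (simp add: ovl_def overlap_def unit_spin_def sum_divide_distrib)
qed

lemma unit_spin_mean: "(\<Sum>j\<in>{1..N}. unit_spin \<sigma> j * mean j) = ovl1 \<sigma> + q"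
proof -
  have "(\<Sum>j\<in>{1..N}. unit_spin \<sigma> j * mean j) = (\<Sum>\<tau>\<in>spins N. w \<tau> * (\<Sum>j\<in>{1..N}. unit_spin \<sigma> j * unit_spin \<tau> j))"
    unfolding mean_def sum_distrib_left by (subst sum.swap) (simp add: mult_ac)
  also have "\<dots> = ovl1 \<sigma> + q"
    unfolding unit_spin_product ovl1_def using sum_w
    by (simp add: distrib_left sum.distrib sum_distrib_right [symmetric])
  finally show ?thesis .
qed

lemma mean_mean: "(\<Sum>j\<in>{1..N}. mean j * mean j) = ovl2 + q"
proof -
  have "(\<Sum>j\<in>{1..N}. mean j * mean j) = (\<Sum>\<sigma>\<in>spins N. w \<sigma> * (\<Sum>j\<in>{1..N}. unit_spin \<sigma> j * mean j))"
    unfolding mean_def [of "_"] sum_distrib_left sum_distrib_right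
    by (subst sum.swap) (simp add: mult_ac)
  also have "\<dots> = ovl2 + q"
    unfolding unit_spin_mean ovl2_def using sum_w
    by (simp add: distrib_left sum.distrib sum_distrib_right [symmetric])
  finally show ?thesis .
qed

lemma dev_mean: "(\<Sum>j\<in>{1..N}. dev \<sigma> j * mean j) = ovl1 \<sigma> - ovl2"
  unfolding dev_def left_diff_distrib sum_subtractf unit_spin_mean mean_mean by simp

lemma dev_dev: "(\<Sum>j\<in>{1..N}. dev \<sigma> j * dev \<tau> j) = ovl \<sigma> \<tau> - ovl1 \<sigma> - ovl1 \<tau> + ovl2"
proof -
  have "(\<Sum>j\<in>{1..N}. dev \<sigma> j * dev \<tau> j) = (\<Sum>j\<in>{1..N}. unit_spin \<sigma> j * unit_spin \<tau> j)
      - (\<Sum>j\<in>{1..N}. unit_spin \<sigma> j * mean j) - (\<Sum>j\<in>{1..N}. unit_spin \<tau> j * mean j) + (\<Sum>j\<in>{1..N}. mean j * mean j)"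
    unfolding dev_def sum_subtractf [symmetric] sum.distrib [symmetric]
    by (intro sum.cong refl) (simp add: algebra_simps)
  then show ?thesis
    unfolding unit_spin_product unit_spin_mean mean_mean by simp
qed

lemma ovl_diag: "\<sigma> \<in> spins N \<Longrightarrow> ovl \<sigma> \<sigma> = \<rho>\<^sup>2"
  using spin_square[of \<sigma> N] N by (simp add: ovl_def overlap_def \<rho>_square)

lemma ovl1_moment: "(\<Sum>\<sigma>\<in>spins N. w \<sigma> * \<bar>ovl1 \<sigma>\<bar> ^ n) \<le> overlap_power_mean"
  unfolding overlap_power_mean_def ovl1_def using n w_nonneg by (intro sum_mono mult_left_mono power_mean) auto

lemma ovl2_moment: "\<bar>ovl2\<bar> ^ n \<le> overlap_power_mean"
  unfolding ovl2_def using ovl1_moment power_mean[of n ovl1] n by linarith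

lemma overlap_power_mean_nonneg: "0 \<le> overlap_power_mean"
  unfolding overlap_power_mean_def using w_nonneg by (intro sum_nonneg mult_nonneg_nonneg) auto

text \<open>Every discrepancy is a signed sum of four terms, each of which is \<open>R - q\<close> averaged over none, one or
  both of its replicas, or zero. Their moments are bounded by Jensen's inequality.\<close>

lemma cov_moment:
  assumes a: "a \<in> {1..n}" and b: "b \<in> {0..n}"
  shows "rav (\<lambda>s. \<bar>cov s a b\<bar> ^ n) \<le> 4 ^ n * (4 * overlap_power_mean)"
proof -
  (* for a loop the term ovl cancels against \<rho>^2, since every spin vector has norm one *)
  define f where "f s = (if b = 0 \<or> a = b then 0 else ovl (s a) (s b))" for s
  define g where "g s = (if b = 0 then 0 else - ovl1 (s b))" for s
  define h where "h s = (if b = 0 then ovl1 (s a) else - ovl1 (s a))" for s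
  define k where "k = (if b = 0 then - ovl2 else ovl2)"
  have a0: "a \<noteq> 0" using a by simp
  have n0: "n \<noteq> 0" using n by simp
  have "cov s a b = f s + g s + h s + k" if "s \<in> R" for s
    using ovl_diag[OF R_mem[OF that a]] a0 unfolding cov_def dev_mean dev_dev
    by (auto simp: f_def g_def h_def k_def)
  then have "rav (\<lambda>s. \<bar>cov s a b\<bar> ^ n) = rav (\<lambda>s. \<bar>f s + g s + h s + k\<bar> ^ n)"
    by (intro rav_cong) simp
  also have "\<dots> \<le> rav (\<lambda>s. 4 ^ n * (\<bar>f s\<bar> ^ n + \<bar>g s\<bar> ^ n + \<bar>h s\<bar> ^ n + \<bar>k\<bar> ^ n))"
    by (intro rav_mono abs_sum4_power_le)
  also have "\<dots> = 4 ^ n * (rav (\<lambda>s. \<bar>f s\<bar> ^ n) + rav (\<lambda>s. \<bar>g s\<bar> ^ n) + rav (\<lambda>s. \<bar>h s\<bar> ^ n) + \<bar>k\<bar> ^ n)"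
    by (simp add: rav_cmult rav_add rav_const)
  also have "\<dots> \<le> 4 ^ n * (overlap_power_mean + overlap_power_mean + overlap_power_mean + overlap_power_mean)"
  proof (intro mult_left_mono add_mono)
    show "rav (\<lambda>s. \<bar>f s\<bar> ^ n) \<le> overlap_power_mean"
    proof (cases "b = 0 \<or> a = b")
      case True
      then show ?thesis using n0 overlap_power_mean_nonneg by (auto simp: f_def rav_const power_0_left)
    next
      case False
      then have "rav (\<lambda>s. \<bar>f s\<bar> ^ n) = overlap_power_mean"
        using rav_pair[of a b "\<lambda>\<sigma> \<tau>. \<bar>ovl \<sigma> \<tau>\<bar> ^ n"] a b by (simp add: f_def overlap_power_mean_def)
      then show ?thesis by simp
    qed
    show "rav (\<lambda>s. \<bar>g s\<bar> ^ n) \<le> overlap_power_mean"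
    proof (cases "b = 0")
      case True
      then show ?thesis using n0 overlap_power_mean_nonneg by (simp add: g_def rav_const power_0_left)
    next
      case False
      then show ?thesis
        using rav_single[of b "\<lambda>\<sigma>. \<bar>ovl1 \<sigma>\<bar> ^ n"] ovl1_moment b by (simp add: g_def)
    qed
    have "rav (\<lambda>s. \<bar>h s\<bar> ^ n) = rav (\<lambda>s. \<bar>ovl1 (s a)\<bar> ^ n)"
      by (intro rav_cong) (auto simp: h_def)
    then show "rav (\<lambda>s. \<bar>h s\<bar> ^ n) \<le> overlap_power_mean"
      using rav_single[OF a, of "\<lambda>\<sigma>. \<bar>ovl1 \<sigma>\<bar> ^ n"] ovl1_moment by simp
    show "\<bar>k\<bar> ^ n \<le> overlap_power_mean" using ovl2_moment by (simp add: k_def)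
  qed auto
  finally show ?thesis by simp
qed

lemma cov_product_moment:
  assumes L: "valid L" "length L = n"
  shows "rav (\<lambda>s. \<bar>cov_product s L\<bar>) \<le> real n * (real n + 1) * (4 ^ n * (4 * overlap_power_mean))"
proof -
  define T where "T s = (\<Sum>a\<in>{1..n}. \<Sum>b\<in>{0..n}. \<bar>cov s a b\<bar> ^ n)" for s
  have T0: "0 \<le> T s" for s unfolding T_def by (intro sum_nonneg) auto
  have "\<bar>cov_product s L\<bar> \<le> T s" for s
  proof -
    have "\<bar>cov_product s L\<bar> = prod_list (map (\<lambda>(a, b). \<bar>cov s a b\<bar>) L)"
      unfolding cov_product_def by (induction L) (auto simp: abs_mult)
    also have "\<dots> \<le> T s"
    proof (rule prod_list_le_of_powers)
      fix x assume "x \<in> set (map (\<lambda>(a, b). \<bar>cov s a b\<bar>) L)"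
      then obtain a b where ab: "(a, b) \<in> set L" "x = \<bar>cov s a b\<bar>" by auto
      have v: "a \<in> {1..n}" "b \<in> {0..n}" using L(1) ab(1) by (auto simp: valid_def)
      have "\<bar>cov s a b\<bar> ^ n \<le> (\<Sum>b\<in>{0..n}. \<bar>cov s a b\<bar> ^ n)"
        using v by (intro member_le_sum) auto
      also have "\<dots> \<le> T s"
        unfolding T_def using v by (intro member_le_sum) (auto intro: sum_nonneg)
      finally show "0 \<le> x \<and> x ^ length (map (\<lambda>(a, b). \<bar>cov s a b\<bar>) L) \<le> T s"
        using ab L by simp
    qed (use L n T0 in auto)
    finally show ?thesis .
  qed
  then have "rav (\<lambda>s. \<bar>cov_product s L\<bar>) \<le> rav T" by (intro rav_mono)
  also have "\<dots> = (\<Sum>a\<in>{1..n}. \<Sum>b\<in>{0..n}. rav (\<lambda>s. \<bar>cov s a b\<bar> ^ n))"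
    unfolding T_def [abs_def] rav_sum ..
  also have "\<dots> \<le> (\<Sum>a\<in>{1..n}. \<Sum>b\<in>{0..n}. 4 ^ n * (4 * overlap_power_mean))"
    by (intro sum_mono cov_moment)
  finally show ?thesis by (simp add: algebra_simps)
qed

text \<open>The constant of \<open>EP_bound\<close> times that of \<open>cov_product_moment\<close>.\<close>

definition K0 where "K0 = (3 * C) ^ n * (2 * (real n + 1)) * (real n * (real n + 1) * (4 ^ n * (4 * overlap_power_mean)))"

lemma K0_nonneg: "0 \<le> K0"
  using C_nonneg overlap_power_mean_nonneg by (simp add: K0_def)

lemma centring_bounds: "0 \<le> centring L a" "centring L a \<le> 1"
  by (auto simp: centring_def)

text \<open>Downward induction on the number of edges. A term with \<open>n\<close> edges is bounded directly. A term with
  fewer edges vanishes at \<open>t = 0\<close>, its derivative consists of \<open>2 n\<^sup>2\<close> terms with one more edge, and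
  the path has length at most 2.\<close>

lemma Phi_bound:
  assumes "valid L" "length L + m = n" "\<And>a. p a \<le> 2 * length L" "0 \<le> t" "t \<le> pi / 2"
  shows "\<bar>Phi L p t\<bar> \<le> (4 * (real n)\<^sup>2) ^ m * K0"
  using assms
proof (induction m arbitrary: L p t)
  case 0
  have "\<bar>Phi L p t\<bar> \<le> rav (\<lambda>s. \<bar>cov_product s L * EP p (centring L) s t\<bar>)"
    unfolding Phi_def by (rule abs_rav_le)
  also have "\<dots> \<le> rav (\<lambda>s. \<bar>cov_product s L\<bar> * ((3 * C) ^ n * (2 * (real n + 1))))"
    unfolding abs_mult using 0 centring_bounds by (intro rav_mono mult_left_mono EP_bound) auto
  also have "\<dots> = rav (\<lambda>s. \<bar>cov_product s L\<bar>) * ((3 * C) ^ n * (2 * (real n + 1)))"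
    by (rule rav_cmult)
  also have "\<dots> \<le> real n * (real n + 1) * (4 ^ n * (4 * overlap_power_mean)) * ((3 * C) ^ n * (2 * (real n + 1)))"
    using 0 C_nonneg by (intro mult_right_mono cov_product_moment) auto
  finally show ?case by (simp add: K0_def mult_ac)
next
  case (Suc m)
  define B where "B = (4 * (real n)\<^sup>2) ^ m * K0"
  have B: "B \<ge> 0" using K0_nonneg by (simp add: B_def)
  have IH: "\<bar>Phi ((a, b) # L) (inc (inc p a) c) u\<bar> \<le> B"
    if "a \<in> {1..n}" "b \<in> {0..n}" "0 \<le> u" "u \<le> pi / 2" for a b c u
    unfolding B_def
  proof (rule Suc.IH)
    show "(inc (inc p a) c) e \<le> 2 * length ((a, b) # L)" for e
      using Suc.prems(3)[of e] Suc.prems(3)[of a] Suc.prems(3)[of c] by auto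
  qed (use Suc.prems that in \<open>auto simp: valid_Cons\<close>)
  have step: "\<bar>x * y + z * v\<bar> \<le> 2 * B" if "\<bar>x\<bar> \<le> 1" "\<bar>y\<bar> \<le> B" "\<bar>z\<bar> \<le> 1" "\<bar>v\<bar> \<le> B" for x y z v :: real
  proof -
    have "\<bar>x * y\<bar> \<le> 1 * B" "\<bar>z * v\<bar> \<le> 1 * B"
      unfolding abs_mult using that by (intro mult_mono; simp)+
    then show ?thesis by linarith
  qed
  have sc: "\<bar>sin u * cos u\<bar> \<le> 1" for u :: real
    unfolding abs_mult by (intro mult_le_one) auto
  have "norm (Phi L p t - Phi L p 0) \<le> (2 * (real n)\<^sup>2 * B) * norm (t - 0)"
  proof (rule field_differentiable_bound[where S = "{0..pi / 2}"])
    fix u :: real assume u: "u \<in> {0..pi / 2}"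
    show "(Phi L p has_real_derivative (\<Sum>a\<in>{1..n}. \<Sum>b\<in>{1..n}.
      sin u * cos u * Phi ((a, b) # L) (inc (inc p a) b) u + cos u * Phi ((a, 0) # L) (inc (inc p a) b) u))
      (at u within {0..pi / 2})"
      by (rule has_field_derivative_at_within[OF Phi_derivative])
    have "\<bar>\<Sum>a\<in>{1..n}. \<Sum>b\<in>{1..n}.
      sin u * cos u * Phi ((a, b) # L) (inc (inc p a) b) u + cos u * Phi ((a, 0) # L) (inc (inc p a) b) u\<bar>
      \<le> (\<Sum>a\<in>{1..n}. \<Sum>b\<in>{1..n}. 2 * B)"
      using u by (intro order_trans[OF sum_abs] sum_mono step sc IH) auto
    then show "norm (\<Sum>a\<in>{1..n}. \<Sum>b\<in>{1..n}.
      sin u * cos u * Phi ((a, b) # L) (inc (inc p a) b) u + cos u * Phi ((a, 0) # L) (inc (inc p a) b) u)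
      \<le> 2 * (real n)\<^sup>2 * B"
      by (simp add: power2_eq_square mult_ac)
  qed (use Suc.prems in auto)
  moreover have "Phi L p 0 = 0"
    using Suc.prems by (intro Phi_start) simp
  ultimately have "\<bar>Phi L p t\<bar> \<le> (2 * (real n)\<^sup>2 * B) * t"
    using Suc.prems by simp
  also have "\<dots> \<le> (2 * (real n)\<^sup>2 * B) * 2"
    using Suc.prems pi_less_4 B by (intro mult_left_mono) auto
  finally show ?case by (simp add: B_def mult_ac)
qed

definition Dev where "Dev g = (\<Sum>\<sigma>\<in>spins N. w \<sigma> * A 0 (\<Sum>j\<in>{1..N}. unit_spin \<sigma> j * g j))
  - W 0 (\<Sum>j\<in>{1..N}. mean j * g j)" for g :: "nat \<Rightarrow> real"

text \<open>For an arbitrary probability weight on the spins, the moment is the term of the empty graph at the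
  end of the interpolation.\<close>

theorem cavity_moment:
  "integrable (gaussian_coords {1..N}) (\<lambda>g. Dev g ^ n)"
  "(LINT g|gaussian_coords {1..N}. Dev g ^ n) \<le> (4 * (real n)\<^sup>2) ^ n * K0"
proof -
  have x0: "X s (pi / 2) g 0 = (\<Sum>j\<in>{1..N}. mean j * g j)" for s g
    unfolding X_def sum_I by (simp add: coef_def)
  have xa: "X s (pi / 2) g 0 + X s (pi / 2) g a = (\<Sum>j\<in>{1..N}. unit_spin (s a) j * g j)" if "a \<in> {1..n}" for s g a
  proof -
    have "X s (pi / 2) g a = (\<Sum>j\<in>{1..N}. dev (s a) j * g j)"
    proof -
      have "(\<Sum>b\<in>{1..n}. coef s a (N + b) (pi / 2) * g (N + b)) = 0"
        by (intro sum.neutral) (auto simp: coef_def)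
      moreover have "(\<Sum>j\<in>{1..N}. coef s a j (pi / 2) * g j) = (\<Sum>j\<in>{1..N}. dev (s a) j * g j)"
        using that by (intro sum.cong) (auto simp: coef_def)
      ultimately show ?thesis unfolding X_def sum_I by simp
    qed
    then show ?thesis
      unfolding x0 by (simp add: dev_def left_diff_distrib sum_subtractf)
  qed
  have Pr: "Pr n (\<lambda>_. 0) (centring []) (X s (pi / 2) g) =
      (\<Prod>a\<in>{1..n}. A 0 (\<Sum>j\<in>{1..N}. unit_spin (s a) j * g j) - W 0 (\<Sum>j\<in>{1..N}. mean j * g j))" for s g
    unfolding Pr_def factor_def
  proof (intro prod.cong refl)
    fix a assume a: "a \<in> {1..n}"
    show "A 0 (X s (pi / 2) g 0 + X s (pi / 2) g a) - centring [] a * W 0 (X s (pi / 2) g 0)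
      = A 0 (\<Sum>j\<in>{1..N}. unit_spin (s a) j * g j) - W 0 (\<Sum>j\<in>{1..N}. mean j * g j)"
      unfolding xa[OF a] unfolding x0 by (simp add: centring_def deg_def)
  qed
  have Dev: "Dev g ^ n = rav (\<lambda>s. Pr n (\<lambda>_. 0) (centring []) (X s (pi / 2) g))" for g
  proof -
    have "Dev g = (\<Sum>\<sigma>\<in>spins N. w \<sigma> * (A 0 (\<Sum>j\<in>{1..N}. unit_spin \<sigma> j * g j) - W 0 (\<Sum>j\<in>{1..N}. mean j * g j)))"
      using sum_w by (simp add: Dev_def right_diff_distrib sum_subtractf sum_distrib_right [symmetric])
    then show ?thesis unfolding Pr by (simp add: rav_prod)
  qed
  have int: "integrable (gaussian_coords I) (\<lambda>g. Dev g ^ n)"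
    unfolding Dev rav_def
    by (intro Bochner_Integration.integrable_sum integrable_mult_right Pr_integrable)
  have val: "(LINT g|gaussian_coords I. Dev g ^ n) = Phi [] (\<lambda>_. 0) (pi / 2)"
    unfolding Dev Phi_def rav_def EP_def cov_product_def using Pr_integrable
    by (subst Bochner_Integration.integral_sum) auto
  have sub: "{1..N} \<subseteq> I" by (auto simp: I_def)
  have meas: "(\<lambda>g. Dev g ^ n) \<in> borel_measurable (gaussian_coords {1..N})"
  proof -
    have [measurable]: "(\<lambda>g. \<Sum>j\<in>{1..N}. z j * g j) \<in> borel_measurable (gaussian_coords {1..N})" for z :: "nat \<Rightarrow> real"
      by (intro borel_measurable_sum borel_measurable_times borel_measurable_const measurable_gaussian_coord)
    show ?thesis unfolding Dev_def by measurable
  qed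
  have dep: "Dev (restrict g {1..N}) ^ n = Dev g ^ n" for g
    by (simp add: Dev_def)
  note marg = gaussian_coords_marginal[OF finite_I sub meas dep]
  show "integrable (gaussian_coords {1..N}) (\<lambda>g. Dev g ^ n)"
    using int marg(1) by simp
  have "Phi [] (\<lambda>_. 0) (pi / 2) \<le> \<bar>Phi [] (\<lambda>_. 0) (pi / 2)\<bar>" by simp
  also have "\<dots> \<le> (4 * (real n)\<^sup>2) ^ n * K0"
    by (rule Phi_bound) (auto simp: valid_def)
  finally show "(LINT g|gaussian_coords {1..N}. Dev g ^ n) \<le> (4 * (real n)\<^sup>2) ^ n * K0"
    using val marg(2) by simp
qed

end

section \<open>Moments of the cavity field\<close>

lemma moderate_growth_bound:
  fixes f :: "real \<Rightarrow> real"
  assumes "moderate_growth f" "a > 0"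
  shows "\<exists>C. \<forall>x. \<bar>f x\<bar> \<le> C * exp (a * x\<^sup>2)"
proof -
  have cont: "continuous_on UNIV f" and lim: "((\<lambda>x. f x * exp (- a * (norm x)\<^sup>2)) \<longlongrightarrow> 0) at_infinity"
    using assms by (auto simp: moderate_growth_def)
  from lim have "eventually (\<lambda>x. dist (f x * exp (- a * (norm x)\<^sup>2)) 0 < 1) at_infinity"
    by (rule tendstoD) simp
  then obtain b where b: "\<And>x. b \<le> norm x \<Longrightarrow> \<bar>f x * exp (- a * (norm x)\<^sup>2)\<bar> < 1"
    unfolding eventually_at_infinity by auto
  have "compact (f ` {- \<bar>b\<bar>..\<bar>b\<bar>})"
    by (intro compact_continuous_image continuous_on_subset[OF cont]) auto
  then obtain B where B: "\<And>x. x \<in> {- \<bar>b\<bar>..\<bar>b\<bar>} \<Longrightarrow> \<bar>f x\<bar> \<le> B"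
    using compact_imp_bounded bounded_iff by (metis imageI real_norm_def)
  have "\<bar>f x\<bar> \<le> max 1 B * exp (a * x\<^sup>2)" for x
  proof (cases "b \<le> norm x")
    case True
    have "exp (- a * (norm x)\<^sup>2) * exp (a * x\<^sup>2) = 1"
      by (simp add: exp_add [symmetric])
    then have "\<bar>f x\<bar> = \<bar>f x * exp (- a * (norm x)\<^sup>2)\<bar> * exp (a * x\<^sup>2)"
      by (simp add: abs_mult mult.assoc)
    also have "\<dots> \<le> max 1 B * exp (a * x\<^sup>2)"
      using b[OF True] by (intro mult_right_mono) auto
    finally show ?thesis .
  next
    case False
    then have "\<bar>f x\<bar> \<le> B" by (intro B) auto
    also have "B \<le> max 1 B * 1" by simp
    also have "\<dots> \<le> max 1 B * exp (a * x\<^sup>2)"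
      using assms(2) by (intro mult_left_mono) auto
    finally show ?thesis .
  qed
  then show ?thesis by blast
qed

lemma test_family_derivatives:
  assumes "smooth U" "\<And>n. moderate_growth ((deriv ^^ n) U)"
  shows "test_family (\<lambda>p. (deriv ^^ p) U)"
proof
  show "((deriv ^^ p) U has_real_derivative (deriv ^^ Suc p) U x) (at x)" for p x
    using assms(1) by (simp add: smooth_def DERIV_deriv_iff_real_differentiable)
  show "\<exists>C. \<forall>x. \<bar>(deriv ^^ p) U x\<bar> \<le> C * exp (a * x\<^sup>2)" if "a > 0" for p a
    using assms(2) that by (rule moderate_growth_bound)
qed

text \<open>An affine change of variables. For \<open>v = 0\<close> the density degenerates to the zero function, hence the
  strict inequality.\<close>

lemma gaussian_average_eq:
  assumes "v > 0" and [measurable]: "U \<in> borel_measurable borel"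
  shows "gaussian_average r v U = (LINT z|std_gaussian. U (r + sqrt v * z))"
proof -
  define s where "s = sqrt v"
  have s: "s > 0" using assms by (simp add: s_def)
  have dens: "s * normal_density r s (r + s * z) = std_normal_density z" for z
  proof -
    have "(r + s * z - r)\<^sup>2 / (2 * s\<^sup>2) = (z - 0)\<^sup>2 / (2 * 1\<^sup>2)"
      using s by (simp add: power_mult_distrib)
    moreover have "sqrt (2 * pi * s\<^sup>2) = sqrt (2 * pi * 1\<^sup>2) * s"
      using s by (simp add: real_sqrt_mult)
    ultimately show ?thesis
      using s unfolding normal_density_def by (simp add: minus_divide_left [symmetric])
  qed
  have "gaussian_average r v U = (LINT x|lborel. U x * normal_density r s x)"
    by (simp add: gaussian_average_def s_def)
  also have "\<dots> = \<bar>s\<bar> *\<^sub>R (LINT z|lborel. U (r + s * z) * normal_density r s (r + s * z))"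
    using s by (intro lborel_integral_real_affine) auto
  also have "\<dots> = (LINT z|lborel. std_normal_density z * U (r + s * z))"
    using s unfolding dens [symmetric] by (simp add: mult_ac)
  also have "\<dots> = (LINT z|std_gaussian. U (r + s * z))"
    by (subst integral_std_gaussian) auto
  finally show ?thesis by (simp add: s_def)
qed

lemma gibbs_weight_nonneg: "0 \<le> gibbs_weight \<beta> h N G \<sigma>"
  by (simp add: gibbs_weight_def partition_function_def sum_nonneg)

lemma sum_gibbs_weight: "(\<Sum>\<sigma>\<in>spins N. gibbs_weight \<beta> h N G \<sigma>) = 1"
proof -
  have "partition_function \<beta> h N G > 0"
    unfolding partition_function_def by (intro sum_pos) auto
  then show ?thesis
    by (simp add: gibbs_weight_def partition_function_def sum_divide_distrib [symmetric])
qed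

lemma gibbs_weight_measurable:
  "(\<lambda>G. gibbs_weight \<beta> h N G \<sigma>) \<in> borel_measurable (gaussian_coords (pairs N))"
proof -
  have "(\<lambda>G. exp (- hamiltonian \<beta> h N G \<sigma>)) \<in> borel_measurable (gaussian_coords (pairs N))" for \<sigma>
    unfolding hamiltonian_def split_def
    by (intro measurable_compose[OF _ borel_measurable_exp] borel_measurable_uminus borel_measurable_add borel_measurable_sum
        borel_measurable_times borel_measurable_const) (auto intro: measurable_gaussian_coord)
  then show ?thesis
    unfolding gibbs_weight_def partition_function_def
    by (intro borel_measurable_divide borel_measurable_sum)
qed

theorem theorem2:
  fixes \<beta>\<^sub>0 :: real and k :: nat and U :: "real \<Rightarrow> real"
  assumes "0 < \<beta>\<^sub>0" and "\<beta>\<^sub>0 < 1 / 2"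
    and "smooth U"
    and "\<And>n. moderate_growth ((deriv ^^ n) U)"
  shows "\<exists>K::real. \<forall>N::nat. \<forall>\<beta> h :: real. 1 \<le> N \<and> 0 < \<beta> \<and> \<beta> \<le> \<beta>\<^sub>0 \<longrightarrow>
    (let D = (\<lambda>(G, g).
           gibbs_average \<beta> h N G (\<lambda>\<sigma>. U (cavity_field N g \<sigma>))
           - gaussian_average (quenched_cavity_field \<beta> h N G g) (1 - sk_q \<beta> h) U)
     in integrable (disorder N) (\<lambda>\<omega>. D \<omega> ^ (2 * k)) \<and>
        (LINT \<omega>|disorder N. D \<omega> ^ (2 * k)) \<le> K / real N ^ k)"
proof (cases "k = 0")
  case True
  have "prob_space (disorder N)" for N
    unfolding disorder_def gaussian_coords_def [symmetric]
    by (intro prob_space_pair prob_space_gaussian_coords)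
  then have "integrable (disorder N) (\<lambda>_. 1 :: real)" "measure (disorder N) (space (disorder N)) = 1" for N
    by (auto simp: prob_space.prob_space intro!: finite_measure.integrable_const prob_space.finite_measure)
  then show ?thesis
    using True by (intro exI[of _ 1]) (auto simp: Let_def)
next
  case False
  define n where "n = 2 * k"
  define A where "A p = (deriv ^^ p) U" for p
  interpret tf: test_family A
    unfolding A_def [abs_def] by (rule test_family_derivatives[OF assms(3,4)])
  have A0: "A 0 = U" by (simp add: A_def)
  obtain C where C: "\<And>p x. p \<le> 2 * n \<Longrightarrow> \<bar>A p x\<bar> \<le> C * exp (1 / (64 * (real n + 1)) * x\<^sup>2)"
  proof -
    have "\<exists>C\<ge>0. \<forall>p\<in>{..2 * n}. \<forall>x. \<bar>A p x\<bar> \<le> C * exp (1 / (64 * (real n + 1)) * x\<^sup>2)"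
      by (intro uniform_constant tf.A_growth) auto
    then show ?thesis using that by auto
  qed
  obtain Ko where Ko: "\<And>N \<beta> h. 1 \<le> N \<and> 0 < \<beta> \<and> \<beta> \<le> \<beta>\<^sub>0 \<Longrightarrow>
    integrable (gaussian_coords (pairs N)) (overlap_moment \<beta> h N (2 * k)) \<and>
    (LINT G|gaussian_coords (pairs N). overlap_moment \<beta> h N (2 * k) G) \<le> Ko / real N ^ k"
    using overlap_concentration[OF assms(1,2), of k] by auto
  have C0: "C \<ge> 0" using C[of 0 0] by simp
  define Kc where "Kc = (4 * (real n)\<^sup>2) ^ n * ((3 * C) ^ n * (2 * (real n + 1)) * (real n * (real n + 1) * (4 ^ n * 4)))"
  have Kc: "Kc \<ge> 0" using C0 by (simp add: Kc_def)
  show ?thesis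
  proof (intro exI[of _ "Kc * Ko"] allI impI)
    fix N :: nat and \<beta> h :: real
    assume H: "1 \<le> N \<and> 0 < \<beta> \<and> \<beta> \<le> \<beta>\<^sub>0"
    define q where "q = sk_q \<beta> h"
    have q: "0 \<le> q" "q < 1"
      using sk_q_fixed_point[of \<beta> h] H assms(2) by (auto simp: q_def)
    interpret sf: smoothed_family A "sqrt (1 - q)"
      by standard (use q in auto)
    have cav: "cavity A (sqrt (1 - q)) N (gibbs_weight \<beta> h N G) n q C" for G
      by standard
        (use H q False C in \<open>auto simp: n_def gibbs_weight_nonneg sum_gibbs_weight\<close>)
    define D where "D = (\<lambda>(G, g).
           gibbs_average \<beta> h N G (\<lambda>\<sigma>. U (cavity_field N g \<sigma>))
           - gaussian_average (quenched_cavity_field \<beta> h N G g) (1 - sk_q \<beta> h) U)"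
    have Um [measurable]: "U \<in> borel_measurable borel" using tf.A_measurable[of 0] by (simp add: A0)
    have D: "D (G, g) = (\<Sum>\<sigma>\<in>spins N. U (cavity_field N g \<sigma>) * gibbs_weight \<beta> h N G \<sigma>)
        - sf.W 0 (\<Sum>\<sigma>\<in>spins N. cavity_field N g \<sigma> * gibbs_weight \<beta> h N G \<sigma>)" for G g
      using q by (simp add: D_def gibbs_average_def quenched_cavity_field_def gaussian_average_eq
          sf.W_def A0 q_def [symmetric])
    let ?P = "gaussian_coords (pairs N)" and ?Q = "gaussian_coords {1..N}"
    interpret P: prob_space ?P by (rule prob_space_gaussian_coords)
    interpret Q: prob_space ?Q by (rule prob_space_gaussian_coords)
    interpret PQ: pair_sigma_finite ?P ?Q ..
    have dis: "disorder N = ?P \<Otimes>\<^sub>M ?Q"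
      by (simp add: disorder_def gaussian_coords_def)
    have Dm [measurable]: "D \<in> borel_measurable (?P \<Otimes>\<^sub>M ?Q)"
    proof -
      have [measurable]: "(\<lambda>\<omega>. gibbs_weight \<beta> h N (fst \<omega>) \<sigma>) \<in> borel_measurable (?P \<Otimes>\<^sub>M ?Q)" for \<sigma>
        by (rule measurable_compose[OF measurable_fst gibbs_weight_measurable])
      have "(\<lambda>g. cavity_field N g \<sigma>) \<in> borel_measurable ?Q" for \<sigma>
        unfolding cavity_field_def
        by (intro borel_measurable_sum borel_measurable_times borel_measurable_const measurable_gaussian_coord)
      from measurable_compose[OF measurable_snd this]
      have [measurable]: "(\<lambda>\<omega>. cavity_field N (snd \<omega>) \<sigma>) \<in> borel_measurable (?P \<Otimes>\<^sub>M ?Q)" for \<sigma> .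
      have "(\<lambda>\<omega>. D (fst \<omega>, snd \<omega>)) \<in> borel_measurable (?P \<Otimes>\<^sub>M ?Q)"
        unfolding D by measurable
      then show ?thesis by simp
    qed
    have even: "0 \<le> D \<omega> ^ n" for \<omega> by (simp add: n_def)
    (* the couplings G are fixed, and the Gibbs measure enters only as a probability weight on the spins *)
    have fibre: "(\<integral>\<^sup>+g. ennreal (D (G, g) ^ n) \<partial>?Q) \<le> ennreal (Kc * overlap_moment \<beta> h N n G)" for G
    proof -
      interpret cavity A "sqrt (1 - q)" N "gibbs_weight \<beta> h N G" n q C by (rule cav)
      have cf: "cavity_field N g \<sigma> = (\<Sum>j\<in>{1..N}. unit_spin \<sigma> j * g j)" for g \<sigma>
        by (simp add: cavity_field_def unit_spin_def sum_distrib_left mult_ac)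
      have mf: "(\<Sum>\<sigma>\<in>spins N. cavity_field N g \<sigma> * gibbs_weight \<beta> h N G \<sigma>) = (\<Sum>j\<in>{1..N}. mean j * g j)" for g
        unfolding cf mean_def sum_distrib_right by (subst sum.swap) (simp add: mult_ac)
      have De: "D (G, g) = Dev g" for g
        unfolding D mf unfolding cf Dev_def A0 by (simp add: mult.commute)
      have Mo: "overlap_power_mean = overlap_moment \<beta> h N n G"
        unfolding overlap_power_mean_def ovl_def overlap_moment_def gibbs_average_def q_def [symmetric]
        by (simp add: mult.commute)
      have "(LINT g|?Q. D (G, g) ^ n) \<le> Kc * overlap_moment \<beta> h N n G"
        using cavity_moment(2) unfolding De K0_def Mo Kc_def by (simp add: mult_ac)
      moreover have "integrable ?Q (\<lambda>g. D (G, g) ^ n)"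
        using cavity_moment(1) by (simp add: De)
      ultimately show ?thesis
        using even by (subst nn_integral_eq_integral) (auto intro: ennreal_leI)
    qed
    have Ko': "integrable ?P (overlap_moment \<beta> h N n)" "(LINT G|?P. overlap_moment \<beta> h N n G) \<le> Ko / real N ^ k"
      using Ko[OF H] by (auto simp: n_def)
    have nonneg: "0 \<le> overlap_moment \<beta> h N n G" for G
      unfolding overlap_moment_def gibbs_average_def
      by (intro sum_nonneg mult_nonneg_nonneg gibbs_weight_nonneg) auto
    have "(\<integral>\<^sup>+\<omega>. ennreal (D \<omega> ^ n) \<partial>(?P \<Otimes>\<^sub>M ?Q)) = (\<integral>\<^sup>+G. (\<integral>\<^sup>+g. ennreal (D (G, g) ^ n) \<partial>?Q) \<partial>?P)"
      by (rule Q.nn_integral_fst [symmetric]) measurable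
    also have "\<dots> \<le> (\<integral>\<^sup>+G. ennreal (Kc * overlap_moment \<beta> h N n G) \<partial>?P)"
      by (intro nn_integral_mono fibre)
    also have "\<dots> = ennreal (Kc * (LINT G|?P. overlap_moment \<beta> h N n G))"
      using Ko'(1) nonneg Kc by (subst nn_integral_eq_integral) auto
    also have "\<dots> \<le> ennreal (Kc * Ko / real N ^ k)"
      using mult_left_mono[OF Ko'(2) Kc] by (intro ennreal_leI) simp
    finally have le: "(\<integral>\<^sup>+\<omega>. ennreal (D \<omega> ^ n) \<partial>disorder N) \<le> ennreal (Kc * Ko / real N ^ k)"
      by (simp add: dis)
    have int: "integrable (disorder N) (\<lambda>\<omega>. D \<omega> ^ n)"
    proof (rule integrableI_bounded)
      show "(\<lambda>\<omega>. D \<omega> ^ n) \<in> borel_measurable (disorder N)" unfolding dis by measurable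
      show "(\<integral>\<^sup>+\<omega>. ennreal (norm (D \<omega> ^ n)) \<partial>disorder N) < \<infinity>"
        using le even by (simp add: order.strict_trans1)
    qed
    have "0 \<le> (LINT G|?P. overlap_moment \<beta> h N n G)"
      using nonneg by (intro Bochner_Integration.integral_nonneg) auto
    then have "0 \<le> Ko / real N ^ k" using Ko'(2) by linarith
    then have pos: "0 \<le> Kc * Ko / real N ^ k" using Kc by (metis mult_nonneg_nonneg times_divide_eq_right)
    have "ennreal (LINT \<omega>|disorder N. D \<omega> ^ n) \<le> ennreal (Kc * Ko / real N ^ k)"
      using le int even by (subst nn_integral_eq_integral [symmetric]) auto
    then have "(LINT \<omega>|disorder N. D \<omega> ^ n) \<le> Kc * Ko / real N ^ k"
      using pos by (subst (asm) ennreal_le_iff) auto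
    with int show "let D = (\<lambda>(G, g).
           gibbs_average \<beta> h N G (\<lambda>\<sigma>. U (cavity_field N g \<sigma>))
           - gaussian_average (quenched_cavity_field \<beta> h N G g) (1 - sk_q \<beta> h) U)
     in integrable (disorder N) (\<lambda>\<omega>. D \<omega> ^ (2 * k)) \<and>
        (LINT \<omega>|disorder N. D \<omega> ^ (2 * k)) \<le> Kc * Ko / real N ^ k"
      unfolding D_def [symmetric] Let_def n_def by simp
  qed
qed

end
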